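(* Let $0<\sigma<1$ and take $\alpha\in(0,1]$. (1) Let $v\in C^{0,\alpha}(\mathbb{T}^n)$ and $0<2\sigma<\alpha$. Then $(-\Delta_{\mathbb{T}^n})^\sigma v\in C^{0,\alpha-2\sigma}(\mathbb{T}^n)$ and $$\|(-\Delta_{\mathbb{T}^n})^\sigma v\|_{C^{0,\alpha-2\sigma}(\mathbb{T}^n)}\le C\|v\|_{C^{0,\alpha}(\mathbb{T}^n)}.$$ (2) Let $v\in C^{1,\alpha}(\mathbb{T}^n)$ and $0<2\sigma<\alpha$. Then $(-\Delta_{\mathbb{T}^n})^\sigma v\in C^{1,\alpha-2\sigma}(\mathbb{T}^n)$ and $$\|(-\Delta_{\mathbb{T}^n})^\sigma v\|_{C^{1,\alpha-2\sigma}(\mathbb{T}^n)}\le C\|v\|_{C^{1,\alpha}(\mathbb{T}^n)}.$$ (3) Let $v\in C^{1,\alpha}(\mathbb{T}^n)$ and $2\sigma\ge\alpha$, with $\alpha-2\sigma+1\neq0$. Then $(-\Delta_{\mathbb{T}^n})^\sigma v\in C^{0,\alpha-2\sigma+1}(\mathbb{T}^n)$ and $$\|(-\Delta_{\mathbb{T}^n})^\sigma v\|_{C^{0,\alpha-2\sigma+1}(\mathbb{T}^n)}\le C\|v\|_{C^{1,\alpha}(\mathbb{T}^n)}.$$ (4) Let $v\in C^{k,\alpha}(\mathbb{T}^n)$ and assume that $k+\alpha-2\sigma$ is not an integer. Then $(-\Delta_{\mathbb{T}^n})^\sigma v\in C^{l,\beta}(\mathbb{T}^n)$, where $l$ is the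 integer part of $k+\alpha-2\sigma$ and $\beta=k+\alpha-2\sigma-l$, and $$\|(-\Delta_{\mathbb{T}^n})^\sigma v\|_{C^{l,\beta}(\mathbb{T}^n)}\le C\|v\|_{C^{k,\alpha}(\mathbb{T}^n)}.$$
   Context: $\mathbb{T}^n=\mathbb{R}^n/(2\pi\mathbb{Z}^n)$ is identified with $Q_n=(-\pi,\pi]^n$. For $\phi\in C^\infty(\mathbb{T}^n)$, $(-\Delta_{\mathbb{T}^n})^\sigma\phi(z)=\sum_{k\in\mathbb{Z}^n}|k|^{2\sigma}c_k(\phi)e^{ik\cdot z}$ with $c_k(\phi)=(2\pi)^{-n}\int_{Q_n}\phi(z)e^{-ik\cdot z}dz$. For a function $v$ on $\mathbb{T}^n$ that is a periodic distribution, $(-\Delta_{\mathbb{T}^n})^\sigma v$ is the periodic distribution $\langle(-\Delta_{\mathbb{T}^n})^\sigma v,\phi\rangle=\int_{\mathbb{T}^n}v(z)(-\Delta_{\mathbb{T}^n})^\sigma\phi(z)\,dz$, $\phi\in C^\infty(\mathbb{T}^n)$; saying that it belongs to a function space means that it is given by integration against a function in that space. $C$ denotes a constant independent of $v$. For $0<\alpha\le1$ and $k\in\mathbb{N}_0$, a continuous $v:\mathbb{T}^n\to\mathbb{R}$ is in $C^{k,\alpha}(\mathbb{T}^n)$ if $v\in C^k(\mathbb{T}^n)$ and $[D^\gamma v]_{C^\alpha(\mathbb{T}^n)}=\sup_{x\neq y}\frac{|D^\gamma v(x)-D^\gamma v(y)|}{\mathrm{dist}(x,y)^\alpha}<\infty$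 for each multi-index $\gamma\in\mathbb{N}_0^n$ with $|\gamma|=k$, where $\mathrm{dist}$ is the geodesic distance on $\mathbb{T}^n$. The norm is the usual one, e.g. $\|v\|_{C^{k,\alpha}(\mathbb{T}^n)}=\sum_{|\gamma|\le k}\|D^\gamma v\|_{L^\infty(\mathbb{T}^n)}+\sum_{|\gamma|=k}[D^\gamma v]_{C^\alpha(\mathbb{T}^n)}$.
   Formalization: In (3) the case 2σ=α is excluded, since the claimed Lipschitz bound is false there, and α−2σ+1>0 is required; in (4) k+α−2σ>0 is required, because otherwise the target Hölder space is not defined. *)

theory Defs
  imports "HOL-Analysis.Analysis"
begin

text \<open>
  Functions on the torus \<open>\<real>\<^sup>n / (2\<pi>\<int>\<^sup>n)\<close>, \<open>n = CARD('n)\<close>, are functions on \<open>real ^ 'n\<close>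
  that are \<open>2\<pi>\<close>-periodic in every coordinate; \<open>torus_box\<close> is the set of representatives
  \<open>Q\<^sub>n = (-\<pi>, \<pi>]\<^sup>n\<close>.
\<close>

definition lattice_vec :: "int ^ 'n \<Rightarrow> real ^ 'n" where
  "lattice_vec k = (\<chi> i. real_of_int (k $ i))"

definition torus_box :: "(real ^ 'n) set" where
  "torus_box = {x. \<forall>i. - pi < x $ i \<and> x $ i \<le> pi}"

definition torus_periodic :: "(real ^ 'n \<Rightarrow> 'a) \<Rightarrow> bool" where
  "torus_periodic f \<longleftrightarrow> (\<forall>k x. f (x + (2 * pi) *\<^sub>R lattice_vec k) = f x)"

text \<open>
  The geodesics of the flat torus joining the classes of \<open>x\<close> and \<open>y\<close> are the projections of
  the segments from \<open>x\<close> to the translates of \<open>y\<close> by the lattice \<open>2\<pi>\<int>\<^sup>n\<close>.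
\<close>

definition torus_dist :: "real ^ 'n \<Rightarrow> real ^ 'n \<Rightarrow> real" where
  "torus_dist x y = (INF k. dist x (y + (2 * pi) *\<^sub>R lattice_vec k))"

definition partial_along :: "'n \<Rightarrow> (real ^ 'n \<Rightarrow> 'a::real_normed_vector) \<Rightarrow> real ^ 'n \<Rightarrow> 'a" where
  "partial_along i f x = vector_derivative (\<lambda>t. f (x + t *\<^sub>R axis i 1)) (at 0)"

text \<open>All partial derivatives of order at most \<open>k\<close> exist everywhere and are continuous.\<close>

fun cont_diff :: "nat \<Rightarrow> (real ^ 'n \<Rightarrow> 'a::real_normed_vector) \<Rightarrow> bool" where
  "cont_diff 0 f \<longleftrightarrow> continuous_on UNIV f"
| "cont_diff (Suc k) f \<longleftrightarrow> continuous_on UNIV f \<and>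
     (\<forall>i. (\<forall>x. (\<lambda>t. f (x + t *\<^sub>R axis i 1)) differentiable (at 0)) \<and>
          cont_diff k (partial_along i f))"

fun iter_partial :: "'n list \<Rightarrow> (real ^ 'n \<Rightarrow> 'a::real_normed_vector) \<Rightarrow> real ^ 'n \<Rightarrow> 'a" where
  "iter_partial [] f = f"
| "iter_partial (i # is) f = partial_along i (iter_partial is f)"

text \<open>
  \<open>D\<^sup>\<gamma>\<close> differentiates \<open>\<gamma> $ i\<close> times in direction \<open>i\<close>. The index type \<open>'n\<close> carries no order,
  so the order of differentiation is chosen arbitrarily; for functions of class \<open>C\<^sup>k\<close> and
  \<open>|\<gamma>| \<le> k\<close> the result does not depend on it (symmetry of mixed derivatives).
\<close>

definition multi_deriv ::
    "nat ^ 'n \<Rightarrow> (real ^ 'n \<Rightarrow> 'a::real_normed_vector) \<Rightarrow> real ^ 'n \<Rightarrow> 'a" where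
  "multi_deriv \<gamma> = iter_partial (SOME is. \<forall>i. count_list is i = \<gamma> $ i)"

definition multi_order :: "nat ^ 'n \<Rightarrow> nat" where
  "multi_order \<gamma> = (\<Sum>i\<in>UNIV. \<gamma> $ i)"

definition holder_quotients :: "real \<Rightarrow> (real ^ 'n \<Rightarrow> real) \<Rightarrow> real set" where
  "holder_quotients \<alpha> f =
     {\<bar>f x - f y\<bar> / torus_dist x y powr \<alpha> | x y. x \<in> torus_box \<and> y \<in> torus_box \<and> x \<noteq> y}"

definition holder_seminorm :: "real \<Rightarrow> (real ^ 'n \<Rightarrow> real) \<Rightarrow> real" where
  "holder_seminorm \<alpha> f = Sup (holder_quotients \<alpha> f)"

text \<open>
  The space \<open>C\<^bsup>k,\<alpha>\<^esup>\<close> of the torus, meaningful for \<open>0 < \<alpha> \<le> 1\<close>. The supremum of a set of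
  reals that is not bounded above carries no information, so finiteness of the seminorms is
  stated as boundedness of the quotients.
\<close>

definition torus_holder :: "nat \<Rightarrow> real \<Rightarrow> (real ^ 'n \<Rightarrow> real) set" where
  "torus_holder k \<alpha> = {v. torus_periodic v \<and> cont_diff k v \<and>
     (\<forall>\<gamma>. multi_order \<gamma> = k \<longrightarrow> bdd_above (holder_quotients \<alpha> (multi_deriv \<gamma> v)))}"

text \<open>For continuous functions the \<open>L\<^sup>\<infinity>\<close> norm is the supremum of the absolute value.\<close>

definition torus_sup_norm :: "(real ^ 'n \<Rightarrow> real) \<Rightarrow> real" where
  "torus_sup_norm f = (SUP x\<in>torus_box. \<bar>f x\<bar>)"

definition torus_holder_norm :: "nat \<Rightarrow> real \<Rightarrow> (real ^ 'n \<Rightarrow> real) \<Rightarrow> real" where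
  "torus_holder_norm k \<alpha> v =
     (\<Sum>\<gamma> | multi_order \<gamma> \<le> k. torus_sup_norm (multi_deriv \<gamma> v)) +
     (\<Sum>\<gamma> | multi_order \<gamma> = k. holder_seminorm \<alpha> (multi_deriv \<gamma> v))"

definition torus_smooth :: "(real ^ 'n \<Rightarrow> complex) set" where
  "torus_smooth = {\<phi>. torus_periodic \<phi> \<and> (\<forall>k. cont_diff k \<phi>)}"

definition fourier_coeff :: "int ^ 'n \<Rightarrow> (real ^ 'n \<Rightarrow> complex) \<Rightarrow> complex" where
  "fourier_coeff k \<phi> =
     (LINT z:torus_box|lborel. \<phi> z * exp (- (\<i> * complex_of_real (lattice_vec k \<bullet> z))))
       / complex_of_real ((2 * pi) ^ CARD('n))"

definition frac_laplacian_smooth ::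
    "real \<Rightarrow> (real ^ 'n \<Rightarrow> complex) \<Rightarrow> real ^ 'n \<Rightarrow> complex" where
  "frac_laplacian_smooth \<sigma> \<phi> z =
     (\<Sum>\<^sub>\<infinity>k. complex_of_real (norm (lattice_vec k) powr (2 * \<sigma>)) * fourier_coeff k \<phi> *
           exp (\<i> * complex_of_real (lattice_vec k \<bullet> z)))"

definition frac_laplacian_distr ::
    "real \<Rightarrow> (real ^ 'n \<Rightarrow> real) \<Rightarrow> (real ^ 'n \<Rightarrow> complex) \<Rightarrow> complex" where
  "frac_laplacian_distr \<sigma> v \<phi> =
     (LINT z:torus_box|lborel. complex_of_real (v z) * frac_laplacian_smooth \<sigma> \<phi> z)"

text \<open>The periodic distribution \<open>T\<close> is given by integration against \<open>w\<close>.\<close>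

definition distr_given_by ::
    "((real ^ 'n \<Rightarrow> complex) \<Rightarrow> complex) \<Rightarrow> (real ^ 'n \<Rightarrow> real) \<Rightarrow> bool" where
  "distr_given_by T w \<longleftrightarrow>
     (\<forall>\<phi>\<in>torus_smooth. T \<phi> = (LINT z:torus_box|lborel. complex_of_real (w z) * \<phi> z))"

end

theory Submission
  imports Defs "HOL-Probability.Probability"
begin

text \<open>
  All four parts are instances of (4). The proof represents the operator by second differences,
  without integral kernels: with \<open>Z\<close> a standard Gaussian vector and
  \<open>\<delta>\<^sub>y f x = 2 f x - f (x + y) - f (x - y)\<close>, the averages of \<open>\<delta>\<^sub>s\<^sub>Z f x\<close> against
  \<open>s powr (- 1 - 2\<sigma>) ds\<close>, \<open>s > 0\<close>, define an operator whose symbol is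
  a constant multiple of \<open>|k| powr (2\<sigma>)\<close>, since the characteristic function of \<open>Z\<close> is radial and the
  measure is homogeneous. It is symmetric with respect to integration over the torus
  and agrees with \<open>(-\<Delta>)\<^sup>\<sigma>\<close> on smooth functions by Fourier inversion, so it also represents the
  distribution \<open>(-\<Delta>)\<^sup>\<sigma> v\<close> as soon as \<open>|\<delta>\<^sub>y v| \<le> C |y| powr a\<close> with \<open>a > 2\<sigma>\<close>.

  For \<open>f = D\<^sup>\<gamma> v\<close> with \<open>|\<gamma>| = l\<close> the increment \<open>\<delta>\<^sub>y f (x + h) - \<delta>\<^sub>y f x\<close> is bounded by a
  multiple of both \<open>|h| powr p * |y| powr a\<close> and \<open>|h| powr q * |y| powr b\<close> with \<open>p + a = q + b\<close> and
  \<open>b < 2\<sigma> < a\<close>. Using the first bound for small \<open>|y|\<close> and the second for large \<open>|y|\<close> gives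
  \<open>C |h| powr (p + a - 2\<sigma>)\<close>. Since \<open>\<sigma> < 1\<close>, only \<open>l = k\<close>, \<open>l = k - 1\<close> and \<open>l = k - 2\<close> occur, with
  \<open>(p, a, b)\<close> equal to \<open>(0, \<alpha>, 0)\<close>, \<open>(0, 1 + \<alpha>, \<alpha>)\<close> and \<open>(\<alpha>, 2, 1 + \<alpha>)\<close>.
\<close>

section \<open>Periodic functions and the torus metric\<close>

text \<open>The operator is given only through Fourier series and duality, while Hoelder bounds are
  pointwise; an average of second differences is accessible from both sides. The points sZ have
  density proportional to |y| powr (-n - 2\<sigma>), so this is the usual singular kernel, but
  written as a product of a measure on the half-line and independent coordinates it asks only for
  integrals of powers and for Gaussian moments.

  The quantitative core is that min(|y| powr a, r powr (a - b) * |y| powr b) integrates to at most C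
  r powr (a - 2\<sigma>): a > 2\<sigma> gives convergence at 0, b < 2\<sigma> at infinity, and r =
  |h| is the point where the two increment bounds meet. Noninteger k + \<alpha> - 2\<sigma> means 0
  < \<beta> < 1; together with 0 < \<sigma> < 1 this yields both strict inequalities in each of the
  three cases, and k - l = 2\<sigma> - \<alpha> + \<beta> lies between -1 and 3, so there are no
  others.

  On the Fourier side everything rests on translation invariance of the torus integral: integration
  by parts, the coefficients of a translate and the symmetry of the operator all come from it.
  Uniqueness of coefficients then gives inversion and the symmetry of mixed derivatives.\<close>

lemma lattice_vec_nth [simp]: "lattice_vec k $ i = real_of_int (k $ i)"
  by (simp add: lattice_vec_def)

lemma lattice_vec_0 [simp]: "lattice_vec 0 = 0"
  by (simp add: vec_eq_iff)

lemma lattice_vec_add: "lattice_vec (k + m) = lattice_vec k + lattice_vec m"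
  by (simp add: vec_eq_iff)

lemma lattice_vec_minus: "lattice_vec (- k) = - lattice_vec k"
  by (simp add: vec_eq_iff)

lemma lattice_vec_diff: "lattice_vec (k - m) = lattice_vec k - lattice_vec m"
  by (simp add: vec_eq_iff)

lemma lattice_vec_axis: "lattice_vec (axis i 1) = axis i 1"
  by (simp add: vec_eq_iff axis_def)

lemma torus_periodicD: "torus_periodic f \<Longrightarrow> f (x + (2 * pi) *\<^sub>R lattice_vec k) = f x"
  by (simp add: torus_periodic_def)

text \<open>The ceiling, rather than the floor, fits intervals that contain pi but not - pi.\<close>

definition torus_reduce :: "real ^ 'n \<Rightarrow> int ^ 'n" where
  "torus_reduce x = (\<chi> i. - \<lceil>(x $ i - pi) / (2 * pi)\<rceil>)"

text \<open>Serves twice: it provides representatives in the box, and its uniqueness half makes the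
  indicators of the lattice translates of the box add up to 1.\<close>

lemma torus_box_shift_iff:
  "x + (2 * pi) *\<^sub>R lattice_vec k \<in> torus_box \<longleftrightarrow> k = torus_reduce x"
proof -
  have "(- pi < x $ i + 2 * pi * real_of_int (k $ i) \<and> x $ i + 2 * pi * real_of_int (k $ i) \<le> pi) \<longleftrightarrow>
        k $ i = - \<lceil>(x $ i - pi) / (2 * pi)\<rceil>" for i
  proof -
    have "k $ i = - \<lceil>(x $ i - pi) / (2 * pi)\<rceil> \<longleftrightarrow> \<lceil>(x $ i - pi) / (2 * pi)\<rceil> = - (k $ i)"
      by auto
    also have "\<dots> \<longleftrightarrow> - real_of_int (k $ i) - 1 < (x $ i - pi) / (2 * pi) \<and>
        (x $ i - pi) / (2 * pi) \<le> - real_of_int (k $ i)"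
      by (simp add: ceiling_eq_iff)
    also have "\<dots> \<longleftrightarrow> - pi < x $ i + 2 * pi * real_of_int (k $ i) \<and>
        x $ i + 2 * pi * real_of_int (k $ i) \<le> pi"
      by (auto simp: field_simps)
    finally show ?thesis by simp
  qed
  then show ?thesis
    by (auto simp: torus_box_def torus_reduce_def vec_eq_iff)
qed

section \<open>Lebesgue measure on the torus and its translation invariance\<close>

lemma borel_measurable_vec_component [measurable]: "(\<lambda>x :: real ^ 'n. x $ i) \<in> borel_measurable borel"
  by (intro borel_measurable_continuous_onI continuous_intros)

lemma borel_measurable_vecI:
  fixes f :: "'a \<Rightarrow> real ^ 'n"
  assumes "\<And>i. (\<lambda>x. f x $ i) \<in> borel_measurable M"
  shows "f \<in> borel_measurable M"
  unfolding borel_measurable_euclidean_space[of f]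
  using assms by (auto simp: Basis_vec_def inner_axis)

lemma sets_torus_box [measurable]: "torus_box \<in> sets borel"
proof -
  have "torus_box = {x \<in> space borel. \<forall>i. - pi < x $ i \<and> x $ i \<le> pi}"
    by (simp add: torus_box_def)
  also have "\<dots> \<in> sets borel" by measurable
  finally show ?thesis .
qed

lemma torus_box_subset_cbox: "torus_box \<subseteq> cbox (\<chi> i. - pi) (\<chi> i. pi)"
  by (auto simp: torus_box_def mem_box_cart less_imp_le)

text \<open>The box is half-open, so its volume is squeezed between those of the open and the closed
  cube.\<close>

lemma emeasure_torus_box: "emeasure lborel (torus_box :: (real ^ 'n) set) = ennreal ((2 * pi) ^ CARD('n))"
proof -
  let ?A = "box (\<chi> i. - pi) (\<chi> i. pi) :: (real ^ 'n) set" and ?B = "cbox (\<chi> i. - pi) (\<chi> i. pi) :: (real ^ 'n) set"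
  have prod: "(\<Prod>b\<in>Basis. ((\<chi> i. pi) - (\<chi> i. - pi) :: real ^ 'n) \<bullet> b) = (2 * pi) ^ CARD('n)"
  proof -
    have "((\<chi> i. pi) - (\<chi> i. - pi) :: real ^ 'n) \<bullet> b = 2 * pi" if "b \<in> Basis" for b
      using that by (auto simp: Basis_vec_def inner_axis)
    then show ?thesis by simp
  qed
  have le: "\<forall>b\<in>Basis. (\<chi> i. - pi :: real ^ 'n) \<bullet> b \<le> (\<chi> i. pi) \<bullet> b"
    by (auto simp: Basis_vec_def inner_axis)
  have "emeasure lborel ?A = ennreal ((2 * pi) ^ CARD('n))"
    using le prod by (subst emeasure_lborel_box) auto
  moreover have "emeasure lborel ?B = ennreal ((2 * pi) ^ CARD('n))"
    using le prod by (subst emeasure_lborel_cbox) auto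
  moreover have "?A \<subseteq> torus_box"
    by (auto simp: torus_box_def mem_box_cart less_imp_le)
  then have "emeasure lborel ?A \<le> emeasure lborel (torus_box :: (real ^ 'n) set)"
    by (intro emeasure_mono) auto
  moreover have "emeasure lborel (torus_box :: (real ^ 'n) set) \<le> emeasure lborel ?B"
    by (intro emeasure_mono torus_box_subset_cbox) auto
  ultimately show ?thesis by (simp add: antisym)
qed

text \<open>A measure of its own, rather than integrals over a set, makes the theory of finite
  measures, dominated convergence and Fubini directly applicable.\<close>

definition torus_measure :: "(real ^ 'n) measure" where
  "torus_measure = restrict_space lborel torus_box"

lemma space_torus_measure [simp]: "space torus_measure = torus_box"
  by (simp add: torus_measure_def space_restrict_space)

lemma set_integral_torus_box:
  fixes f :: "real ^ 'n \<Rightarrow> 'a :: {banach, second_countable_topology}"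
  shows "(LINT z:torus_box|lborel. f z) = integral\<^sup>L torus_measure f"
  by (simp add: set_lebesgue_integral_def torus_measure_def integral_restrict_space)

lemma borel_measurable_torus_measure [measurable_dest]:
  "f \<in> borel_measurable borel \<Longrightarrow> f \<in> borel_measurable torus_measure"
  unfolding torus_measure_def by (rule measurable_restrict_space1) simp

lemma emeasure_torus_measure_space:
  "emeasure (torus_measure :: (real ^ 'n) measure) torus_box = ennreal ((2 * pi) ^ CARD('n))"
  by (simp add: torus_measure_def emeasure_restrict_space emeasure_torus_box)

interpretation torus_measure: finite_measure torus_measure
  by standard (simp add: emeasure_torus_measure_space)

lemma measure_torus_measure_space:
  "measure (torus_measure :: (real ^ 'n) measure) torus_box = (2 * pi) ^ CARD('n)"
  by (simp add: measure_def emeasure_torus_measure_space)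

lemma nn_integral_lborel_shift:
  fixes f :: "'a :: euclidean_space \<Rightarrow> ennreal"
  assumes [measurable]: "f \<in> borel_measurable borel"
  shows "(\<integral>\<^sup>+x. f (a + x) \<partial>lborel) = (\<integral>\<^sup>+x. f x \<partial>lborel)"
  by (subst (2) lborel_distr_plus[of a, symmetric]) (simp add: nn_integral_distr)

lemma nn_integral_count_space_torus_box:
  "(\<integral>\<^sup>+k. indicator torus_box (x + (2 * pi) *\<^sub>R lattice_vec k) \<partial>count_space UNIV) = (1 :: ennreal)"
proof -
  have "(\<integral>\<^sup>+k. indicator torus_box (x + (2 * pi) *\<^sub>R lattice_vec k) \<partial>count_space UNIV) =
        (\<integral>\<^sup>+k. indicator {torus_reduce x} k \<partial>count_space UNIV)"
    by (intro nn_integral_cong) (simp add: indicator_def torus_box_shift_iff)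
  then show ?thesis by simp
qed

text \<open>Unfolding: the box moved by a and the box itself are both fundamental domains. Write 1
  as a sum of lattice indicators, translate each term by a lattice vector, where f does not change,
  and sum again over the other domain.\<close>

lemma nn_integral_torus_shift:
  fixes f :: "real ^ 'n \<Rightarrow> ennreal"
  assumes [measurable]: "f \<in> borel_measurable borel" and per: "torus_periodic f"
  shows "(\<integral>\<^sup>+x. indicator torus_box x * f (a + x) \<partial>lborel) = (\<integral>\<^sup>+x. indicator torus_box x * f x \<partial>lborel)"
proof -
  let ?l = "\<lambda>k. (2 * pi) *\<^sub>R lattice_vec k :: real ^ 'n"
  let ?B = "indicator torus_box :: real ^ 'n \<Rightarrow> ennreal"
  have "(\<integral>\<^sup>+x. ?B x * f (a + x) \<partial>lborel) = (\<integral>\<^sup>+x. ?B (- a + x) * f x \<partial>lborel)"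
    by (subst nn_integral_lborel_shift[of "\<lambda>x. ?B (- a + x) * f x" a, symmetric]) auto
  also have "\<dots> = (\<integral>\<^sup>+x. (\<integral>\<^sup>+k. ?B (- a + x) * f x * ?B (x + ?l k) \<partial>count_space UNIV) \<partial>lborel)"
    by (subst nn_integral_cmult) (simp_all add: nn_integral_count_space_torus_box)
  also have "\<dots> = (\<integral>\<^sup>+k. (\<integral>\<^sup>+x. ?B (- a + x) * f x * ?B (x + ?l k) \<partial>lborel) \<partial>count_space UNIV)"
    by (rule nn_integral_count_space_nn_integral) auto
  \<comment> \<open>The translation by a lattice vector exchanges the roles of the two indicators:
    the sum over k now acts on the moved box.\<close>
  also have "\<dots> = (\<integral>\<^sup>+k. (\<integral>\<^sup>+x. ?B x * f x * ?B ((- a + x) + ?l (- k)) \<partial>lborel) \<partial>count_space UNIV)"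
  proof (rule nn_integral_cong)
    fix k :: "int ^ 'n"
    have "(\<integral>\<^sup>+x. ?B (- a + x) * f x * ?B (x + ?l k) \<partial>lborel) =
      (\<integral>\<^sup>+x. ?B (- a + (?l (- k) + x)) * f (?l (- k) + x) * ?B ((?l (- k) + x) + ?l k) \<partial>lborel)"
      by (rule nn_integral_lborel_shift[symmetric]) auto
    also have "\<dots> = (\<integral>\<^sup>+x. ?B x * f x * ?B ((- a + x) + ?l (- k)) \<partial>lborel)"
      using torus_periodicD[OF per, of _ "- k"]
      by (intro nn_integral_cong) (simp add: lattice_vec_minus algebra_simps)
    finally show "(\<integral>\<^sup>+x. ?B (- a + x) * f x * ?B (x + ?l k) \<partial>lborel) =
      (\<integral>\<^sup>+x. ?B x * f x * ?B ((- a + x) + ?l (- k)) \<partial>lborel)" .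
  qed
  also have "\<dots> = (\<integral>\<^sup>+x. (\<integral>\<^sup>+k. ?B x * f x * ?B ((- a + x) + ?l (- k)) \<partial>count_space UNIV) \<partial>lborel)"
    by (rule nn_integral_count_space_nn_integral[symmetric]) auto
  also have "\<dots> = (\<integral>\<^sup>+x. ?B x * f x \<partial>lborel)"
  proof (rule nn_integral_cong)
    fix x :: "real ^ 'n"
    have "bij_betw uminus (UNIV :: (int ^ 'n) set) UNIV"
      by (rule bij_uminus)
    then have "(\<integral>\<^sup>+k. ?B ((- a + x) + ?l (- k)) \<partial>count_space UNIV) = 1"
      using nn_integral_bij_count_space[of uminus UNIV UNIV "\<lambda>k. ?B ((- a + x) + ?l k)"]
      by (simp add: nn_integral_count_space_torus_box)
    then show "(\<integral>\<^sup>+k. ?B x * f x * ?B ((- a + x) + ?l (- k)) \<partial>count_space UNIV) = ?B x * f x"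
      by (subst nn_integral_cmult) auto
  qed
  finally show ?thesis .
qed

lemma torus_reduce_measurable [measurable]:
  "(\<lambda>x. x + (2 * pi) *\<^sub>R lattice_vec (torus_reduce x)) \<in> borel_measurable borel"
  by (rule borel_measurable_vecI) (simp add: torus_reduce_def, measurable)

lemma torus_reduce_shift: "torus_reduce (x + (2 * pi) *\<^sub>R lattice_vec k) = torus_reduce x - k"
proof -
  have "x + (2 * pi) *\<^sub>R lattice_vec (torus_reduce x) \<in> torus_box"
    by (simp add: torus_box_shift_iff)
  then have "(x + (2 * pi) *\<^sub>R lattice_vec k) + (2 * pi) *\<^sub>R lattice_vec (torus_reduce x - k) \<in> torus_box"
    by (simp add: lattice_vec_diff algebra_simps)
  then show ?thesis by (simp only: torus_box_shift_iff)
qed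

text \<open>The translation by \<open>a\<close>, reduced modulo \<open>2\<pi>\<close>, preserves the measure of the box.\<close>

lemma torus_measure_shift:
  fixes a :: "real ^ 'n"
  defines "r \<equiv> \<lambda>x :: real ^ 'n. x + (2 * pi) *\<^sub>R lattice_vec (torus_reduce x)"
  shows "distr torus_measure torus_measure (\<lambda>x. r (a + x)) = torus_measure"
proof -
  have r_box: "r x \<in> torus_box" for x
    by (simp add: r_def torus_box_shift_iff)
  have [measurable]: "r \<in> borel_measurable borel"
    unfolding r_def by measurable
  have r_id: "r x = x" if "x \<in> torus_box" for x
  proof -
    have "torus_reduce x = 0"
      using torus_box_shift_iff[of x 0] that by simp
    then show ?thesis by (simp add: r_def)
  qed
  have m: "(\<lambda>x. r (a + x)) \<in> torus_measure \<rightarrow>\<^sub>M torus_measure"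
    unfolding torus_measure_def
    by (intro measurable_restrict_space2 measurable_restrict_space1) (auto simp: r_box)
  show ?thesis
  proof (rule measure_eqI)
    fix A assume "A \<in> sets (distr torus_measure torus_measure (\<lambda>x. r (a + x)))"
    then have A: "A \<in> sets (torus_measure :: (real ^ 'n) measure)" by simp
    then have A': "A \<subseteq> torus_box" "A \<in> sets borel"
      by (auto simp: torus_measure_def sets_restrict_space)
    note [measurable] = A'(2)
    \<comment> \<open>The periodic extension of the indicator of A, to which
      \<open>nn_integral_torus_shift\<close> applies.\<close>
    let ?f = "\<lambda>x. indicator A (r x) :: ennreal"
    have "r (x + (2 * pi) *\<^sub>R lattice_vec k) = r x" for x k
      unfolding r_def torus_reduce_shift lattice_vec_diff by (simp add: scaleR_diff_right)
    then have per: "torus_periodic ?f"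
      by (simp add: torus_periodic_def)
    have "emeasure (distr torus_measure torus_measure (\<lambda>x. r (a + x))) A =
        emeasure torus_measure ((\<lambda>x. r (a + x)) -` A \<inter> torus_box)"
      using m A by (simp add: emeasure_distr)
    also have "\<dots> = emeasure lborel ((\<lambda>x. r (a + x)) -` A \<inter> torus_box)"
      unfolding torus_measure_def by (subst emeasure_restrict_space) auto
    also have "\<dots> = (\<integral>\<^sup>+x. indicator ((\<lambda>x. r (a + x)) -` A \<inter> torus_box) x \<partial>lborel)"
    proof (rule nn_integral_indicator[symmetric])
      have "(\<lambda>x. r (a + x)) -` A \<inter> space borel \<in> sets borel"
        by (rule measurable_sets[of _ borel borel]) auto
      then show "(\<lambda>x. r (a + x)) -` A \<inter> torus_box \<in> sets lborel" by auto
    qed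
    also have "\<dots> = (\<integral>\<^sup>+x. indicator torus_box x * ?f (a + x) \<partial>lborel)"
      by (intro nn_integral_cong) (auto simp: indicator_def)
    also have "\<dots> = (\<integral>\<^sup>+x. indicator torus_box x * ?f x \<partial>lborel)"
      by (rule nn_integral_torus_shift[OF _ per]) measurable
    also have "\<dots> = (\<integral>\<^sup>+x. indicator A x \<partial>lborel)"
      using A'(1) by (intro nn_integral_cong) (auto simp: indicator_def r_id)
    also have "\<dots> = emeasure torus_measure A"
      using A' unfolding torus_measure_def by (subst emeasure_restrict_space) auto
    finally show "emeasure (distr torus_measure torus_measure (\<lambda>x. r (a + x))) A = emeasure torus_measure A" .
  qed simp
qed

text \<open>For Banach-valued integrands the change of variables goes through the measure-preserving
  map of \<open>torus_measure_shift\<close>; by periodicity the integrand does not see the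
  reduction.\<close>

lemma integral_torus_shift:
  fixes f :: "real ^ 'n \<Rightarrow> 'a :: {banach, second_countable_topology}"
  assumes [measurable]: "f \<in> borel_measurable borel" and per: "torus_periodic f"
  shows "(LINT x|torus_measure. f (x + a)) = integral\<^sup>L torus_measure f"
proof -
  let ?r = "\<lambda>x :: real ^ 'n. x + (2 * pi) *\<^sub>R lattice_vec (torus_reduce x)"
  have "(\<lambda>x. ?r (a + x)) \<in> torus_measure \<rightarrow>\<^sub>M torus_measure"
    unfolding torus_measure_def
    by (intro measurable_restrict_space2 measurable_restrict_space1)
       (auto simp: torus_box_shift_iff simp del: measurable_lborel2 intro: measurable_compose[OF _ torus_reduce_measurable])
  then have "integral\<^sup>L torus_measure f = (LINT x|torus_measure. f (?r (a + x)))"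
    by (subst torus_measure_shift[of a, symmetric], subst integral_distr) auto
  also have "\<dots> = (LINT x|torus_measure. f (x + a))"
    by (intro Bochner_Integration.integral_cong) (simp_all add: torus_periodicD[OF per] add.commute)
  finally show ?thesis by simp
qed

lemma torus_box_representative:
  obtains k where "x + (2 * pi) *\<^sub>R lattice_vec k \<in> torus_box"
  using torus_box_shift_iff by blast

lemma torus_periodic_bounded:
  fixes f :: "real ^ 'n \<Rightarrow> 'a :: real_normed_vector"
  assumes cont: "continuous_on UNIV f" and per: "torus_periodic f"
  obtains B where "B \<ge> 0" "\<And>x. norm (f x) \<le> B"
proof -
  let ?K = "cbox (\<chi> i. - pi) (\<chi> i. pi) :: (real ^ 'n) set"
  have "compact (f ` ?K)"
    using cont by (intro compact_continuous_image) (auto intro: continuous_on_subset)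
  then obtain B where B: "\<And>x. x \<in> ?K \<Longrightarrow> norm (f x) \<le> B"
    by (meson bounded_iff compact_imp_bounded imageI)
  have *: "norm (f x) \<le> max B 0" for x
  proof -
    obtain k where k: "x + (2 * pi) *\<^sub>R lattice_vec k \<in> torus_box"
      by (rule torus_box_representative)
    then have "norm (f (x + (2 * pi) *\<^sub>R lattice_vec k)) \<le> B"
      using B torus_box_subset_cbox by blast
    then show ?thesis by (simp add: torus_periodicD[OF per])
  qed
  show thesis by (rule that[of "max B 0"]) (simp_all add: *)
qed

section \<open>Torus distance, Hoelder quotients and sup norms\<close>

lemma torus_dist_le: "torus_dist x y \<le> dist x (y + (2 * pi) *\<^sub>R lattice_vec k)"
  unfolding torus_dist_def by (intro cINF_lower bdd_belowI2[of _ 0]) auto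

text \<open>An infimum over infinitely many translates needs a uniform lower bound. In a coordinate
  where the points differ by d, 0 < |d| < 2 pi, every translate stays at distance at least min(|d|,
  2 pi - |d|).\<close>

lemma torus_dist_pos:
  assumes "x \<in> torus_box" "y \<in> torus_box" "x \<noteq> y"
  shows "0 < torus_dist x y"
proof -
  obtain i where i: "x $ i \<noteq> y $ i"
    using assms(3) by (auto simp: vec_eq_iff)
  define d where "d = x $ i - y $ i"
  have d: "d \<noteq> 0" "\<bar>d\<bar> < 2 * pi"
    using assms(1,2) i by (auto simp: torus_box_def d_def abs_less_iff dest!: spec[of _ i])
  have "min \<bar>d\<bar> (2 * pi - \<bar>d\<bar>) \<le> torus_dist x y"
    unfolding torus_dist_def
  proof (rule cINF_greatest)
    fix k :: "int ^ 'a"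
    have "min \<bar>d\<bar> (2 * pi - \<bar>d\<bar>) \<le> \<bar>d - 2 * pi * real_of_int (k $ i)\<bar>"
    proof (cases "k $ i = 0")
      case False
      then have "1 \<le> \<bar>real_of_int (k $ i)\<bar>" by linarith
      then have "2 * pi * 1 \<le> 2 * pi * \<bar>real_of_int (k $ i)\<bar>"
        by (intro mult_left_mono) auto
      then have "2 * pi \<le> \<bar>2 * pi * real_of_int (k $ i)\<bar>"
        by (simp add: abs_mult)
      then show ?thesis by linarith
    qed simp
    also have "\<dots> = \<bar>(x - (y + (2 * pi) *\<^sub>R lattice_vec k)) $ i\<bar>"
      by (simp add: d_def algebra_simps)
    also have "\<dots> \<le> dist x (y + (2 * pi) *\<^sub>R lattice_vec k)"
      unfolding dist_norm by (rule component_le_norm_cart)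
    finally show "min \<bar>d\<bar> (2 * pi - \<bar>d\<bar>) \<le> dist x (y + (2 * pi) *\<^sub>R lattice_vec k)" .
  qed simp
  then show ?thesis using d by linarith
qed

text \<open>Both points are reduced to the box, where the quotient is available; the torus distance
  of the representatives is at most the Euclidean distance of the original points.\<close>

lemma holder_quotients_imp_holder:
  fixes f :: "real ^ 'n \<Rightarrow> real"
  assumes per: "torus_periodic f" and "0 < \<alpha>" "0 \<le> H"
    and H: "\<And>q. q \<in> holder_quotients \<alpha> f \<Longrightarrow> q \<le> H"
  shows "\<bar>f x - f y\<bar> \<le> H * norm (x - y) powr \<alpha>"
proof -
  let ?l = "\<lambda>k. (2 * pi) *\<^sub>R lattice_vec k :: real ^ 'n"
  obtain k m where km: "x + ?l k \<in> torus_box" "y + ?l m \<in> torus_box"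
    by (metis torus_box_representative)
  have "\<bar>f (x + ?l k) - f (y + ?l m)\<bar> \<le> H * norm (x - y) powr \<alpha>"
  proof (cases "x + ?l k = y + ?l m")
    case False
    let ?d = "torus_dist (x + ?l k) (y + ?l m)"
    have pos: "0 < ?d" by (rule torus_dist_pos[OF km False])
    have "\<bar>f (x + ?l k) - f (y + ?l m)\<bar> / ?d powr \<alpha> \<le> H"
      using km False by (intro H) (auto simp: holder_quotients_def)
    then have "\<bar>f (x + ?l k) - f (y + ?l m)\<bar> \<le> H * ?d powr \<alpha>"
      using pos by (simp add: field_simps)
    moreover have "?d \<le> norm (x - y)"
    proof -
      have "?d \<le> dist (x + ?l k) ((y + ?l m) + ?l (k - m))"
        by (rule torus_dist_le)
      also have "\<dots> = norm (x - y)"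
        by (simp add: dist_norm lattice_vec_diff scaleR_diff_right)
      finally show ?thesis .
    qed
    then have "H * ?d powr \<alpha> \<le> H * norm (x - y) powr \<alpha>"
      using \<open>0 \<le> H\<close> \<open>0 < \<alpha>\<close> pos by (intro mult_left_mono powr_mono2) auto
    ultimately show ?thesis by linarith
  qed (use \<open>0 \<le> H\<close> in simp)
  then show ?thesis by (simp add: torus_periodicD[OF per])
qed

text \<open>By periodicity the Euclidean estimate holds against every translate of y, and it remains
  to pass to the infimum over translates.\<close>

lemma holder_imp_holder_quotients:
  fixes f :: "real ^ 'n \<Rightarrow> real"
  assumes per: "torus_periodic f" and "0 < \<alpha>" "0 \<le> H"
    and H: "\<And>x y. \<bar>f x - f y\<bar> \<le> H * norm (x - y) powr \<alpha>"
    and q: "q \<in> holder_quotients \<alpha> f"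
  shows "q \<le> H"
proof -
  obtain x y where xy: "x \<in> torus_box" "y \<in> torus_box" "x \<noteq> y"
    and q: "q = \<bar>f x - f y\<bar> / torus_dist x y powr \<alpha>"
    using q by (auto simp: holder_quotients_def)
  have pos: "0 < torus_dist x y" by (rule torus_dist_pos[OF xy])
  have "\<bar>f x - f y\<bar> \<le> H * torus_dist x y powr \<alpha>"
  proof (cases "H = 0")
    case False
    then have "0 < H" using \<open>0 \<le> H\<close> by simp
    \<comment> \<open>Solving for the distance turns the family of estimates into a common lower
      bound, which is what an infimum accepts.\<close>
    have "(\<bar>f x - f y\<bar> / H) powr (1 / \<alpha>) \<le> torus_dist x y"
      unfolding torus_dist_def
    proof (rule cINF_greatest)
      fix k :: "int ^ 'n"
      let ?d = "dist x (y + (2 * pi) *\<^sub>R lattice_vec k)"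
      have "\<bar>f x - f y\<bar> \<le> H * ?d powr \<alpha>"
        using H[of x "y + (2 * pi) *\<^sub>R lattice_vec k"] by (simp add: torus_periodicD[OF per] dist_norm)
      then have "\<bar>f x - f y\<bar> / H \<le> ?d powr \<alpha>"
        using \<open>0 < H\<close> by (simp add: field_simps)
      then have "(\<bar>f x - f y\<bar> / H) powr (1 / \<alpha>) \<le> (?d powr \<alpha>) powr (1 / \<alpha>)"
        using \<open>0 < H\<close> \<open>0 < \<alpha>\<close> by (intro powr_mono2) auto
      then show "(\<bar>f x - f y\<bar> / H) powr (1 / \<alpha>) \<le> ?d"
        using \<open>0 < \<alpha>\<close> by (simp add: powr_powr)
    qed simp
    then have "((\<bar>f x - f y\<bar> / H) powr (1 / \<alpha>)) powr \<alpha> \<le> torus_dist x y powr \<alpha>"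
      using \<open>0 < \<alpha>\<close> by (intro powr_mono2) auto
    then show ?thesis
      using \<open>0 < H\<close> \<open>0 < \<alpha>\<close> by (simp add: powr_powr field_simps)
  qed (use H[of x y] in simp)
  then show ?thesis
    using pos by (simp add: q field_simps)
qed

lemma torus_box_nonempty: "0 \<in> torus_box" "vec 1 \<in> torus_box"
  using pi_gt3 by (auto simp: torus_box_def)

lemma holder_quotients_nonempty: "holder_quotients \<alpha> f \<noteq> {}"
proof -
  have "(0 :: real ^ 'n) \<noteq> vec 1" by (simp add: vec_eq_iff)
  then show ?thesis
    unfolding holder_quotients_def using torus_box_nonempty by blast
qed

lemma holder_seminorm_nonneg:
  assumes "bdd_above (holder_quotients \<alpha> f)"
  shows "0 \<le> holder_seminorm \<alpha> f"
proof -
  obtain q where q: "q \<in> holder_quotients \<alpha> f"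
    using holder_quotients_nonempty[of \<alpha> f] by blast
  then have "0 \<le> q" by (auto simp: holder_quotients_def)
  also have "q \<le> holder_seminorm \<alpha> f"
    unfolding holder_seminorm_def by (rule cSup_upper[OF q assms])
  finally show ?thesis .
qed

lemma holder_seminorm_holder:
  assumes per: "torus_periodic f" and "0 < \<alpha>" "bdd_above (holder_quotients \<alpha> f)"
  shows "\<bar>f x - f y\<bar> \<le> holder_seminorm \<alpha> f * norm (x - y) powr \<alpha>"
  using assms holder_seminorm_nonneg[OF assms(3)]
  by (intro holder_quotients_imp_holder) (auto simp: holder_seminorm_def intro: cSup_upper)

lemma holder_seminorm_le:
  assumes "torus_periodic f" and "0 < \<alpha>" "0 \<le> H"
    and "\<And>x y. \<bar>f x - f y\<bar> \<le> H * norm (x - y) powr \<alpha>"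
  shows "bdd_above (holder_quotients \<alpha> f)" "holder_seminorm \<alpha> f \<le> H"
  unfolding holder_seminorm_def
  by (auto intro!: bdd_aboveI[of _ H] cSup_least holder_quotients_nonempty
        intro: holder_imp_holder_quotients[OF assms])

lemma abs_le_torus_sup_norm:
  fixes f :: "real ^ 'n \<Rightarrow> real"
  assumes cont: "continuous_on UNIV f" and per: "torus_periodic f"
  shows "\<bar>f x\<bar> \<le> torus_sup_norm f"
proof -
  obtain B where B: "\<And>x. norm (f x) \<le> B"
    using torus_periodic_bounded[OF assms] by blast
  obtain k where k: "x + (2 * pi) *\<^sub>R lattice_vec k \<in> torus_box"
    by (rule torus_box_representative)
  have "\<bar>f (x + (2 * pi) *\<^sub>R lattice_vec k)\<bar> \<le> torus_sup_norm f"
    unfolding torus_sup_norm_def using B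
    by (intro cSUP_upper k bdd_aboveI2[of _ _ B]) auto
  then show ?thesis by (simp add: torus_periodicD[OF per])
qed

lemma torus_sup_norm_le: "(\<And>x. \<bar>f x\<bar> \<le> B) \<Longrightarrow> torus_sup_norm f \<le> B"
  unfolding torus_sup_norm_def using torus_box_nonempty by (intro cSUP_least) auto

lemma integrable_torus_measure_bounded:
  fixes f :: "real ^ 'n \<Rightarrow> 'a :: {banach, second_countable_topology}"
  assumes "f \<in> borel_measurable borel" "\<And>x. norm (f x) \<le> B"
  shows "integrable torus_measure f"
  using assms by (intro torus_measure.integrable_const_bound[of _ B]) auto

lemma integrable_torus_measure_continuous:
  fixes f :: "real ^ 'n \<Rightarrow> 'a :: {banach, second_countable_topology}"
  assumes cont: "continuous_on UNIV f" and per: "torus_periodic f"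
  shows "integrable torus_measure f"
proof -
  obtain B where "\<And>x. norm (f x) \<le> B"
    using torus_periodic_bounded[OF assms] by blast
  then show ?thesis
    by (intro integrable_torus_measure_bounded borel_measurable_continuous_onI cont)
qed

section \<open>Partial derivatives and Fourier coefficients\<close>

text \<open>The relational form asserts that the derivative exists, which
  \<open>partial_along\<close> alone, being defined through a choice, does not.\<close>

definition has_partial ::
    "'n \<Rightarrow> (real ^ 'n \<Rightarrow> 'a::real_normed_vector) \<Rightarrow> (real ^ 'n \<Rightarrow> 'a) \<Rightarrow> bool" where
  "has_partial i f f' \<longleftrightarrow>
     (\<forall>x. ((\<lambda>t. f (x + t *\<^sub>R axis i 1)) has_vector_derivative f' x) (at 0))"

lemma has_partial_at:
  assumes "has_partial i f f'"
  shows "((\<lambda>t. f (x + t *\<^sub>R axis i 1)) has_vector_derivative f' (x + t *\<^sub>R axis i 1)) (at t)"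
proof -
  have "((\<lambda>s. f ((x + t *\<^sub>R axis i 1) + s *\<^sub>R axis i 1)) has_vector_derivative
      f' (x + t *\<^sub>R axis i 1)) (at (t + (- t)))"
    using assms by (simp add: has_partial_def)
  moreover have "((\<lambda>s. s + (- t)) has_vector_derivative 1) (at t)"
    by (auto intro!: derivative_eq_intros)
  ultimately have "((\<lambda>s. f ((x + t *\<^sub>R axis i 1) + s *\<^sub>R axis i 1)) \<circ> (\<lambda>s. s + (- t))
      has_vector_derivative 1 *\<^sub>R f' (x + t *\<^sub>R axis i 1)) (at t)"
    by (intro vector_diff_chain_at) auto
  moreover have "(\<lambda>s. f ((x + t *\<^sub>R axis i 1) + s *\<^sub>R axis i 1)) \<circ> (\<lambda>s. s + (- t)) =
      (\<lambda>s. f (x + s *\<^sub>R axis i 1))"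
    by (simp add: fun_eq_iff algebra_simps)
  ultimately show ?thesis by simp
qed

text \<open>The mean value inequality on a line. The bound is asked only on the segment, so that it
  can later be supplied from a small cube.\<close>

lemma has_partial_norm_le:
  assumes "has_partial i f f'"
    and B: "\<And>s. s \<in> closed_segment 0 t \<Longrightarrow> norm (f' (x + s *\<^sub>R axis i 1)) \<le> B"
  shows "norm (f (x + t *\<^sub>R axis i 1) - f x) \<le> B * \<bar>t\<bar>"
proof -
  have "norm (f (x + t *\<^sub>R axis i 1) - f (x + 0 *\<^sub>R axis i 1)) \<le> B * norm (t - 0)"
  proof (rule differentiable_bound[where S = "closed_segment 0 t"])
    fix s assume s: "s \<in> closed_segment 0 t"
    show "((\<lambda>t. f (x + t *\<^sub>R axis i 1)) has_derivative (\<lambda>h. h *\<^sub>R f' (x + s *\<^sub>R axis i 1)))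
        (at s within closed_segment 0 t)"
      using has_partial_at[OF assms(1), of x s]
      by (auto simp: has_vector_derivative_def intro: has_derivative_at_withinI)
    show "onorm (\<lambda>h. h *\<^sub>R f' (x + s *\<^sub>R axis i 1)) \<le> B"
      using mult_left_mono[OF B[OF s], of "\<bar>_\<bar>"] by (intro onorm_le) (simp add: mult.commute)
  qed auto
  then show ?thesis by simp
qed

text \<open>In this form a derivative can be carried through an integral by dominated
  convergence.\<close>

lemma has_partial_iff_diff_quotient:
  "has_partial i f f' \<longleftrightarrow>
     (\<forall>x. ((\<lambda>t. (f (x + t *\<^sub>R axis i 1) - f x) /\<^sub>R t) \<longlongrightarrow> f' x) (at 0))"
proof -
  have "((\<lambda>t. f (x + t *\<^sub>R axis i 1)) has_vector_derivative f' x) (at 0) \<longleftrightarrow>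
      ((\<lambda>t. (f (x + t *\<^sub>R axis i 1) - f x) /\<^sub>R t) \<longlongrightarrow> f' x) (at 0)" for x
  proof -
    let ?q = "\<lambda>t. (f (x + t *\<^sub>R axis i 1) - f x) /\<^sub>R t"
    have norm_eq: "norm (f (x + t *\<^sub>R axis i 1) - f x - t *\<^sub>R f' x) / norm t = norm (?q t - f' x)" if "t \<noteq> 0" for t
    proof -
      have "?q t - f' x = (f (x + t *\<^sub>R axis i 1) - f x - t *\<^sub>R f' x) /\<^sub>R t"
        using that by (simp add: scaleR_diff_right)
      then show ?thesis by (simp add: divide_inverse_commute)
    qed
    have "((\<lambda>t. f (x + t *\<^sub>R axis i 1)) has_vector_derivative f' x) (at 0) \<longleftrightarrow>
        (\<lambda>t. norm (f (x + t *\<^sub>R axis i 1) - f x - t *\<^sub>R f' x) / norm t) \<midarrow>0\<rightarrow> 0"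
      by (simp add: has_vector_derivative_def has_derivative_at bounded_linear_scaleR_left)
    also have "\<dots> \<longleftrightarrow> (\<lambda>t. norm (?q t - f' x)) \<midarrow>0\<rightarrow> 0"
      by (intro filterlim_cong refl) (simp add: eventually_at_filter norm_eq del: real_norm_def)
    also have "\<dots> \<longleftrightarrow> (?q \<longlongrightarrow> f' x) (at 0)"
      by (simp only: tendsto_norm_zero_iff LIM_zero_iff)
    finally show ?thesis .
  qed
  then show ?thesis by (simp add: has_partial_def)
qed

lemma has_partial_diff_quotient:
  "has_partial i f f' \<Longrightarrow> ((\<lambda>t. (f (x + t *\<^sub>R axis i 1) - f x) /\<^sub>R t) \<longlongrightarrow> f' x) (at 0)"
  by (simp add: has_partial_iff_diff_quotient)

lemma partial_along_eqI:
  assumes "has_partial i f f'"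
  shows "partial_along i f = f'"
  using assms by (auto simp: has_partial_def partial_along_def fun_eq_iff intro: vector_derivative_at)

lemma has_partial_periodic:
  assumes "has_partial i f f'" "torus_periodic f"
  shows "torus_periodic f'"
proof -
  have "f' (x + (2 * pi) *\<^sub>R lattice_vec k) = f' x" for k x
  proof -
    have "((\<lambda>t. f (x + (2 * pi) *\<^sub>R lattice_vec k + t *\<^sub>R axis i 1)) has_vector_derivative
        f' (x + (2 * pi) *\<^sub>R lattice_vec k)) (at 0)"
      using assms(1) by (simp add: has_partial_def)
    moreover have "f (x + (2 * pi) *\<^sub>R lattice_vec k + t *\<^sub>R axis i 1) = f (x + t *\<^sub>R axis i 1)" for t
      using torus_periodicD[OF assms(2), of "x + t *\<^sub>R axis i 1" k] by (simp add: algebra_simps)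
    ultimately show ?thesis
      using assms(1) by (auto simp: has_partial_def intro: vector_derivative_unique_at)
  qed
  then show ?thesis by (simp add: torus_periodic_def)
qed

lemma has_partial_mult:
  fixes f g :: "real ^ 'n \<Rightarrow> 'a :: real_normed_algebra"
  assumes "has_partial i f f'" "has_partial i g g'"
  shows "has_partial i (\<lambda>x. f x * g x) (\<lambda>x. f x * g' x + f' x * g x)"
  unfolding has_partial_def
proof
  fix x
  show "((\<lambda>t. f (x + t *\<^sub>R axis i 1) * g (x + t *\<^sub>R axis i 1)) has_vector_derivative
      f x * g' x + f' x * g x) (at 0)"
    using has_vector_derivative_mult[of "\<lambda>t. f (x + t *\<^sub>R axis i 1)" "f' x" 0 UNIV
        "\<lambda>t. g (x + t *\<^sub>R axis i 1)" "g' x"] assms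
    by (simp add: has_partial_def)
qed

lemma has_partial_of_real:
  assumes "has_partial i f f'"
  shows "has_partial i (\<lambda>x. complex_of_real (f x)) (\<lambda>x. complex_of_real (f' x))"
  using assms bounded_linear.has_vector_derivative[OF bounded_linear_of_real[where 'a = complex]]
  by (auto simp: has_partial_def)

text \<open>Translation invariance makes the integral of every difference quotient vanish. The
  quotients are bounded by the supremum of |f'|, so the limit can be taken under the
  integral.\<close>

lemma integral_torus_partial:
  fixes f :: "real ^ 'n \<Rightarrow> 'a :: {banach, second_countable_topology}"
  assumes D: "has_partial i f f'" and per: "torus_periodic f"
    and cont: "continuous_on UNIV f" "continuous_on UNIV f'"
  shows "integral\<^sup>L torus_measure f' = 0"
proof -
  have [measurable]: "f \<in> borel_measurable borel" "f' \<in> borel_measurable borel"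
    using cont by (simp_all add: borel_measurable_continuous_onI)
  obtain B where B: "\<And>x. norm (f' x) \<le> B"
    using torus_periodic_bounded[OF cont(2) has_partial_periodic[OF D per]] by blast
  define t :: "nat \<Rightarrow> real" where "t = (\<lambda>n. inverse (Suc n))"
  have t: "t n > 0" for n by (simp add: t_def)
  have t0: "filterlim t (at 0) sequentially"
    using LIMSEQ_inverse_real_of_nat t by (auto simp: filterlim_at t_def)
  have *: "(LINT x|torus_measure. (f (x + t n *\<^sub>R axis i 1) - f x) /\<^sub>R t n) = 0" for n
  proof -
    have "integrable torus_measure f"
      by (rule integrable_torus_measure_continuous[OF cont(1) per])
    moreover have "integrable torus_measure (\<lambda>x. f (x + t n *\<^sub>R axis i 1))"
    proof (rule integrable_torus_measure_continuous)
      show "continuous_on UNIV (\<lambda>x. f (x + t n *\<^sub>R axis i 1))"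
        by (intro continuous_on_compose2[OF cont(1)] continuous_intros) auto
      have "f (x + (2 * pi) *\<^sub>R lattice_vec k + t n *\<^sub>R axis i 1) = f (x + t n *\<^sub>R axis i 1)" for k x
        using torus_periodicD[OF per, of "x + t n *\<^sub>R axis i 1" k] by (simp add: algebra_simps)
      then show "torus_periodic (\<lambda>x. f (x + t n *\<^sub>R axis i 1))"
        by (simp add: torus_periodic_def)
    qed
    ultimately show ?thesis
      using integral_torus_shift[OF _ per, of "t n *\<^sub>R axis i 1"] by simp
  qed
  have "(\<lambda>n. LINT x|torus_measure. (f (x + t n *\<^sub>R axis i 1) - f x) /\<^sub>R t n) \<longlonglongrightarrow> integral\<^sup>L torus_measure f'"
  proof (rule integral_dominated_convergence[where w = "\<lambda>_. B"])
    show "AE x in torus_measure. (\<lambda>n. (f (x + t n *\<^sub>R axis i 1) - f x) /\<^sub>R t n) \<longlonglongrightarrow> f' x"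
      by (intro AE_I2 filterlim_compose[OF has_partial_diff_quotient[OF D] t0])
    show "AE x in torus_measure. norm ((f (x + t n *\<^sub>R axis i 1) - f x) /\<^sub>R t n) \<le> B" for n
    proof (rule AE_I2)
      fix x
      have "norm (f (x + t n *\<^sub>R axis i 1) - f x) \<le> B * \<bar>t n\<bar>"
        by (rule has_partial_norm_le[OF D]) (simp add: B)
      then show "norm ((f (x + t n *\<^sub>R axis i 1) - f x) /\<^sub>R t n) \<le> B"
        using t[of n] by (simp add: divide_inverse_commute[symmetric] pos_divide_le_eq)
    qed
    have "(\<lambda>x. (f (x + t n *\<^sub>R axis i 1) - f x) /\<^sub>R t n) \<in> borel_measurable borel" for n
      by measurable
    then show "(\<lambda>x. (f (x + t n *\<^sub>R axis i 1) - f x) /\<^sub>R t n) \<in> borel_measurable torus_measure" for n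
      by (rule borel_measurable_torus_measure)
  qed auto
  then show ?thesis
    unfolding * by (simp add: LIMSEQ_const_iff)
qed

section \<open>Characters and Fourier coefficients\<close>

definition torus_char :: "int ^ 'n \<Rightarrow> real ^ 'n \<Rightarrow> complex" where
  "torus_char k x = exp (\<i> * complex_of_real (lattice_vec k \<bullet> x))"

lemma torus_char_0 [simp]: "torus_char 0 x = 1"
  by (simp add: torus_char_def)

lemma torus_char_add: "torus_char (k + m) x = torus_char k x * torus_char m x"
  by (simp add: torus_char_def lattice_vec_add inner_add_left distrib_left exp_add)

lemma torus_char_minus_mult [simp]: "torus_char (- k) x * torus_char k x = 1"
  using torus_char_add[of "- k" k x] by simp

lemma torus_char_shift: "torus_char k (x + y) = torus_char k x * torus_char k y"
  by (simp add: torus_char_def inner_add_right distrib_left exp_add)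

lemma torus_char_shift_diff: "torus_char k (x - y) = torus_char k x * torus_char k (- y)"
  using torus_char_shift[of k x "- y"] by simp

lemma norm_torus_char [simp]: "norm (torus_char k x) = 1"
  by (simp add: torus_char_def)

lemma torus_char_eq_cis: "torus_char k x = cis (lattice_vec k \<bullet> x)"
  by (simp add: torus_char_def cis_conv_exp)

lemma inner_lattice_vec: "lattice_vec k \<bullet> (lattice_vec m :: real ^ 'n) = real_of_int (\<Sum>i\<in>UNIV. k $ i * m $ i)"
  by (simp add: inner_vec_def)

lemma torus_periodic_char: "torus_periodic (torus_char k)"
proof -
  have "torus_char k ((2 * pi) *\<^sub>R lattice_vec m) = 1" for m :: "int ^ 'a"
    unfolding torus_char_eq_cis inner_scaleR_right inner_lattice_vec
    by (rule cis_multiple_2pi) (rule Ints_of_int)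
  then show ?thesis
    by (simp add: torus_periodic_def torus_char_shift)
qed

lemma continuous_on_torus_char [continuous_intros]:
  "continuous_on A f \<Longrightarrow> continuous_on A (\<lambda>x. torus_char k (f x))"
  unfolding torus_char_def by (intro continuous_intros)

lemma borel_measurable_torus_char [measurable]: "torus_char k \<in> borel_measurable borel"
  by (intro borel_measurable_continuous_onI continuous_intros)

lemma has_partial_torus_char:
  "has_partial i (torus_char k) (\<lambda>x. \<i> * of_int (k $ i) * torus_char k x)"
proof -
  have "((\<lambda>t. iexp (a + t * b)) has_vector_derivative \<i> * b * iexp a) (at 0)" for a b :: real
  proof -
    have "(iexp \<circ> (\<lambda>t. a + t * b) has_vector_derivative b *\<^sub>R (\<i> * iexp (a + 0 * b))) (at 0)"
      by (intro vector_diff_chain_at) (auto intro!: derivative_eq_intros has_vector_derivative_iexp)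
    then show ?thesis by (simp add: o_def scaleR_conv_of_real mult_ac)
  qed
  from this[of "lattice_vec k \<bullet> _" "of_int (k $ i)"] show ?thesis
    by (simp add: has_partial_def torus_char_def inner_add_right inner_axis)
qed

lemma fourier_coeff_eq:
  "fourier_coeff k \<phi> =
     (LINT z|torus_measure. \<phi> z * torus_char (- k) z) / complex_of_real ((2 * pi) ^ CARD('n))"
  for k :: "int ^ 'n"
  by (simp add: fourier_coeff_def set_integral_torus_box torus_char_def lattice_vec_minus)

lemma torus_periodic_mult:
  "torus_periodic f \<Longrightarrow> torus_periodic g \<Longrightarrow> torus_periodic (\<lambda>x. f x * g x)"
  by (simp add: torus_periodic_def)

lemma torus_periodic_const: "torus_periodic (\<lambda>_. c)"
  by (simp add: torus_periodic_def)

lemma torus_periodic_shift: "torus_periodic f \<Longrightarrow> torus_periodic (\<lambda>x. f (x + a))"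
  by (simp add: torus_periodic_def add.assoc)
     (simp add: add.commute[of _ a] flip: add.assoc)

lemma continuous_on_shift:
  fixes f :: "'a :: topological_monoid_add \<Rightarrow> 'b :: topological_space"
  shows "continuous_on UNIV f \<Longrightarrow> continuous_on UNIV (\<lambda>x. f (x + a))"
  by (rule continuous_on_compose2[of UNIV f]) (auto intro: continuous_intros)

text \<open>For k \<noteq> 0 the character is a nonzero multiple of its own derivative in some
  direction, and derivatives integrate to 0.\<close>

lemma integral_torus_char:
  fixes k :: "int ^ 'n"
  shows "integral\<^sup>L torus_measure (torus_char k) = (if k = 0 then complex_of_real ((2 * pi) ^ CARD('n)) else 0)"
proof (cases "k = 0")
  case True
  then have "torus_char k = (\<lambda>_. 1)" by auto
  with True show ?thesis
    by (simp add: measure_torus_measure_space scaleR_conv_of_real)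
next
  case False
  then obtain i where i: "k $ i \<noteq> 0" by (auto simp: vec_eq_iff)
  have "(LINT x|torus_measure. \<i> * of_int (k $ i) * torus_char k x) = 0"
    by (rule integral_torus_partial[OF has_partial_torus_char torus_periodic_char])
       (auto intro!: continuous_intros)
  then have "\<i> * of_int (k $ i) * integral\<^sup>L torus_measure (torus_char k) = 0" by simp
  with i False show ?thesis by simp
qed

text \<open>Integration by parts, obtained by integrating the derivative of the product of f with
  the conjugate character.\<close>

lemma fourier_coeff_partial:
  assumes D: "has_partial i f f'" and per: "torus_periodic f"
    and cont: "continuous_on UNIV f" "continuous_on UNIV f'"
  shows "fourier_coeff k f' = \<i> * of_int (k $ i) * fourier_coeff k f"
proof -
  note per' = has_partial_periodic[OF D per]
  have "(LINT x|torus_measure. f x * (\<i> * of_int ((- k) $ i) * torus_char (- k) x) + f' x * torus_char (- k) x) = 0"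
    by (rule integral_torus_partial[OF has_partial_mult[OF D has_partial_torus_char]])
       (auto intro!: continuous_intros cont torus_periodic_mult per torus_periodic_char)
  moreover have "integrable torus_measure (\<lambda>x. f x * (\<i> * of_int ((- k) $ i) * torus_char (- k) x))"
    "integrable torus_measure (\<lambda>x. f' x * torus_char (- k) x)"
    by (auto intro!: integrable_torus_measure_continuous continuous_intros cont torus_periodic_mult
          per per' torus_periodic_char torus_periodic_const)
  ultimately have "(LINT x|torus_measure. f' x * torus_char (- k) x) =
      - (LINT x|torus_measure. f x * (\<i> * of_int ((- k) $ i) * torus_char (- k) x))"
    by (simp add: add_eq_0_iff)
  also have "\<dots> = (LINT x|torus_measure. \<i> * of_int (k $ i) * (f x * torus_char (- k) x))"
    by (simp add: mult_ac flip: Bochner_Integration.integral_minus)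
  finally show ?thesis by (simp add: fourier_coeff_eq)
qed

lemma fourier_coeff_diff:
  fixes k :: "int ^ 'n"
  assumes "continuous_on UNIV f" "torus_periodic f" "continuous_on UNIV g" "torus_periodic g"
  shows "fourier_coeff k (\<lambda>x. f x - g x) = fourier_coeff k f - fourier_coeff k g"
proof -
  have "integrable torus_measure (\<lambda>x. f x * torus_char (- k) x)" "integrable torus_measure (\<lambda>x. g x * torus_char (- k) x)"
    by (auto intro!: integrable_torus_measure_continuous continuous_intros assms torus_periodic_mult
          torus_periodic_char)
  then show ?thesis
    by (simp add: fourier_coeff_eq left_diff_distrib diff_divide_distrib)
qed

lemma norm_fourier_coeff_le:
  fixes k :: "int ^ 'n"
  assumes "\<And>x. norm (f x) \<le> B"
  shows "norm (fourier_coeff k f) \<le> B"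
proof -
  have "0 \<le> B" using assms norm_ge_zero order_trans by blast
  have "norm (LINT z|torus_measure. f z * torus_char (- k) z) \<le> (LINT z|(torus_measure :: (real ^ 'n) measure). B)"
  proof (cases "integrable torus_measure (\<lambda>z. f z * torus_char (- k) z)")
    case True
    then show ?thesis
      by (rule Bochner_Integration.integral_norm_bound_integral) (simp_all add: norm_mult assms)
  next
    \<comment> \<open>The Bochner integral is then 0 by convention, so the bound still
      holds.\<close>
    case False
    then show ?thesis
      using \<open>0 \<le> B\<close> by (simp add: not_integrable_integral_eq)
  qed
  then show ?thesis
    by (simp add: fourier_coeff_eq norm_divide measure_torus_measure_space norm_power norm_mult pos_divide_le_eq mult.commute)
qed

lemma fourier_coeff_shift:
  fixes k :: "int ^ 'n"
  assumes "continuous_on UNIV f" "torus_periodic f"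
  shows "fourier_coeff k (\<lambda>x. f (x + a)) = torus_char k a * fourier_coeff k f"
proof -
  have "(LINT z|torus_measure. f (z + a) * torus_char (- k) z) =
      (LINT z|torus_measure. torus_char k a * (f (z + a) * torus_char (- k) (z + a)))"
  proof (intro Bochner_Integration.integral_cong refl)
    fix z :: "real ^ 'n"
    have "torus_char k a * (f (z + a) * torus_char (- k) (z + a)) =
        (torus_char (- k) a * torus_char k a) * (f (z + a) * torus_char (- k) z)"
      by (simp only: torus_char_shift mult_ac)
    then show "f (z + a) * torus_char (- k) z = torus_char k a * (f (z + a) * torus_char (- k) (z + a))"
      by (simp only: torus_char_minus_mult mult_1_left)
  qed
  also have "\<dots> = torus_char k a * (LINT z|torus_measure. f (z + a) * torus_char (- k) (z + a))"
    by simp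
  also have "(LINT z|torus_measure. f (z + a) * torus_char (- k) (z + a)) =
      (LINT z|torus_measure. f z * torus_char (- k) z)"
    by (rule integral_torus_shift[of "\<lambda>z. f z * torus_char (- k) z"])
       (auto intro!: borel_measurable_continuous_onI continuous_intros assms torus_periodic_mult torus_periodic_char)
  finally show ?thesis by (simp add: fourier_coeff_eq)
qed

section \<open>Uniqueness of Fourier coefficients\<close>

text \<open>The powers of this trigonometric polynomial concentrate at the lattice points.\<close>

definition torus_bump :: "'n set \<Rightarrow> real ^ 'n \<Rightarrow> real" where
  "torus_bump S x = (\<Prod>i\<in>S. (1 + cos (x $ i)) / 2)"

lemma continuous_on_torus_bump: "continuous_on A (torus_bump S)"
  unfolding torus_bump_def by (intro continuous_intros) auto

lemma one_plus_cos_nonneg [simp]: "0 \<le> 1 + cos (t :: real)"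
  using cos_ge_minus_one[of t] by linarith

lemma torus_bump_bounds: "0 \<le> torus_bump S x" "torus_bump S x \<le> 1"
proof -
  have "0 \<le> (1 + cos (x $ i)) / 2 \<and> (1 + cos (x $ i)) / 2 \<le> 1" for i
    by simp
  then show "0 \<le> torus_bump S x" "torus_bump S x \<le> 1"
    unfolding torus_bump_def by (blast intro!: prod_nonneg prod_le_1)+
qed

lemma torus_char_axis: "torus_char (axis i 1) x = cis (x $ i)" "torus_char (- axis i 1) x = cis (- (x $ i))"
  by (simp_all add: torus_char_eq_cis lattice_vec_minus lattice_vec_axis inner_axis')

lemma torus_periodic_cos: "torus_periodic (\<lambda>x. cos (x $ i))"
proof -
  have "cos (x $ i) = Re (torus_char (axis i 1) x)" for x :: "real ^ 'a"
    by (simp add: torus_char_axis)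
  then show ?thesis
    using torus_periodic_char[of "axis i 1"] by (simp add: torus_periodic_def)
qed

lemma torus_periodic_bump: "torus_periodic (torus_bump S)"
  unfolding torus_periodic_def torus_bump_def
  by (simp only: torus_periodic_cos[unfolded torus_periodic_def, rule_format] simp_thms)

text \<open>A factor (1 + cos (x $ i)) / 2 only shifts the frequency by 0 or by plus or minus a unit
  vector. Orthogonality to all characters, not just to the constants, therefore survives each
  factor, which is why \<open>orth\<close> quantifies over k.\<close>

lemma integral_torus_bump_orthogonal:
  fixes f :: "real ^ 'n \<Rightarrow> complex"
  assumes cont: "continuous_on UNIV f" and per: "torus_periodic f"
    and zero: "\<And>k. (LINT x|torus_measure. f x * torus_char k x) = 0"
  shows "(LINT x|torus_measure. f x * torus_bump UNIV x ^ N) = 0"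
proof -
  define orth :: "(real ^ 'n \<Rightarrow> real) \<Rightarrow> bool" where
    "orth g \<longleftrightarrow> (\<forall>k. (LINT x|torus_measure. f x * g x * torus_char k x) = 0)" for g
  have step: "orth (\<lambda>x. g x * ((1 + cos (x $ i)) / 2))"
    if g: "orth g" "continuous_on UNIV g" "torus_periodic g" for g i
    unfolding orth_def
  proof
    fix k :: "int ^ 'n"
    have per_g: "torus_periodic (\<lambda>x. complex_of_real (g x))"
      using g(3) by (simp add: torus_periodic_def)
    define F where "F m x = f x * complex_of_real (g x) * torus_char m x" for m x
    have int: "integrable torus_measure (F m)" for m
      unfolding F_def
      by (intro integrable_torus_measure_continuous continuous_intros cont g torus_periodic_mult per
            per_g torus_periodic_char)
    have zero: "integral\<^sup>L torus_measure (F m) = 0" for m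
      using g(1) by (simp add: orth_def F_def[abs_def])
    have cos_cis: "complex_of_real (cos t) = (cis t + cis (- t)) / 2" for t
      by (simp add: complex_eq_iff)
    have "f x * complex_of_real (g x * ((1 + cos (x $ i)) / 2)) * torus_char k x =
        F k x / 2 + F (k + axis i 1) x / 4 + F (k - axis i 1) x / 4" for x
      using torus_char_add[of k "- axis i 1" x]
      by (simp add: F_def torus_char_add torus_char_axis cos_cis field_simps)
    then have "(LINT x|torus_measure. f x * complex_of_real (g x * ((1 + cos (x $ i)) / 2)) * torus_char k x) =
        (LINT x|torus_measure. F k x / 2 + F (k + axis i 1) x / 4 + F (k - axis i 1) x / 4)"
      by (simp only:)
    also have "\<dots> = 0"
      using int zero by simp
    finally show "(LINT x|torus_measure. f x * complex_of_real (g x * ((1 + cos (x $ i)) / 2)) * torus_char k x) = 0" .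
  qed
  have prod: "orth (\<lambda>x. g x * torus_bump S x)"
    if g: "orth g" "continuous_on UNIV g" "torus_periodic g" and "finite S" for g S
    using \<open>finite S\<close>
  proof (induction S rule: finite_induct)
    case empty
    then show ?case using g by (simp add: torus_bump_def)
  next
    case (insert i S)
    have "orth (\<lambda>x. (g x * torus_bump S x) * ((1 + cos (x $ i)) / 2))"
      by (intro step insert.IH continuous_intros continuous_on_torus_bump g torus_periodic_mult torus_periodic_bump)
    then show ?case
      using insert.hyps by (simp add: torus_bump_def mult_ac)
  qed
  have "orth (\<lambda>x. torus_bump UNIV x ^ N)"
  proof (induction N)
    case 0
    show ?case using zero by (simp add: orth_def)
  next
    case (Suc N)
    have "torus_periodic (\<lambda>x. torus_bump (UNIV :: 'n set) x ^ N)"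
      using torus_periodic_bump[of "UNIV :: 'n set"] by (simp add: torus_periodic_def)
    then have "orth (\<lambda>x. torus_bump UNIV x ^ N * torus_bump UNIV x)"
      by (intro prod Suc continuous_intros continuous_on_torus_bump) auto
    then show ?case by (simp add: mult_ac)
  qed
  then show ?thesis
    unfolding orth_def by (metis (no_types, lifting) Bochner_Integration.integral_cong mult.right_neutral of_real_power torus_char_0)
qed

text \<open>If f 0 were nonzero, testing against P ^ N would bound |f 0| times the integral of P ^ N
  by half of itself plus a term of order Q ^ N, where Q bounds P away from the origin. But that
  integral is at least m * q ^ N with q > Q, which fails for large N.\<close>

lemma orthogonal_imp_zero_at_0:
  fixes f :: "real ^ 'n \<Rightarrow> complex"
  assumes cont: "continuous_on UNIV f" and per: "torus_periodic f"
    and zero: "\<And>k. (LINT x|torus_measure. f x * torus_char k x) = 0"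
  shows "f 0 = 0"
proof (rule ccontr)
  assume nz: "f 0 \<noteq> 0"
  define \<epsilon> where "\<epsilon> = norm (f 0) / 2"
  have "\<epsilon> > 0" using nz by (simp add: \<epsilon>_def)
  obtain B where B: "B \<ge> 0" "\<And>x. norm (f x) \<le> B"
    using torus_periodic_bounded[OF cont per] by blast
  define P where "P = torus_bump (UNIV :: 'n set)"
  note P = torus_bump_bounds[of "UNIV :: 'n set", folded P_def]
  have contP: "continuous_on UNIV P" unfolding P_def by (rule continuous_on_torus_bump)
  have perP: "torus_periodic P" unfolding P_def by (rule torus_periodic_bump)
  obtain d where d: "d > 0" "\<And>x. dist x 0 < d \<Longrightarrow> dist (f x) (f 0) < \<epsilon>"
    using cont \<open>\<epsilon> > 0\<close> unfolding continuous_on_iff by (metis UNIV_I)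
  \<comment> \<open>Small enough that a point all of whose coordinates are below \<delta> has norm
    at most d / 2, and that cos \<delta> is positive.\<close>
  define \<delta> where "\<delta> = min 1 (d / (2 * real CARD('n)))"
  have \<delta>: "0 < \<delta>" "\<delta> \<le> 1" "real CARD('n) * \<delta> < d"
    using d(1) by (auto simp: \<delta>_def min_def field_simps)
  define Q where "Q = (1 + cos \<delta>) / 2"
  have "cos \<delta> < 1"
    using cos_monotone_0_pi[of 0 \<delta>] \<delta> pi_gt3 by simp
  moreover have "0 < cos \<delta>"
    using \<delta> pi_gt3 by (intro cos_gt_zero) auto
  ultimately have Q: "0 < Q" "Q < 1" by (auto simp: Q_def)
  \<comment> \<open>Away from 0 some coordinate has absolute value at least \<delta>. Its factor is
    at most Q because cos decreases on [0, pi], and the other factors are at most 1.\<close>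
  have far: "P x \<le> Q" if x: "x \<in> torus_box" and "\<not> dist x 0 < d" for x
  proof -
    have "\<exists>i. \<delta> \<le> \<bar>x $ i\<bar>"
    proof (rule ccontr)
      assume "\<not> (\<exists>i. \<delta> \<le> \<bar>x $ i\<bar>)"
      then have "norm x \<le> (\<Sum>i\<in>(UNIV :: 'n set). \<delta>)"
        by (intro order_trans[OF norm_le_l1_cart sum_mono]) (auto simp: not_le less_imp_le)
      then show False using \<delta>(3) that(2) by simp
    qed
    then obtain i where i: "\<delta> \<le> \<bar>x $ i\<bar>" by blast
    have "cos (x $ i) = cos \<bar>x $ i\<bar>" by simp
    also have "\<dots> \<le> cos \<delta>"
      using i \<delta> x by (intro cos_monotone_0_pi_le) (auto simp: torus_box_def abs_le_iff less_imp_le minus_le_iff dest!: spec[of _ i])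
    finally have "(1 + cos (x $ i)) / 2 \<le> Q" by (simp add: Q_def)
    moreover have "P x = (1 + cos (x $ i)) / 2 * torus_bump (UNIV - {i}) x"
      unfolding P_def torus_bump_def by (subst prod.remove[of _ i]) auto
    moreover have "\<dots> \<le> (1 + cos (x $ i)) / 2 * 1"
      by (intro mult_left_mono torus_bump_bounds) simp
    ultimately show ?thesis by simp
  qed
  \<comment> \<open>Any value strictly between Q and 1 would do: P exceeds it on a neighbourhood U
    of 0, which has positive measure.\<close>
  define q where "q = (1 + Q) / 2"
  have q: "Q < q" "q < 1" using Q by (auto simp: q_def)
  define U where "U = {x \<in> torus_box. q < P x}"
  have [measurable]: "P \<in> borel_measurable borel" "f \<in> borel_measurable borel"
    by (intro borel_measurable_continuous_onI contP cont)+
  define m where "m = measure torus_measure U"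
  have U_sets: "U \<in> sets borel"
  proof -
    have "U = torus_box \<inter> {x \<in> space borel. q < P x}" by (auto simp: U_def)
    also have "\<dots> \<in> sets borel" by measurable
    finally show ?thesis .
  qed
  have U_sets': "U \<in> sets torus_measure"
    using U_sets unfolding torus_measure_def sets_restrict_space by (auto simp: U_def)
  have "m > 0"
  proof -
    have "P 0 = 1" by (simp add: P_def torus_bump_def)
    obtain e where e: "e > 0" "\<And>x. dist x 0 < e \<Longrightarrow> dist (P x) (P 0) < 1 - q"
      using contP q(2) unfolding continuous_on_iff by (metis UNIV_I diff_gt_0_iff_gt)
    have "ball 0 (min e 1) \<subseteq> U"
    proof
      fix x :: "real ^ 'n" assume "x \<in> ball 0 (min e 1)"
      then have x: "norm x < e" "norm x < 1" by auto
      have "\<bar>x $ i\<bar> < pi" for i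
        using component_le_norm_cart[of x i] x(2) pi_gt3 by linarith
      then have "x \<in> torus_box"
        by (auto simp: torus_box_def abs_less_iff less_imp_le minus_less_iff)
      moreover have "q < P x"
        using e(2)[of x] x \<open>P 0 = 1\<close> by (auto simp: dist_real_def)
      ultimately show "x \<in> U" by (simp add: U_def)
    qed
    then have "emeasure lborel (ball (0 :: real ^ 'n) (min e 1)) \<le> emeasure lborel U"
      using U_sets by (intro emeasure_mono) auto
    moreover have "0 < emeasure lborel (ball (0 :: real ^ 'n) (min e 1))"
    proof -
      have "0 < measure lborel (ball (0 :: real ^ 'n) (min e 1))"
        using e(1) by (intro content_ball_pos) auto
      then show ?thesis
        by (simp add: measure_def enn2real_positive_iff)
    qed
    moreover have "emeasure lborel U = emeasure torus_measure U"
      unfolding torus_measure_def using U_sets by (subst emeasure_restrict_space) (auto simp: U_def)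
    ultimately have "0 < emeasure torus_measure U" by simp
    then show ?thesis
      unfolding m_def by (simp add: torus_measure.emeasure_eq_measure)
  qed
  have key: "\<epsilon> * q ^ N * m \<le> 2 * B * (2 * pi) ^ CARD('n) * Q ^ N" for N
  proof -
    let ?I = "LINT x|torus_measure. P x ^ N"
    have perN: "torus_periodic (\<lambda>x. P x ^ N)" "torus_periodic (\<lambda>x. complex_of_real (P x ^ N))"
      using perP by (simp_all add: torus_periodic_def)
    have int: "integrable torus_measure (\<lambda>x. P x ^ N)"
      by (intro integrable_torus_measure_continuous perN continuous_intros contP)
    have int2: "integrable torus_measure (\<lambda>x. f x * complex_of_real (P x ^ N))"
      by (intro integrable_torus_measure_continuous perN continuous_intros contP cont torus_periodic_mult per)
    have eq: "f 0 * complex_of_real ?I =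
        (LINT x|torus_measure. (f 0 - f x) * complex_of_real (P x ^ N))"
    proof -
      have "(LINT x|torus_measure. (f 0 - f x) * complex_of_real (P x ^ N)) =
          (LINT x|torus_measure. f 0 * complex_of_real (P x ^ N)) - (LINT x|torus_measure. f x * complex_of_real (P x ^ N))"
        using int int2 by (subst Bochner_Integration.integral_diff[symmetric])
          (auto simp: left_diff_distrib simp del: of_real_power)
      \<comment> \<open>Orthogonality enters here, replacing f 0 by the difference f 0 - f x, which
        is small near the origin.\<close>
      also have "(LINT x|torus_measure. f x * complex_of_real (P x ^ N)) = 0"
        using integral_torus_bump_orthogonal[OF cont per zero] by (simp add: P_def)
      finally show ?thesis by (simp del: of_real_power)
    qed
    have "2 * \<epsilon> * ?I =
        norm (LINT x|torus_measure. (f 0 - f x) * complex_of_real (P x ^ N))"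
    proof -
      have "0 \<le> ?I"
        using P by (intro Bochner_Integration.integral_nonneg) simp
      moreover have "2 * \<epsilon> = norm (f 0)" by (simp add: \<epsilon>_def)
      ultimately have "2 * \<epsilon> * ?I = norm (f 0 * complex_of_real ?I)"
        by (simp add: norm_mult)
      with eq show ?thesis by (simp only:)
    qed
    also have "\<dots> \<le> (LINT x|torus_measure. \<epsilon> * P x ^ N + 2 * B * Q ^ N)"
    proof (rule Bochner_Integration.integral_norm_bound_integral)
      show "integrable torus_measure (\<lambda>x. \<epsilon> * P x ^ N + 2 * B * Q ^ N)" using int by simp
      show "integrable torus_measure (\<lambda>x. (f 0 - f x) * complex_of_real (P x ^ N))"
        using int int2 by (simp add: left_diff_distrib del: of_real_power)
      fix x :: "real ^ 'n" assume "x \<in> space torus_measure"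
      then have x: "x \<in> torus_box" by simp
      have PN: "0 \<le> P x ^ N" using P by simp
      have "norm (f 0 - f x) * P x ^ N \<le> \<epsilon> * P x ^ N + 2 * B * Q ^ N"
      proof (cases "dist x 0 < d")
        case True
        then have "norm (f 0 - f x) * P x ^ N \<le> \<epsilon> * P x ^ N"
          using d(2)[OF True] PN by (intro mult_right_mono) (auto simp: dist_norm norm_minus_commute)
        then show ?thesis using B(1) Q by (simp add: add_increasing2)
      next
        case False
        have "norm (f 0 - f x) \<le> 2 * B"
          using B(2)[of 0] B(2)[of x] norm_triangle_ineq4[of "f 0" "f x"] by linarith
        moreover have "P x ^ N \<le> Q ^ N"
          using far[OF x False] P by (intro power_mono) auto
        ultimately have "norm (f 0 - f x) * P x ^ N \<le> 2 * B * Q ^ N"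
          using PN B(1) by (intro mult_mono) auto
        then show ?thesis using \<open>\<epsilon> > 0\<close> PN by (simp add: add_increasing)
      qed
      then show "norm ((f 0 - f x) * complex_of_real (P x ^ N)) \<le> \<epsilon> * P x ^ N + 2 * B * Q ^ N"
        using PN by (simp add: norm_mult norm_power P)
    qed
    also have "\<dots> = \<epsilon> * ?I + 2 * B * (2 * pi) ^ CARD('n) * Q ^ N"
      using int by (simp add: measure_torus_measure_space)
    finally have "\<epsilon> * ?I \<le> 2 * B * (2 * pi) ^ CARD('n) * Q ^ N" by simp
    moreover have "q ^ N * m \<le> ?I"
    proof -
      have "q ^ N * m = (LINT x|torus_measure. q ^ N * indicator U x)"
        using U_sets' sets.sets_into_space[OF U_sets'] by (simp add: m_def Int_absorb2)
      also have "\<dots> \<le> ?I"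
      proof (rule integral_mono)
        show "integrable torus_measure (\<lambda>x. q ^ N * indicator U x :: real)"
          using U_sets' by (simp add: torus_measure.emeasure_eq_measure)
        show "q ^ N * indicator U x \<le> P x ^ N" for x
          using P q Q by (auto simp: U_def indicator_def intro!: power_mono)
      qed (rule int)
      finally show ?thesis .
    qed
    then have "\<epsilon> * (q ^ N * m) \<le> \<epsilon> * ?I"
      using \<open>\<epsilon> > 0\<close> by (intro mult_left_mono) auto
    ultimately show ?thesis by (simp only: mult.assoc)
  qed
  have "(\<lambda>N. (Q / q) ^ N) \<longlonglongrightarrow> 0"
    using q Q by (intro LIMSEQ_power_zero) (simp add: divide_less_eq)
  then have "(\<lambda>N. 2 * B * (2 * pi) ^ CARD('n) * (Q / q) ^ N) \<longlonglongrightarrow> 2 * B * (2 * pi) ^ CARD('n) * 0"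
    by (rule tendsto_mult[OF tendsto_const])
  moreover have "\<epsilon> * m \<le> 2 * B * (2 * pi) ^ CARD('n) * (Q / q) ^ N" for N
    using key[of N] q Q by (simp add: power_divide field_simps)
  ultimately have "\<epsilon> * m \<le> 2 * B * (2 * pi) ^ CARD('n) * 0"
    by (intro LIMSEQ_le_const) auto
  then show False using \<open>m > 0\<close> \<open>\<epsilon> > 0\<close> by (simp add: mult_le_0_iff)
qed

text \<open>Translation multiplies each coefficient by a character value, so the vanishing at 0 can
  be applied to the translate of f by x.\<close>

theorem fourier_coeff_zero_imp_zero:
  fixes f :: "real ^ 'n \<Rightarrow> complex"
  assumes cont: "continuous_on UNIV f" and per: "torus_periodic f"
    and zero: "\<And>k. fourier_coeff k f = 0"
  shows "f x = 0"
proof -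
  have "(LINT z|torus_measure. f (z + x) * torus_char k z) = 0" for k
    using fourier_coeff_shift[OF cont per, of "- k" x] zero[of "- k"] by (simp add: fourier_coeff_eq)
  from orthogonal_imp_zero_at_0[OF continuous_on_shift[OF cont] torus_periodic_shift[OF per] this]
  show ?thesis by simp
qed

section \<open>Smooth functions and Fourier inversion\<close>

lemma torus_smoothD:
  assumes "\<phi> \<in> torus_smooth"
  shows "torus_periodic \<phi>" "continuous_on UNIV \<phi>"
proof -
  have \<phi>: "torus_periodic \<phi>" "\<And>k. cont_diff k \<phi>"
    using assms unfolding torus_smooth_def by blast+
  show "torus_periodic \<phi>" by (rule \<phi>)
  show "continuous_on UNIV \<phi>" using \<phi>(2)[of 0] by simp
qed

lemma cont_diff_Suc_partial:
  assumes "cont_diff (Suc k) f"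
  shows "has_partial i f (partial_along i f)" "cont_diff k (partial_along i f)"
proof -
  have "\<And>x. (\<lambda>t. f (x + t *\<^sub>R axis i 1)) differentiable (at 0)"
    using assms by simp
  then show "has_partial i f (partial_along i f)"
    unfolding has_partial_def partial_along_def vector_derivative_works[symmetric] by blast
  show "cont_diff k (partial_along i f)" using assms by simp
qed

lemma cont_diff_continuous: "cont_diff k f \<Longrightarrow> continuous_on UNIV f"
  by (cases k) auto

lemma torus_smooth_partial:
  assumes "\<phi> \<in> torus_smooth"
  shows "has_partial i \<phi> (partial_along i \<phi>)" "partial_along i \<phi> \<in> torus_smooth"
proof -
  show 1: "has_partial i \<phi> (partial_along i \<phi>)"
    using assms unfolding torus_smooth_def by (blast intro: cont_diff_Suc_partial(1))
  show "partial_along i \<phi> \<in> torus_smooth"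
    using assms has_partial_periodic[OF 1] unfolding torus_smooth_def
    by (blast intro: cont_diff_Suc_partial(2))
qed

lemma has_partial_diff:
  assumes "has_partial i f f'" "has_partial i g g'"
  shows "has_partial i (\<lambda>x. f x - g x) (\<lambda>x. f' x - g' x)"
  using assms by (auto simp: has_partial_def intro: has_vector_derivative_diff)

lemma cont_diff_SucI:
  assumes "continuous_on UNIV f" "\<And>i. has_partial i f (f' i)" "\<And>i. cont_diff k (f' i)"
  shows "cont_diff (Suc k) f"
proof -
  have "(\<lambda>t. f (x + t *\<^sub>R axis i 1)) differentiable (at 0)" for i x
    using assms(2)[of i] by (auto simp: has_partial_def intro: differentiableI_vector)
  then show ?thesis
    using assms by (simp add: partial_along_eqI[OF assms(2)])
qed

lemma cont_diff_diff:
  "cont_diff k f \<Longrightarrow> cont_diff k g \<Longrightarrow> cont_diff k (\<lambda>x. f x - g x)"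
proof (induction k arbitrary: f g)
  case (Suc k)
  show ?case
  proof (rule cont_diff_SucI)
    show "continuous_on UNIV (\<lambda>x. f x - g x)"
      using Suc.prems by (intro continuous_intros cont_diff_continuous)
    show "has_partial i (\<lambda>x. f x - g x) (\<lambda>x. partial_along i f x - partial_along i g x)" for i
      by (intro has_partial_diff cont_diff_Suc_partial(1)[of k] Suc.prems)
    show "cont_diff k (\<lambda>x. partial_along i f x - partial_along i g x)" for i
      by (intro Suc.IH cont_diff_Suc_partial(2) Suc.prems)
  qed
qed (auto intro: continuous_intros)

lemma torus_smooth_diff:
  "f \<in> torus_smooth \<Longrightarrow> g \<in> torus_smooth \<Longrightarrow> (\<lambda>x. f x - g x) \<in> torus_smooth"
  by (simp add: torus_smooth_def cont_diff_diff torus_periodic_def)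

text \<open>Apply \<open>1 - \<partial>\<^sub>i\<^sup>2\<close> to \<open>\<phi>\<close> for each \<open>i \<in> S\<close>.\<close>

lemma torus_smooth_fourier_weight:
  fixes \<phi> :: "real ^ 'n \<Rightarrow> complex"
  assumes "\<phi> \<in> torus_smooth" "finite S"
  shows "\<exists>\<psi>\<in>torus_smooth. \<forall>k. fourier_coeff k \<psi> =
    of_real (\<Prod>i\<in>S. 1 + (real_of_int (k $ i))\<^sup>2) * fourier_coeff k \<phi>"
  using assms(2)
proof (induction S rule: finite_induct)
  case empty
  then show ?case using assms(1) by auto
next
  case (insert i S)
  then obtain \<psi> where \<psi>: "\<psi> \<in> torus_smooth" and
    coeff: "\<And>k. fourier_coeff k \<psi> = of_real (\<Prod>i\<in>S. 1 + (real_of_int (k $ i))\<^sup>2) * fourier_coeff k \<phi>"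
    by blast
  note P = torus_smooth_partial[OF \<psi>, of i]
  note P2 = torus_smooth_partial[OF P(2), of i]
  define \<eta> where "\<eta> = (\<lambda>x. \<psi> x - partial_along i (partial_along i \<psi>) x)"
  have "\<eta> \<in> torus_smooth"
    unfolding \<eta>_def by (intro torus_smooth_diff \<psi> P2)
  moreover have "fourier_coeff k \<eta> =
      of_real (\<Prod>i\<in>insert i S. 1 + (real_of_int (k $ i))\<^sup>2) * fourier_coeff k \<phi>" for k
  proof -
    have "fourier_coeff k \<eta> = fourier_coeff k \<psi> - fourier_coeff k (partial_along i (partial_along i \<psi>))"
      unfolding \<eta>_def by (intro fourier_coeff_diff torus_smoothD \<psi> P2)
    also have "fourier_coeff k (partial_along i (partial_along i \<psi>)) =
        \<i> * of_int (k $ i) * (\<i> * of_int (k $ i) * fourier_coeff k \<psi>)"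
      by (simp only: fourier_coeff_partial[OF P2(1)] fourier_coeff_partial[OF P(1)] torus_smoothD \<psi> P P2)
    also have "fourier_coeff k \<psi> - \<dots> = of_real (1 + (real_of_int (k $ i))\<^sup>2) * fourier_coeff k \<psi>"
      by (simp add: algebra_simps power2_eq_square)
    finally show ?thesis
      using insert.hyps by (simp add: coeff mult.assoc)
  qed
  ultimately show ?case by blast
qed

lemma sum_inverse_one_plus_square_int_le:
  obtains S where "S > 0" "\<And>B :: int set. finite B \<Longrightarrow> (\<Sum>m\<in>B. 1 / (1 + (real_of_int m)\<^sup>2)) \<le> S"
proof -
  let ?g = "\<lambda>n :: nat. 1 / (1 + (real n)\<^sup>2)"
  have "summable ?g"
  proof (rule summable_comparison_test')
    show "summable (\<lambda>n. inverse ((real n)\<^sup>2))"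
      by (rule inverse_power_summable) simp
    show "norm (?g n) \<le> inverse ((real n)\<^sup>2)" if "n \<ge> 1" for n
      using that by (simp add: divide_simps add_pos_nonneg)
  qed
  then have g: "(\<Sum>n\<in>N. ?g n) \<le> suminf ?g" if "finite N" for N
    using that by (intro sum_le_suminf) auto
  \<comment> \<open>Nonnegative and negative integers each contribute at most one copy of the series
    over the naturals; the 1 makes S positive.\<close>
  define S where "S = 2 * suminf ?g + 1"
  have S: "(\<Sum>m\<in>B. 1 / (1 + (real_of_int m)\<^sup>2)) \<le> S" if "finite B" for B :: "int set"
  proof -
    let ?h = "\<lambda>m :: int. 1 / (1 + (real_of_int m)\<^sup>2)"
    have "sum ?h B \<le> sum ?h {m\<in>B. 0 \<le> m} + sum ?h {m\<in>B. m < 0}"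
      using that by (subst sum.union_disjoint[symmetric]) (auto intro!: sum_mono2)
    also have "sum ?h {m\<in>B. 0 \<le> m} = sum ?g (nat ` {m\<in>B. 0 \<le> m})"
      by (subst sum.reindex) (auto simp: inj_on_def intro!: sum.cong)
    also have "sum ?h {m\<in>B. m < 0} = sum ?g ((\<lambda>m. nat (- m)) ` {m\<in>B. m < 0})"
      by (subst sum.reindex) (auto simp: inj_on_def intro!: sum.cong)
    also have "sum ?g (nat ` {m\<in>B. 0 \<le> m}) + sum ?g ((\<lambda>m. nat (- m)) ` {m\<in>B. m < 0}) \<le> S"
      unfolding S_def using that g[of "nat ` {m\<in>B. 0 \<le> m}"] g[of "(\<lambda>m. nat (- m)) ` {m\<in>B. m < 0}"] by simp
    finally show ?thesis by simp
  qed
  have "0 \<le> suminf ?g" using g[of "{}"] by simp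
  then have "S > 0" by (simp add: S_def)
  then show thesis using S that by blast
qed

text \<open>Every finite set of lattice points lies in a product of copies of one finite set B of
  integers, and over such a product the sum factors into one-dimensional sums.\<close>

lemma summable_on_prod_inverse_squares:
  "(\<lambda>k :: int ^ 'n. \<Prod>i\<in>UNIV. 1 / (1 + (real_of_int (k $ i))\<^sup>2)) summable_on UNIV"
proof -
  obtain S where S: "S > 0" "\<And>B :: int set. finite B \<Longrightarrow> (\<Sum>m\<in>B. 1 / (1 + (real_of_int m)\<^sup>2)) \<le> S"
    using sum_inverse_one_plus_square_int_le by metis
  show ?thesis
  proof (rule nonneg_bdd_above_summable_on)
    show "bdd_above (sum (\<lambda>k :: int ^ 'n. \<Prod>i\<in>UNIV. 1 / (1 + (real_of_int (k $ i))\<^sup>2)) ` {F. F \<subseteq> UNIV \<and> finite F})"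
    proof (rule bdd_aboveI2)
      fix F :: "(int ^ 'n) set" assume "F \<in> {F. F \<subseteq> UNIV \<and> finite F}"
      then have F: "finite F" by simp
      define B where "B = (\<Union>k\<in>F. range (vec_nth k))"
      have B: "finite B" using F by (simp add: B_def)
      have "(\<Sum>k\<in>F. \<Prod>i\<in>UNIV. 1 / (1 + (real_of_int (k $ i))\<^sup>2)) =
          (\<Sum>h\<in>vec_nth ` F. \<Prod>i\<in>UNIV. 1 / (1 + (real_of_int (h i))\<^sup>2))"
        by (subst sum.reindex) (auto simp: inj_on_def vec_nth_inject)
      also have "\<dots> \<le> (\<Sum>h\<in>Pi\<^sub>E (UNIV :: 'n set) (\<lambda>_. B). \<Prod>i\<in>UNIV. 1 / (1 + (real_of_int (h i))\<^sup>2))"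
        using B by (intro sum_mono2 finite_PiE) (auto simp: B_def intro!: prod_nonneg)
      also have "\<dots> = (\<Prod>i\<in>(UNIV :: 'n set). \<Sum>m\<in>B. 1 / (1 + (real_of_int m)\<^sup>2))"
        using B by (subst prod_sum_PiE) auto
      also have "\<dots> \<le> S ^ CARD('n)"
        using S(2)[OF B] by (simp add: power_mono sum_nonneg)
      finally show "(\<Sum>k\<in>F. \<Prod>i\<in>UNIV. 1 / (1 + (real_of_int (k $ i))\<^sup>2)) \<le> S ^ CARD('n)" .
    qed
  qed (auto intro!: prod_nonneg)
qed

lemma prod_one_plus_ge:
  fixes a :: "'i \<Rightarrow> real"
  assumes "finite S" "\<And>i. i \<in> S \<Longrightarrow> 0 \<le> a i"
  shows "1 + (\<Sum>i\<in>S. a i) \<le> (\<Prod>i\<in>S. 1 + a i)"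
  using assms
proof (induction S rule: finite_induct)
  case (insert i S)
  have "1 + (\<Sum>i\<in>insert i S. a i) = (1 + (\<Sum>i\<in>S. a i)) + a i * 1"
    using insert by simp
  also have "\<dots> \<le> (\<Prod>i\<in>S. 1 + a i) + a i * (\<Prod>i\<in>S. 1 + a i)"
    using insert by (intro add_mono mult_left_mono prod_ge_1) auto
  finally show ?case using insert by (simp add: algebra_simps)
qed simp

lemma powr_le_one_plus_square:
  fixes u :: real
  assumes "0 \<le> u" "0 \<le> s" "s \<le> 2"
  shows "u powr s \<le> 1 + u\<^sup>2"
proof (cases "u \<le> 1")
  case True
  then have "u powr s \<le> 1" using assms by (simp add: powr_le1)
  then show ?thesis by (simp add: add_increasing2)
next
  case False
  then have "u powr s \<le> u powr 2" using assms by (intro powr_mono) auto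
  then show ?thesis using False by (simp add: powr_numeral)
qed

text \<open>Compares the symbol of order s with the weight produced by
  \<open>torus_smooth_fourier_weight\<close>.\<close>

lemma norm_powr_le_prod:
  fixes x :: "real ^ 'n"
  assumes "0 \<le> s" "s \<le> 2"
  shows "norm x powr s \<le> (\<Prod>i\<in>UNIV. 1 + (x $ i)\<^sup>2)"
proof -
  have "norm x powr s \<le> 1 + (norm x)\<^sup>2"
    using assms by (intro powr_le_one_plus_square) auto
  also have "(norm x)\<^sup>2 = (\<Sum>i\<in>UNIV. (x $ i)\<^sup>2)"
    by (simp add: norm_vec_def L2_set_def sum_nonneg)
  also have "1 + \<dots> \<le> (\<Prod>i\<in>UNIV. 1 + (x $ i)\<^sup>2)"
    by (intro prod_one_plus_ge) auto
  finally show ?thesis .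
qed

text \<open>The weight is applied twice: one copy absorbs the power of |k|, the other leaves a
  summable family.\<close>

lemma torus_smooth_fourier_summable:
  fixes \<phi> :: "real ^ 'n \<Rightarrow> complex"
  assumes "\<phi> \<in> torus_smooth" "0 \<le> s" "s \<le> 2"
  shows "(\<lambda>k. norm (lattice_vec k :: real ^ 'n) powr s * norm (fourier_coeff k \<phi>)) summable_on UNIV"
proof -
  let ?p = "\<lambda>k :: int ^ 'n. \<Prod>i\<in>UNIV. 1 + (real_of_int (k $ i))\<^sup>2"
  obtain \<psi>' where \<psi>': "\<psi>' \<in> torus_smooth" "\<And>k. fourier_coeff k \<psi>' = of_real (?p k) * fourier_coeff k \<phi>"
    using torus_smooth_fourier_weight[OF assms(1), of UNIV] by auto
  obtain \<psi> where \<psi>: "\<psi> \<in> torus_smooth" "\<And>k. fourier_coeff k \<psi> = of_real (?p k) * fourier_coeff k \<psi>'"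
    using torus_smooth_fourier_weight[OF \<psi>'(1), of UNIV] by auto
  obtain B where B: "\<And>x. norm (\<psi> x) \<le> B"
    using torus_periodic_bounded torus_smoothD[OF \<psi>(1)] by blast
  have pos: "0 < ?p k" for k by (intro prod_pos) (simp add: add_pos_nonneg)
  have inv: "(\<Prod>i\<in>UNIV. 1 / (1 + (real_of_int (k $ i))\<^sup>2)) = 1 / ?p k" for k
    by (simp add: prod_dividef)
  have "(\<lambda>k :: int ^ 'n. B * (1 / ?p k)) summable_on UNIV"
    using summable_on_prod_inverse_squares[where 'n = 'n] unfolding inv by (intro summable_on_cmult_right)
  then show ?thesis
  proof (rule summable_on_comparison_test)
    fix k :: "int ^ 'n"
    have "?p k * (?p k * norm (fourier_coeff k \<phi>)) = norm (fourier_coeff k \<psi>)"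
      using pos[of k] by (simp add: \<psi> \<psi>' norm_mult del: of_real_prod)
    also have "\<dots> \<le> B" by (rule norm_fourier_coeff_le) (rule B)
    finally have "?p k * norm (fourier_coeff k \<phi>) \<le> B * (1 / ?p k)"
      using pos[of k] by (simp add: field_simps)
    moreover have "norm (lattice_vec k :: real ^ 'n) powr s \<le> ?p k"
      using norm_powr_le_prod[OF assms(2,3), of "lattice_vec k"] by simp
    ultimately have "norm (lattice_vec k :: real ^ 'n) powr s * norm (fourier_coeff k \<phi>) \<le> B * (1 / ?p k)"
      by (meson mult_right_mono norm_ge_zero order_trans)
    then show "norm (lattice_vec k :: real ^ 'n) powr s * norm (fourier_coeff k \<phi>) \<le> B * (1 / ?p k)" .
  qed simp
qed

text \<open>The partial sums converge uniformly by the M-test, so their limit S is continuous; it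
  has the coefficients of f, and uniqueness identifies the two.\<close>

theorem fourier_inversion:
  fixes f :: "real ^ 'n \<Rightarrow> complex"
  assumes cont: "continuous_on UNIV f" and per: "torus_periodic f"
    and summ: "(\<lambda>k. norm (fourier_coeff k f)) summable_on UNIV"
  shows "(\<Sum>\<^sub>\<infinity>k. fourier_coeff k f * torus_char k x) = f x"
proof -
  define S where "S x = (\<Sum>\<^sub>\<infinity>k. fourier_coeff k f * torus_char k x)" for x
  define P where "P F x = (\<Sum>k\<in>F. fourier_coeff k f * torus_char k x)" for F x
  have lim: "uniform_limit UNIV P S (finite_subsets_at_top UNIV)"
    unfolding P_def[abs_def] S_def[abs_def]
    by (rule Weierstrass_m_test_general[OF _ summ]) (simp add: norm_mult)
  have contP: "continuous_on UNIV (P F)" for F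
    unfolding P_def[abs_def] by (intro continuous_intros)
  have perP: "torus_periodic (P F)" for F
    unfolding torus_periodic_def P_def by (simp only: torus_periodicD[OF torus_periodic_char] simp_thms)
  have contS: "continuous_on UNIV S"
    by (rule uniform_limit_theorem[OF _ lim finite_subsets_at_top_neq_bot]) (intro always_eventually allI contP)
  have perS: "torus_periodic S"
    unfolding torus_periodic_def S_def by (simp only: torus_periodicD[OF torus_periodic_char] simp_thms)
  have coeffP: "fourier_coeff m (P F) = (if m \<in> F then fourier_coeff m f else 0)" if "finite F" for m F
  proof -
    have int: "integrable torus_measure (torus_char k)" for k :: "int ^ 'n"
      by (intro integrable_torus_measure_continuous torus_periodic_char continuous_intros)
    have "(LINT z|torus_measure. P F z * torus_char (- m) z) =
        (LINT z|torus_measure. (\<Sum>k\<in>F. fourier_coeff k f * torus_char (k - m) z))"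
      using torus_char_add[of _ "- m"] by (simp add: P_def sum_distrib_right mult.assoc)
    also have "\<dots> = (\<Sum>k\<in>F. fourier_coeff k f * (LINT z|torus_measure. torus_char (k - m) z))"
      by (subst Bochner_Integration.integral_sum) (auto intro: int)
    also have "\<dots> = (\<Sum>k\<in>F. if k = m then fourier_coeff k f * complex_of_real ((2 * pi) ^ CARD('n)) else 0)"
      by (intro sum.cong) (auto simp: integral_torus_char)
    also have "\<dots> = (if m \<in> F then fourier_coeff m f * complex_of_real ((2 * pi) ^ CARD('n)) else 0)"
      using that by simp
    finally show ?thesis by (simp add: fourier_coeff_eq)
  qed
  have coeffS: "fourier_coeff m S = fourier_coeff m f" for m
  proof -
    \<comment> \<open>Coefficients are contractive in the sup norm, so it suffices to take a partial
      sum that is uniformly e-close to S and already contains the frequency m.\<close>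
    have "norm (fourier_coeff m S - fourier_coeff m f) \<le> e" if "e > 0" for e
    proof -
      have "\<forall>\<^sub>F F in finite_subsets_at_top UNIV. \<forall>x\<in>UNIV. dist (P F x) (S x) < e"
        using lim that by (simp add: uniform_limit_iff)
      moreover have "\<forall>\<^sub>F F in finite_subsets_at_top UNIV. finite F \<and> {m} \<subseteq> F"
        by (subst eventually_finite_subsets_at_top) (auto intro!: exI[of _ "{m}"])
      ultimately have "\<forall>\<^sub>F F in finite_subsets_at_top UNIV. (\<forall>x\<in>UNIV. dist (P F x) (S x) < e) \<and> (finite F \<and> {m} \<subseteq> F)"
        by (rule eventually_conj)
      then have "\<exists>F. (\<forall>x\<in>UNIV. dist (P F x) (S x) < e) \<and> (finite F \<and> {m} \<subseteq> F)"
        by (rule eventually_happens'[OF finite_subsets_at_top_neq_bot])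
      then obtain F where F: "\<And>x. dist (P F x) (S x) < e" "finite F" "m \<in> F"
        by blast
      have "norm (fourier_coeff m (\<lambda>x. S x - P F x)) \<le> e"
        using F(1) by (intro norm_fourier_coeff_le) (simp add: dist_norm norm_minus_commute less_imp_le)
      then show ?thesis
        by (simp only: fourier_coeff_diff[OF contS perS contP perP] coeffP[OF F(2)] F(3) if_True)
    qed
    then have "norm (fourier_coeff m S - fourier_coeff m f) \<le> 0"
      by (rule field_le_epsilon) simp
    then show ?thesis by simp
  qed
  have "S x - f x = 0"
  proof (rule fourier_coeff_zero_imp_zero[of "\<lambda>x. S x - f x"])
    show "continuous_on UNIV (\<lambda>x. S x - f x)" by (rule continuous_on_diff[OF contS cont])
    show "torus_periodic (\<lambda>x. S x - f x)" using perS per by (simp add: torus_periodic_def)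
    show "fourier_coeff k (\<lambda>x. S x - f x) = 0" for k
      by (simp only: fourier_coeff_diff[OF contS perS cont per] coeffS diff_self)
  qed
  then show ?thesis by (simp add: S_def)
qed

section \<open>A stable Levy measure\<close>

definition levy_time :: "real \<Rightarrow> real measure" where
  "levy_time \<sigma> = density lborel (\<lambda>s. ennreal (indicator {0<..} s * s powr (- 1 - 2 * \<sigma>)))"

lemma sets_levy_time [measurable_cong, simp]: "sets (levy_time \<sigma>) = sets borel"
  by (simp add: levy_time_def)

lemma space_levy_time [simp]: "space (levy_time \<sigma>) = UNIV"
  by (simp add: levy_time_def)

lemma sigma_finite_levy_time: "sigma_finite_measure (levy_time \<sigma>)"
  unfolding levy_time_def by (subst sigma_finite_measure.sigma_finite_iff_density_finite[OF sigma_finite_lborel]) auto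

lemma nn_integral_levy_time:
  assumes [measurable]: "f \<in> borel_measurable borel"
  shows "(\<integral>\<^sup>+s. f s \<partial>levy_time \<sigma>) =
    (\<integral>\<^sup>+s. ennreal (indicator {0<..} s * s powr (- 1 - 2 * \<sigma>)) * f s \<partial>lborel)"
  unfolding levy_time_def by (subst nn_integral_density) auto

text \<open>One power is integrated near 0, where a > 2\<sigma> gives convergence, and the other
  near infinity, where b < 2\<sigma> does.\<close>

lemma nn_integral_levy_time_min_le:
  assumes "0 < u" "0 < r" "2 * \<sigma> < a" "b < 2 * \<sigma>"
  shows "(\<integral>\<^sup>+s. ennreal (min (\<bar>s * u\<bar> powr a) (r powr (a - b) * \<bar>s * u\<bar> powr b)) \<partial>levy_time \<sigma>) \<le>
    ennreal (u powr (2 * \<sigma>) * (r powr (a - 2 * \<sigma>) * (1 / (a - 2 * \<sigma>) + 1 / (2 * \<sigma> - b))))"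
proof -
  \<comment> \<open>At s = c one has s * u = r, where the two powers in the minimum
    coincide.\<close>
  define c where "c = r / u"
  have "c > 0" using assms by (simp add: c_def)
  let ?h = "\<lambda>s. min (\<bar>s * u\<bar> powr a) (r powr (a - b) * \<bar>s * u\<bar> powr b)"
  let ?f = "\<lambda>s. u powr a * s powr (a - 1 - 2 * \<sigma>)"
  let ?g = "\<lambda>s. r powr (a - b) * u powr b * s powr (b - 1 - 2 * \<sigma>)"
  let ?I = "u powr a * (c powr (a - 1 - 2 * \<sigma> + 1) / (a - 1 - 2 * \<sigma> + 1))"
  let ?J = "r powr (a - b) * u powr b * (- (c powr (b - 1 - 2 * \<sigma> + 1)) / (b - 1 - 2 * \<sigma> + 1))"
  have f: "(?f has_integral ?I) {0..c}"
    using assms \<open>c > 0\<close> by (intro has_integral_mult_right has_integral_powr_from_0) auto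
  have g: "(?g has_integral ?J) {c..}"
    using assms \<open>c > 0\<close> by (intro has_integral_mult_right has_integral_powr_to_inf) auto
  have "(\<integral>\<^sup>+s. ennreal (?h s) \<partial>levy_time \<sigma>) =
      (\<integral>\<^sup>+s. ennreal (indicator {0<..} s * s powr (- 1 - 2 * \<sigma>)) *
        ennreal (?h s) \<partial>lborel)"
    by (rule nn_integral_levy_time) measurable
  also have "\<dots> \<le> (\<integral>\<^sup>+s. ennreal (indicator {0..c} s * ?f s) + ennreal (indicator {c..} s * ?g s) \<partial>lborel)"
  proof (rule nn_integral_mono)
    fix s :: real
    show "ennreal (indicator {0<..} s * s powr (- 1 - 2 * \<sigma>)) *
        ennreal (?h s)
      \<le> ennreal (indicator {0..c} s * ?f s) + ennreal (indicator {c..} s * ?g s)"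
    proof (cases "s > 0")
      case True
      have pow: "s powr (- 1 - 2 * \<sigma>) * \<bar>s * u\<bar> powr p = u powr p * s powr (p - 1 - 2 * \<sigma>)" for p
        using True assms by (simp add: abs_mult powr_mult powr_add[symmetric] mult.left_commute algebra_simps)
      have "s powr (- 1 - 2 * \<sigma>) * ?h s \<le>
          indicator {0..c} s * ?f s + indicator {c..} s * ?g s"
      proof (cases "s \<le> c")
        case s: True
        have "s powr (- 1 - 2 * \<sigma>) * ?h s \<le>
            s powr (- 1 - 2 * \<sigma>) * \<bar>s * u\<bar> powr a"
          by (intro mult_left_mono) auto
        also have "\<dots> = indicator {0..c} s * ?f s" using s True by (simp add: pow)
        also have "\<dots> \<le> \<dots> + indicator {c..} s * ?g s" by simp
        finally show ?thesis .
      next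
        case s: False
        have "s powr (- 1 - 2 * \<sigma>) * ?h s \<le>
            s powr (- 1 - 2 * \<sigma>) * (r powr (a - b) * \<bar>s * u\<bar> powr b)"
          by (intro mult_left_mono) auto
        also have "\<dots> = r powr (a - b) * (s powr (- 1 - 2 * \<sigma>) * \<bar>s * u\<bar> powr b)"
          by simp
        also have "\<dots> = indicator {c..} s * ?g s" using s unfolding pow by simp
        also have "\<dots> \<le> indicator {0..c} s * ?f s + \<dots>" by simp
        finally show ?thesis .
      qed
      then show ?thesis
        using True by (simp add: ennreal_mult[symmetric] ennreal_plus[symmetric] del: ennreal_plus)
    qed simp
  qed
  also have "\<dots> = (\<integral>\<^sup>+s. ennreal (indicator {0..c} s * ?f s) \<partial>lborel) + (\<integral>\<^sup>+s. ennreal (indicator {c..} s * ?g s) \<partial>lborel)"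
    by (rule nn_integral_add) auto
  also have "(\<integral>\<^sup>+s. ennreal (indicator {0..c} s * ?f s) \<partial>lborel) = ennreal ?I"
    using nn_integral_has_integral_lebesgue[OF _ f] by simp
  also have "(\<integral>\<^sup>+s. ennreal (indicator {c..} s * ?g s) \<partial>lborel) = ennreal ?J"
    using nn_integral_has_integral_lebesgue[OF _ g] by simp
  also have "?I = u powr (2 * \<sigma>) * r powr (a - 2 * \<sigma>) / (a - 2 * \<sigma>)"
    using assms by (simp add: c_def powr_divide powr_diff)
  also have "?J = u powr (2 * \<sigma>) * r powr (a - 2 * \<sigma>) / (2 * \<sigma> - b)"
    using assms by (simp add: c_def powr_divide powr_diff divide_simps) (simp add: algebra_simps)
  also have "ennreal (u powr (2 * \<sigma>) * r powr (a - 2 * \<sigma>) / (a - 2 * \<sigma>)) +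
      ennreal (u powr (2 * \<sigma>) * r powr (a - 2 * \<sigma>) / (2 * \<sigma> - b)) =
      ennreal (u powr (2 * \<sigma>) * (r powr (a - 2 * \<sigma>) * (1 / (a - 2 * \<sigma>) + 1 / (2 * \<sigma> - b))))"
    using assms by (simp add: ennreal_plus[symmetric] distrib_left del: ennreal_plus)
  finally show ?thesis .
qed

section \<open>Standard Gaussian vectors and their characteristic function\<close>

definition normal_vec :: "('n :: finite \<Rightarrow> real) measure" where
  "normal_vec = (\<Pi>\<^sub>M i\<in>UNIV. std_normal_distribution)"

lemma prob_space_std_normal: "prob_space std_normal_distribution"
  by (rule prob_space_normal_density) simp

interpretation normal_vec: product_prob_space "\<lambda>_ :: 'n :: finite. std_normal_distribution" UNIV
  by (intro product_prob_spaceI prob_space_std_normal)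

interpretation normal_vec_prob: prob_space normal_vec
  unfolding normal_vec_def by (rule prob_space_PiM) (rule prob_space_std_normal)

lemma sets_normal_vec [measurable_cong]: "sets normal_vec = sets (\<Pi>\<^sub>M i\<in>UNIV. borel)"
  unfolding normal_vec_def by (rule sets_PiM_cong) auto

lemma space_normal_vec [simp]: "space normal_vec = UNIV"
  by (simp add: normal_vec_def space_PiM)

lemma emeasure_normal_vec [simp]: "emeasure normal_vec UNIV = 1"
  using normal_vec_prob.emeasure_space_1 by simp

text \<open>The product measure lives on functions; \<open>vec_lambda\<close> carries it to
  \<open>real ^ 'n\<close>.\<close>

lemma borel_measurable_normal_vec [measurable]: "vec_lambda \<in> borel_measurable normal_vec"
  by (rule borel_measurable_vecI) (simp, measurable)

text \<open>Homogeneity in s will produce the moment of Z of order 2\<sigma> < 2, which the second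
  moment dominates.\<close>

lemma nn_integral_normal_vec_norm_finite:
  "(\<integral>\<^sup>+z. ennreal (1 + (norm (vec_lambda z :: real ^ 'n))\<^sup>2) \<partial>normal_vec) < \<infinity>"
proof -
  have comp: "(\<integral>\<^sup>+z. ennreal ((z i)\<^sup>2) \<partial>normal_vec) < \<infinity>" for i :: 'n
  proof -
    have "(\<integral>\<^sup>+z. ennreal ((z i)\<^sup>2) \<partial>normal_vec) =
        (\<integral>\<^sup>+x. ennreal (x\<^sup>2) \<partial>distr (Pi\<^sub>M UNIV (\<lambda>_. std_normal_distribution)) std_normal_distribution (\<lambda>z. z i))"
      unfolding normal_vec_def by (subst nn_integral_distr) (auto intro: measurable_component_singleton)
    also have "\<dots> = (\<integral>\<^sup>+x. ennreal (x\<^sup>2) \<partial>std_normal_distribution)"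
      by (simp add: normal_vec.PiM_component)
    also have "\<dots> < \<infinity>"
      using integrable_std_normal_distribution_moment[of 2] by (simp add: integrable_iff_bounded)
    finally show ?thesis .
  qed
  have "(\<integral>\<^sup>+z. ennreal (1 + (norm (vec_lambda z :: real ^ 'n))\<^sup>2) \<partial>normal_vec) =
      (\<integral>\<^sup>+z. 1 + (\<Sum>i\<in>UNIV. ennreal ((z i)\<^sup>2)) \<partial>(normal_vec :: ('n \<Rightarrow> real) measure))"
    by (intro nn_integral_cong) (simp add: norm_vec_def L2_set_def sum_nonneg ennreal_plus sum_ennreal)
  also have "\<dots> = 1 + (\<Sum>i\<in>UNIV. \<integral>\<^sup>+z. ennreal ((z i)\<^sup>2) \<partial>(normal_vec :: ('n \<Rightarrow> real) measure))"
    by (subst nn_integral_add) (simp_all add: nn_integral_sum del: sum_ennreal)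
  also have "\<dots> < \<infinity>"
    using comp by (simp add: less_top[symmetric])
  finally show ?thesis .
qed

lemma integral_normal_vec_char:
  fixes x :: "real ^ 'n"
  shows "(LINT z|normal_vec. iexp (x \<bullet> vec_lambda z)) = of_real (exp (- (norm x)\<^sup>2 / 2))"
proof -
  have int: "integrable std_normal_distribution (\<lambda>t. iexp (a * t))" for a :: real
    by (rule finite_measure.integrable_const_bound[OF prob_space.finite_measure[OF prob_space_std_normal], of _ 1]) auto
  have "(LINT z|normal_vec. iexp (x \<bullet> vec_lambda z)) = (LINT z|normal_vec. (\<Prod>i\<in>UNIV. iexp (x $ i * z i)))"
    by (intro Bochner_Integration.integral_cong refl)
       (simp add: inner_vec_def exp_sum[symmetric] sum_distrib_left)
  also have "\<dots> = (\<Prod>i\<in>UNIV. LINT t|std_normal_distribution. iexp (x $ i * t))"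
    unfolding normal_vec_def by (rule normal_vec.product_integral_prod) (simp, rule int)
  also have "\<dots> = (\<Prod>i\<in>UNIV. complex_of_real (exp (- (x $ i)\<^sup>2 / 2)))"
    using char_std_normal_distribution by (simp add: char_def fun_eq_iff)
  also have "\<dots> = of_real (exp (- (norm x)\<^sup>2 / 2))"
    by (simp add: of_real_prod[symmetric] exp_sum[symmetric] norm_vec_def L2_set_def sum_nonneg
        sum_negf sum_divide_distrib[symmetric] del: of_real_exp)
  finally show ?thesis .
qed

lemma nn_integral_normal_vec_cos:
  fixes x :: "real ^ 'n"
  shows "(\<integral>\<^sup>+z. ennreal (1 - cos (x \<bullet> vec_lambda z)) \<partial>normal_vec) = ennreal (1 - exp (- (norm x)\<^sup>2 / 2))"
proof -
  have int: "integrable normal_vec (\<lambda>z. iexp (x \<bullet> vec_lambda z))"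
    by (rule normal_vec_prob.integrable_const_bound[of _ 1]) auto
  have int': "integrable normal_vec (\<lambda>z. cos (x \<bullet> vec_lambda z))"
    by (rule normal_vec_prob.integrable_const_bound[of _ 1]) auto
  have "(LINT z|normal_vec. cos (x \<bullet> vec_lambda z)) = Re (LINT z|normal_vec. iexp (x \<bullet> vec_lambda z))"
    by (simp add: integral_Re[symmetric, OF int] Re_exp)
  also have "\<dots> = exp (- (norm x)\<^sup>2 / 2)"
    unfolding integral_normal_vec_char by simp
  finally have "(LINT z|normal_vec. 1 - cos (x \<bullet> vec_lambda z)) = 1 - exp (- (norm x)\<^sup>2 / 2)"
    using int' by (simp add: measure_def)
  then show ?thesis
    using int' by (subst nn_integral_eq_integral) auto
qed

text \<open>Its image under \<open>levy_jump\<close> is a constant multiple of |y| powr (-n -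
  2\<sigma>) dy, the Levy measure of an isotropic 2\<sigma>-stable process. Keeping the product
  instead of the image replaces polar coordinates by Tonelli.\<close>

definition levy_measure :: "real \<Rightarrow> (real \<times> ('n :: finite \<Rightarrow> real)) measure" where
  "levy_measure \<sigma> = levy_time \<sigma> \<Otimes>\<^sub>M normal_vec"

definition levy_jump :: "real \<times> ('n :: finite \<Rightarrow> real) \<Rightarrow> real ^ 'n" where
  "levy_jump p = fst p *\<^sub>R vec_lambda (snd p)"

lemma pair_sigma_finite_levy: "pair_sigma_finite (levy_time \<sigma>) normal_vec"
  by (simp add: pair_sigma_finite_def sigma_finite_levy_time normal_vec_prob.sigma_finite_measure_axioms)

lemma sigma_finite_levy_measure: "sigma_finite_measure (levy_measure \<sigma>)"
proof -
  interpret pair_sigma_finite "levy_time \<sigma>" normal_vec by (rule pair_sigma_finite_levy)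
  show ?thesis unfolding levy_measure_def by unfold_locales
qed

lemma borel_measurable_levy_jump [measurable]: "levy_jump \<in> borel_measurable (levy_measure \<sigma>)"
  unfolding levy_measure_def levy_jump_def[abs_def] by measurable

text \<open>Both orders are used: s innermost to exploit homogeneity in size estimates, z innermost
  to exploit the radial characteristic function in the symbol.\<close>

lemma nn_integral_levy_measure:
  assumes [measurable]: "f \<in> borel_measurable (borel :: (real ^ 'n) measure)"
  shows "(\<integral>\<^sup>+p. f (levy_jump p) \<partial>levy_measure \<sigma>) =
      (\<integral>\<^sup>+z. (\<integral>\<^sup>+s. f (s *\<^sub>R vec_lambda z) \<partial>levy_time \<sigma>) \<partial>normal_vec)"
    and "(\<integral>\<^sup>+p. f (levy_jump p) \<partial>levy_measure \<sigma>) =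
      (\<integral>\<^sup>+s. (\<integral>\<^sup>+z. f (s *\<^sub>R vec_lambda z) \<partial>normal_vec) \<partial>levy_time \<sigma>)"
proof -
  interpret pair_sigma_finite "levy_time \<sigma>" normal_vec by (rule pair_sigma_finite_levy)
  have m: "(\<lambda>p. f (levy_jump p)) \<in> borel_measurable (levy_time \<sigma> \<Otimes>\<^sub>M normal_vec)"
    using borel_measurable_levy_jump[of \<sigma>] unfolding levy_measure_def by measurable
  show "(\<integral>\<^sup>+p. f (levy_jump p) \<partial>levy_measure \<sigma>) =
      (\<integral>\<^sup>+z. (\<integral>\<^sup>+s. f (s *\<^sub>R vec_lambda z) \<partial>levy_time \<sigma>) \<partial>normal_vec)"
    unfolding levy_measure_def nn_integral_snd[OF m, symmetric] by (simp add: levy_jump_def)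
  show "(\<integral>\<^sup>+p. f (levy_jump p) \<partial>levy_measure \<sigma>) =
      (\<integral>\<^sup>+s. (\<integral>\<^sup>+z. f (s *\<^sub>R vec_lambda z) \<partial>normal_vec) \<partial>levy_time \<sigma>)"
    unfolding levy_measure_def normal_vec_prob.nn_integral_fst[OF m, symmetric] by (simp add: levy_jump_def)
qed

text \<open>For fixed z the integral over s scales like |z| powr (2\<sigma>) * r powr (a -
  2\<sigma>), and the first factor has finite Gaussian mean. The point is that C does not depend on
  r.\<close>

lemma levy_measure_min_bound:
  assumes "0 < \<sigma>" "\<sigma> < 1" "2 * \<sigma> < a" "b < 2 * \<sigma>"
  obtains C where "C > 0" "\<And>r. r > 0 \<Longrightarrow>
    (\<integral>\<^sup>+p. ennreal (min (norm (levy_jump p :: real ^ 'n) powr a) (r powr (a - b) * norm (levy_jump p) powr b)) \<partial>levy_measure \<sigma>)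
      \<le> ennreal (C * r powr (a - 2 * \<sigma>))"
proof -
  let ?h = "\<lambda>r y. min (norm (y :: real ^ 'n) powr a) (r powr (a - b) * norm y powr b)"
  let ?N = "normal_vec :: ('n \<Rightarrow> real) measure"
  obtain K where K: "K \<ge> 0" "(\<integral>\<^sup>+z. ennreal (1 + (norm (vec_lambda z :: real ^ 'n))\<^sup>2) \<partial>?N) = ennreal K"
    using nn_integral_normal_vec_norm_finite[where 'n = 'n] by (auto elim: ennreal_cases)
  define D where "D = 1 / (a - 2 * \<sigma>) + 1 / (2 * \<sigma> - b)"
  have "D > 0" using assms by (simp add: D_def add_pos_pos)
  have "(\<integral>\<^sup>+p. ennreal (?h r (levy_jump p)) \<partial>levy_measure \<sigma>)
      \<le> ennreal ((D * K + 1) * r powr (a - 2 * \<sigma>))" if "r > 0" for r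
  proof -
    have "(\<integral>\<^sup>+p. ennreal (?h r (levy_jump p)) \<partial>levy_measure \<sigma>) =
      (\<integral>\<^sup>+z. (\<integral>\<^sup>+s. ennreal (?h r (s *\<^sub>R vec_lambda z)) \<partial>levy_time \<sigma>) \<partial>?N)"
      by (rule nn_integral_levy_measure) measurable
    also have "\<dots> \<le> (\<integral>\<^sup>+z. ennreal (D * r powr (a - 2 * \<sigma>)) * ennreal (1 + (norm (vec_lambda z :: real ^ 'n))\<^sup>2) \<partial>?N)"
    proof (rule nn_integral_mono)
      fix z :: "'n \<Rightarrow> real"
      let ?u = "norm (vec_lambda z :: real ^ 'n)"
      show "(\<integral>\<^sup>+s. ennreal (?h r (s *\<^sub>R vec_lambda z)) \<partial>levy_time \<sigma>) \<le>
          ennreal (D * r powr (a - 2 * \<sigma>)) * ennreal (1 + ?u\<^sup>2)"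
      proof (cases "?u = 0")
        case False
        then have "?u > 0" by simp
        have "?u powr (2 * \<sigma>) \<le> 1 + ?u\<^sup>2"
          using assms by (intro powr_le_one_plus_square) auto
        then have "?u powr (2 * \<sigma>) * (r powr (a - 2 * \<sigma>) * D) \<le> (1 + ?u\<^sup>2) * (r powr (a - 2 * \<sigma>) * D)"
          using \<open>D > 0\<close> by (intro mult_right_mono) auto
        then have "ennreal (?u powr (2 * \<sigma>) * (r powr (a - 2 * \<sigma>) * D)) \<le>
            ennreal (D * r powr (a - 2 * \<sigma>)) * ennreal (1 + ?u\<^sup>2)"
          using \<open>D > 0\<close> by (subst ennreal_mult[symmetric]) (auto intro!: ennreal_leI simp: mult_ac)
        moreover have "(\<integral>\<^sup>+s. ennreal (?h r (s *\<^sub>R vec_lambda z)) \<partial>levy_time \<sigma>) \<le>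
            ennreal (?u powr (2 * \<sigma>) * (r powr (a - 2 * \<sigma>) * D))"
          using nn_integral_levy_time_min_le[OF \<open>?u > 0\<close> that assms(3,4)]
          by (simp add: D_def abs_mult)
        ultimately show ?thesis by (rule order_trans[rotated])
      qed simp
    qed
    also have "\<dots> = ennreal (D * r powr (a - 2 * \<sigma>)) * ennreal K"
      by (subst nn_integral_cmult) (measurable, simp only: K)
    also have "\<dots> = ennreal (D * K * r powr (a - 2 * \<sigma>))"
      using \<open>D > 0\<close> K(1) by (simp add: ennreal_mult[symmetric] mult_ac)
    \<comment> \<open>The added 1 makes the constant positive when only K \<ge> 0 is at
      hand.\<close>
    also have "\<dots> \<le> ennreal ((D * K + 1) * r powr (a - 2 * \<sigma>))"
      by (intro ennreal_leI) (simp add: distrib_right)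
    finally show ?thesis .
  qed
  moreover have "D * K + 1 > 0" using \<open>D > 0\<close> K(1) by (simp add: add_nonneg_pos)
  ultimately show thesis using that by blast
qed

text \<open>The integrand is at most min(s^2, 1), so \<open>nn_integral_levy_time_min_le\<close>
  with a = 2, b = 0 and u = r = 1 applies; on [1, 2] integrand and density are bounded below by
  positive constants.\<close>

lemma levy_symbol_1_finite_pos:
  assumes "0 < \<sigma>" "\<sigma> < 1"
  shows "(\<integral>\<^sup>+s. ennreal (1 - exp (- s\<^sup>2 / 2)) \<partial>levy_time \<sigma>) < \<infinity>"
    and "0 < (\<integral>\<^sup>+s. ennreal (1 - exp (- s\<^sup>2 / 2)) \<partial>levy_time \<sigma>)"
proof -
  have "(\<integral>\<^sup>+s. ennreal (1 - exp (- s\<^sup>2 / 2)) \<partial>levy_time \<sigma>) \<le>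
      (\<integral>\<^sup>+s. ennreal (min (\<bar>s * 1\<bar> powr 2) (1 powr (2 - 0) * \<bar>s * 1\<bar> powr 0)) \<partial>levy_time \<sigma>)"
  proof (intro nn_integral_mono ennreal_leI)
    fix s :: real
    have "1 + - s\<^sup>2 / 2 \<le> exp (- s\<^sup>2 / 2)" by (rule exp_ge_add_one_self)
    then have "1 - exp (- s\<^sup>2 / 2) \<le> s\<^sup>2" using zero_le_power2[of s] by linarith
    moreover have "1 - exp (- s\<^sup>2 / 2) \<le> 1" by simp
    ultimately show "1 - exp (- s\<^sup>2 / 2) \<le> min (\<bar>s * 1\<bar> powr 2) (1 powr (2 - 0) * \<bar>s * 1\<bar> powr 0)"
      by (cases "s = 0") (auto simp: powr_numeral)
  qed
  also have "\<dots> \<le> ennreal (1 powr (2 * \<sigma>) * (1 powr (2 - 2 * \<sigma>) * (1 / (2 - 2 * \<sigma>) + 1 / (2 * \<sigma> - 0))))"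
    using assms by (intro nn_integral_levy_time_min_le) auto
  also have "\<dots> < \<infinity>" by simp
  finally show "(\<integral>\<^sup>+s. ennreal (1 - exp (- s\<^sup>2 / 2)) \<partial>levy_time \<sigma>) < \<infinity>" .
  have "0 < ennreal (2 powr (- 1 - 2 * \<sigma>) * (1 - exp (- 1 / 2)))" by simp
  also have "\<dots> = (\<integral>\<^sup>+s. ennreal (2 powr (- 1 - 2 * \<sigma>) * (1 - exp (- 1 / 2))) * indicator {1..2::real} s \<partial>lborel)"
    by (subst nn_integral_cmult_indicator) auto
  also have "\<dots> \<le> (\<integral>\<^sup>+s. ennreal (indicator {0<..} s * s powr (- 1 - 2 * \<sigma>)) * ennreal (1 - exp (- s\<^sup>2 / 2)) \<partial>lborel)"
  proof (rule nn_integral_mono)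
    fix s :: real
    have "2 powr (- 1 - 2 * \<sigma>) * (1 - exp (- 1 / 2)) \<le> s powr (- 1 - 2 * \<sigma>) * (1 - exp (- s\<^sup>2 / 2))"
      if "1 \<le> s" "s \<le> 2"
    proof (intro mult_mono)
      show "2 powr (- 1 - 2 * \<sigma>) \<le> s powr (- 1 - 2 * \<sigma>)"
        using that assms by (intro powr_mono2') auto
      have "1 \<le> s\<^sup>2" using that by simp
      then show "1 - exp (- 1 / 2) \<le> 1 - exp (- s\<^sup>2 / 2)" by simp
    qed auto
    then show "ennreal (2 powr (- 1 - 2 * \<sigma>) * (1 - exp (- 1 / 2))) * indicator {1..2} s
      \<le> ennreal (indicator {0<..} s * s powr (- 1 - 2 * \<sigma>)) * ennreal (1 - exp (- s\<^sup>2 / 2))"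
      by (cases "s \<in> {1..2}") (auto simp: ennreal_mult[symmetric] intro!: ennreal_leI)
  qed
  also have "\<dots> = (\<integral>\<^sup>+s. ennreal (1 - exp (- s\<^sup>2 / 2)) \<partial>levy_time \<sigma>)"
    by (rule nn_integral_levy_time[symmetric]) measurable
  finally show "0 < (\<integral>\<^sup>+s. ennreal (1 - exp (- s\<^sup>2 / 2)) \<partial>levy_time \<sigma>)" .
qed

text \<open>Substitute s / u for s: the density contributes u powr (1 + 2\<sigma>) and the line
  element 1 / u.\<close>

lemma levy_symbol_scale:
  assumes "0 < u"
  shows "(\<integral>\<^sup>+s. ennreal (1 - exp (- (s * u)\<^sup>2 / 2)) \<partial>levy_time \<sigma>) =
    ennreal (u powr (2 * \<sigma>)) * (\<integral>\<^sup>+s. ennreal (1 - exp (- s\<^sup>2 / 2)) \<partial>levy_time \<sigma>)"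
proof -
  let ?w = "\<lambda>s. ennreal (indicator {0<..} s * s powr (- 1 - 2 * \<sigma>))"
  have "(\<integral>\<^sup>+s. ennreal (1 - exp (- (s * u)\<^sup>2 / 2)) \<partial>levy_time \<sigma>) =
      (\<integral>\<^sup>+s. ?w s * ennreal (1 - exp (- (s * u)\<^sup>2 / 2)) \<partial>lborel)"
    by (rule nn_integral_levy_time) measurable
  also have "\<dots> = ennreal \<bar>1 / u\<bar> * (\<integral>\<^sup>+s. ?w (0 + (1 / u) * s) * ennreal (1 - exp (- ((0 + (1 / u) * s) * u)\<^sup>2 / 2)) \<partial>lborel)"
    using assms by (intro nn_integral_real_affine) auto
  also have "\<dots> = (\<integral>\<^sup>+s. ennreal \<bar>1 / u\<bar> * (?w (0 + (1 / u) * s) * ennreal (1 - exp (- ((0 + (1 / u) * s) * u)\<^sup>2 / 2))) \<partial>lborel)"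
    by (rule nn_integral_cmult[symmetric]) measurable
  also have "\<dots> = (\<integral>\<^sup>+s. ennreal (u powr (2 * \<sigma>)) * (?w s * ennreal (1 - exp (- s\<^sup>2 / 2))) \<partial>lborel)"
  proof (rule nn_integral_cong)
    fix s :: real
    have "\<bar>1 / u\<bar> * (indicator {0<..} (s / u) * (s / u) powr (- 1 - 2 * \<sigma>)) =
        u powr (2 * \<sigma>) * (indicator {0<..} s * s powr (- 1 - 2 * \<sigma>))"
    proof (cases "s > 0")
      case True
      have "(s / u) powr (- 1 - 2 * \<sigma>) = s powr (- 1 - 2 * \<sigma>) * (u * u powr (2 * \<sigma>))"
        using assms True by (simp add: powr_divide powr_diff powr_minus divide_simps)
      then show ?thesis using assms True by simp
    qed (use assms in \<open>simp add: zero_less_divide_iff\<close>)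
    then show "ennreal \<bar>1 / u\<bar> * (?w (0 + (1 / u) * s) * ennreal (1 - exp (- ((0 + (1 / u) * s) * u)\<^sup>2 / 2))) =
        ennreal (u powr (2 * \<sigma>)) * (?w s * ennreal (1 - exp (- s\<^sup>2 / 2)))"
      using assms by (simp add: mult.assoc[symmetric] ennreal_mult[symmetric])
  qed
  also have "\<dots> = ennreal (u powr (2 * \<sigma>)) * (\<integral>\<^sup>+s. ?w s * ennreal (1 - exp (- s\<^sup>2 / 2)) \<partial>lborel)"
    by (rule nn_integral_cmult) measurable
  also have "(\<integral>\<^sup>+s. ?w s * ennreal (1 - exp (- s\<^sup>2 / 2)) \<partial>lborel) =
      (\<integral>\<^sup>+s. ennreal (1 - exp (- s\<^sup>2 / 2)) \<partial>levy_time \<sigma>)"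
    by (rule nn_integral_levy_time[symmetric]) measurable
  finally show ?thesis .
qed

text \<open>The average of 1 - cos at a frequency of norm 1, hence the normalising constant of the
  symbol.\<close>

definition levy_const :: "real \<Rightarrow> real" where
  "levy_const \<sigma> = enn2real (\<integral>\<^sup>+s. ennreal (1 - exp (- s\<^sup>2 / 2)) \<partial>levy_time \<sigma>)"

lemma levy_const_pos: "0 < \<sigma> \<Longrightarrow> \<sigma> < 1 \<Longrightarrow> 0 < levy_const \<sigma>"
  unfolding levy_const_def using levy_symbol_1_finite_pos[of \<sigma>] by (simp add: enn2real_positive_iff)

text \<open>Integrating out the Gaussian leaves a function of s * |x| alone, and the scaling of
  \<open>levy_time\<close> turns the remaining integral into a power of |x|.\<close>

lemma nn_integral_levy_cos:
  fixes x :: "real ^ 'n"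
  assumes "0 < \<sigma>" "\<sigma> < 1"
  shows "(\<integral>\<^sup>+p. ennreal (1 - cos (x \<bullet> levy_jump p)) \<partial>levy_measure \<sigma>) =
    ennreal (levy_const \<sigma> * norm x powr (2 * \<sigma>))"
proof -
  have "(\<integral>\<^sup>+p. ennreal (1 - cos (x \<bullet> levy_jump p)) \<partial>levy_measure \<sigma>) =
      (\<integral>\<^sup>+s. (\<integral>\<^sup>+z. ennreal (1 - cos ((s *\<^sub>R x) \<bullet> vec_lambda z)) \<partial>normal_vec) \<partial>levy_time \<sigma>)"
    by (subst nn_integral_levy_measure(2)) auto
  also have "\<dots> = (\<integral>\<^sup>+s. ennreal (1 - exp (- (s * norm x)\<^sup>2 / 2)) \<partial>levy_time \<sigma>)"
    unfolding nn_integral_normal_vec_cos by (simp add: power_mult_distrib)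
  also have "\<dots> = ennreal (norm x powr (2 * \<sigma>)) * (\<integral>\<^sup>+s. ennreal (1 - exp (- s\<^sup>2 / 2)) \<partial>levy_time \<sigma>)"
    by (cases "x = 0") (simp, rule levy_symbol_scale, simp)
  also have "(\<integral>\<^sup>+s. ennreal (1 - exp (- s\<^sup>2 / 2)) \<partial>levy_time \<sigma>) = ennreal (levy_const \<sigma>)"
    unfolding levy_const_def using levy_symbol_1_finite_pos(1)[OF assms] by simp
  finally show ?thesis
    using levy_const_pos[OF assms] by (simp add: ennreal_mult[symmetric] mult.commute)
qed

section \<open>The operator defined by second differences\<close>

text \<open>With this sign the multiplier on a character is 2 (1 - cos), which is
  nonnegative.\<close>

definition second_diff :: "('a::real_vector \<Rightarrow> 'b::real_vector) \<Rightarrow> 'a \<Rightarrow> 'a \<Rightarrow> 'b" where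
  "second_diff f y x = 2 *\<^sub>R f x - f (x + y) - f (x - y)"

definition levy_op :: "real \<Rightarrow> (real ^ 'n \<Rightarrow> 'a::{banach, second_countable_topology}) \<Rightarrow> real ^ 'n \<Rightarrow> 'a" where
  "levy_op \<sigma> f x = (1 / (2 * levy_const \<sigma>)) *\<^sub>R (LINT p|levy_measure \<sigma>. second_diff f (levy_jump p) x)"

text \<open>The cap at 1 is essential: with a > 2\<sigma> the power alone is integrable near 0 but
  not at infinity.\<close>

definition second_diff_bound :: "real \<Rightarrow> real \<Rightarrow> ('a::real_normed_vector \<Rightarrow> 'b::real_normed_vector) \<Rightarrow> bool" where
  "second_diff_bound a A f \<longleftrightarrow> (\<forall>x y. norm (second_diff f y x) \<le> A * min (norm y powr a) 1)"

lemma second_diff_0 [simp]: "second_diff f 0 x = 0"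
  by (simp add: second_diff_def scaleR_2)

lemma norm_second_diff_le:
  assumes "\<And>x. norm (f x) \<le> B"
  shows "norm (second_diff f y x) \<le> 4 * B"
proof -
  have "norm (second_diff f y x) \<le> norm (2 *\<^sub>R f x) + norm (f (x + y)) + norm (f (x - y))"
    unfolding second_diff_def by (intro norm_triangle_le_diff add_mono order_refl norm_triangle_ineq4)
  also have "\<dots> \<le> 2 * B + B + B"
    using assms by (intro add_mono) auto
  finally show ?thesis by simp
qed

text \<open>For |y| \<le> 1 the larger exponent b gives the smaller power; for larger |y| the
  trivial bound 4 B takes over.\<close>

lemma second_diff_boundI:
  assumes le: "\<And>x y. norm (second_diff f y x) \<le> A * norm y powr b"
    and bdd: "\<And>x. norm (f x) \<le> B" and "0 \<le> a" "a \<le> b" "0 \<le> A"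
  shows "second_diff_bound a (A + 4 * B) f"
  unfolding second_diff_bound_def
proof (intro allI)
  fix x y :: 'a
  have "0 \<le> B" using bdd norm_ge_zero order_trans by blast
  show "norm (second_diff f y x) \<le> (A + 4 * B) * min (norm y powr a) 1"
  proof (cases "y = 0")
    case False
    show ?thesis
    proof (cases "norm y \<le> 1")
      case True
      then have "norm y powr b \<le> norm y powr a" using assms False by (intro powr_mono') auto
      then have "A * norm y powr b \<le> A * norm y powr a" using assms by (intro mult_left_mono)
      moreover have "norm y powr a \<le> 1" using True assms by (intro powr_le1) auto
      moreover have "0 \<le> 4 * B * norm y powr a" using \<open>0 \<le> B\<close> by simp
      ultimately show ?thesis using le[of y x] by (simp add: distrib_right)
    next
      case False
      then have "1 \<le> norm y powr a" using assms by (intro ge_one_powr_ge_zero) auto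
      then show ?thesis using norm_second_diff_le[of f B y x, OF bdd] \<open>0 \<le> A\<close> by simp
    qed
  qed simp
qed

text \<open>The case b = 0, r = 1 of \<open>levy_measure_min_bound\<close>. The minima agree also at
  jump 0, where \<open>0 powr 0 = 0\<close>.\<close>

lemma integrable_levy_min:
  assumes "0 < \<sigma>" "\<sigma> < 1" "2 * \<sigma> < a"
  shows "integrable (levy_measure \<sigma>) (\<lambda>p. min (norm (levy_jump p :: real ^ 'n) powr a) 1)"
proof (rule integrableI_bounded)
  obtain C where C: "\<And>r. r > 0 \<Longrightarrow>
    (\<integral>\<^sup>+p. ennreal (min (norm (levy_jump p :: real ^ 'n) powr a) (r powr (a - 0) * norm (levy_jump p) powr 0)) \<partial>levy_measure \<sigma>)
      \<le> ennreal (C * r powr (a - 2 * \<sigma>))"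
    using levy_measure_min_bound[of \<sigma> a 0] assms by auto
  have "(\<integral>\<^sup>+p. ennreal (norm (min (norm (levy_jump p :: real ^ 'n) powr a) 1)) \<partial>levy_measure \<sigma>) =
      (\<integral>\<^sup>+p. ennreal (min (norm (levy_jump p :: real ^ 'n) powr a) (1 powr (a - 0) * norm (levy_jump p) powr 0)) \<partial>levy_measure \<sigma>)"
    by (intro nn_integral_cong) auto
  also have "\<dots> < \<infinity>"
    using C[of 1] by (simp add: order.strict_trans1)
  finally show "(\<integral>\<^sup>+p. ennreal (norm (min (norm (levy_jump p :: real ^ 'n) powr a) 1)) \<partial>levy_measure \<sigma>) < \<infinity>" .
qed measurable

text \<open>The type argument fixes the dimension, which the real value cannot reveal.\<close>

definition levy_mass :: "'n :: finite itself \<Rightarrow> real \<Rightarrow> real \<Rightarrow> real" where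
  "levy_mass _ \<sigma> a = (LINT p|levy_measure \<sigma>. min (norm (levy_jump p :: real ^ 'n) powr a) 1) / (2 * levy_const \<sigma>)"

lemma levy_mass_nonneg: "0 < \<sigma> \<Longrightarrow> \<sigma> < 1 \<Longrightarrow> 0 \<le> levy_mass TYPE('n :: finite) \<sigma> a"
  unfolding levy_mass_def using levy_const_pos[of \<sigma>]
  by (intro divide_nonneg_nonneg Bochner_Integration.integral_nonneg) auto

lemma torus_periodic_levy_op:
  fixes f :: "real ^ 'n \<Rightarrow> 'a :: {banach, second_countable_topology}"
  assumes "torus_periodic f"
  shows "torus_periodic (levy_op \<sigma> f)"
proof -
  have "second_diff f y (x + (2 * pi) *\<^sub>R lattice_vec k) = second_diff f y x" for x y k
    using torus_periodicD[OF assms, of x k] torus_periodicD[OF torus_periodic_shift[OF assms, of y], of x k]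
      torus_periodicD[OF torus_periodic_shift[OF assms, of "- y"], of x k]
    by (simp add: second_diff_def)
  then show ?thesis by (simp add: torus_periodic_def levy_op_def)
qed

lemma has_partial_shift:
  assumes "has_partial i f f'"
  shows "has_partial i (\<lambda>x. f (x + y)) (\<lambda>x. f' (x + y))"
proof -
  have "(x + t *\<^sub>R axis i 1) + y = (x + y) + t *\<^sub>R axis i 1" for x t
    by (simp add: algebra_simps)
  then show ?thesis using assms by (simp only: has_partial_def) blast
qed

lemma has_partial_second_diff:
  assumes "has_partial i f f'"
  shows "has_partial i (second_diff f y) (second_diff f' y)"
proof -
  have "has_partial i (\<lambda>x. 2 *\<^sub>R f x) (\<lambda>x. 2 *\<^sub>R f' x)"
    using assms by (auto simp: has_partial_def intro!: derivative_eq_intros)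
  then have "has_partial i (\<lambda>x. 2 *\<^sub>R f x - f (x + y) - f (x + - y)) (\<lambda>x. 2 *\<^sub>R f' x - f' (x + y) - f' (x + - y))"
    by (intro has_partial_diff has_partial_shift assms)
  then show ?thesis by (simp add: second_diff_def[abs_def])
qed

lemma levy_op_of_real:
  fixes f :: "real ^ 'n \<Rightarrow> real"
  shows "levy_op \<sigma> (\<lambda>x. complex_of_real (f x)) x = complex_of_real (levy_op \<sigma> f x)"
proof -
  have "second_diff (\<lambda>x. complex_of_real (f x)) y x = complex_of_real (second_diff f y x)" for x y
    by (simp add: second_diff_def scaleR_conv_of_real)
  then show ?thesis by (simp add: levy_op_def scaleR_conv_of_real)
qed

text \<open>Moving a translation by b from f to g turns it into - b, so the terms with y and - y
  merely trade places.\<close>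

lemma integral_torus_second_diff_symmetric:
  fixes f g :: "real ^ 'n \<Rightarrow> complex"
  assumes "continuous_on UNIV f" "torus_periodic f" "continuous_on UNIV g" "torus_periodic g"
  shows "(LINT x|torus_measure. second_diff f y x * g x) = (LINT x|torus_measure. f x * second_diff g y x)"
proof -
  have int: "integrable torus_measure (\<lambda>x. f (x + b) * g (x + c))" for b c
    by (intro integrable_torus_measure_continuous continuous_intros torus_periodic_mult
          continuous_on_shift torus_periodic_shift assms)
  have shift: "(LINT x|torus_measure. f (x + b) * g x) = (LINT x|torus_measure. f x * g (x + - b))" for b
  proof -
    have "(LINT x|torus_measure. f (x + b) * g ((x + b) + - b)) = (LINT x|torus_measure. f x * g (x + - b))"
      by (rule integral_torus_shift[of "\<lambda>x. f x * g (x + - b)"])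
         (intro borel_measurable_continuous_onI continuous_intros continuous_on_shift torus_periodic_mult
            torus_periodic_shift assms)+
    then show ?thesis by simp
  qed
  have "(LINT x|torus_measure. second_diff f y x * g x) =
      (LINT x|torus_measure. 2 * (f (x + 0) * g (x + 0)) - f (x + y) * g (x + 0) - f (x + - y) * g (x + 0))"
    by (intro Bochner_Integration.integral_cong) (auto simp: second_diff_def scaleR_conv_of_real algebra_simps)
  also have "\<dots> = 2 * (LINT x|torus_measure. f x * g x) - (LINT x|torus_measure. f (x + y) * g x) -
      (LINT x|torus_measure. f (x + - y) * g x)"
    using int[of 0 0] int[of y 0] int[of "- y" 0] by simp
  also have "\<dots> = 2 * (LINT x|torus_measure. f x * g x) - (LINT x|torus_measure. f x * g (x + y)) -
      (LINT x|torus_measure. f x * g (x + - y))"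
    by (simp only: shift minus_minus)  (simp only: diff_diff_eq add.commute)
  also have "\<dots> = (LINT x|torus_measure. 2 * (f (x + 0) * g (x + 0)) - f (x + 0) * g (x + y) - f (x + 0) * g (x + - y))"
    using int[of 0 0] int[of 0 y] int[of 0 "- y"] by simp
  also have "\<dots> = (LINT x|torus_measure. f x * second_diff g y x)"
    by (intro Bochner_Integration.integral_cong) (auto simp: second_diff_def scaleR_conv_of_real algebra_simps)
  finally show ?thesis .
qed

context
  fixes \<sigma> a :: real
  assumes \<sigma>: "0 < \<sigma>" "\<sigma> < 1" and a: "2 * \<sigma> < a"
begin

lemma borel_measurable_second_diff:
  fixes f :: "real ^ 'n \<Rightarrow> 'a :: {banach, second_countable_topology}"
  assumes "continuous_on UNIV f"
  shows "(\<lambda>p. second_diff f (levy_jump p) x) \<in> borel_measurable (levy_measure \<sigma>)"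
proof -
  have [measurable]: "f \<in> borel_measurable borel"
    by (rule borel_measurable_continuous_onI[OF assms])
  show ?thesis unfolding second_diff_def by measurable
qed

lemma integrable_second_diff:
  fixes f :: "real ^ 'n \<Rightarrow> 'a :: {banach, second_countable_topology}"
  assumes "continuous_on UNIV f" "second_diff_bound a A f"
  shows "integrable (levy_measure \<sigma>) (\<lambda>p. second_diff f (levy_jump p) x)"
proof (rule Bochner_Integration.integrable_bound)
  show "integrable (levy_measure \<sigma>) (\<lambda>p. A * min (norm (levy_jump p :: real ^ 'n) powr a) 1)"
    using integrable_levy_min[OF \<sigma> a, where 'n = 'n] by simp
  show "AE p in levy_measure \<sigma>. norm (second_diff f (levy_jump p) x) \<le>
      norm (A * min (norm (levy_jump p :: real ^ 'n) powr a) 1)"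
    using assms(2) by (intro AE_I2) (auto simp: second_diff_bound_def intro: order_trans[OF _ abs_ge_self])
qed (rule borel_measurable_second_diff[OF assms(1)])

lemma norm_levy_op_le:
  fixes f :: "real ^ 'n \<Rightarrow> 'a :: {banach, second_countable_topology}"
  assumes "continuous_on UNIV f" "second_diff_bound a A f"
  shows "norm (levy_op \<sigma> f x) \<le> A * levy_mass TYPE('n) \<sigma> a"
proof -
  have "norm (LINT p|levy_measure \<sigma>. second_diff f (levy_jump p) x) \<le>
      (LINT p|levy_measure \<sigma>. norm (second_diff f (levy_jump p) x))"
    by (rule integral_norm_bound)
  also have "\<dots> \<le> (LINT p|levy_measure \<sigma>. A * min (norm (levy_jump p :: real ^ 'n) powr a) 1)"
    using integrable_second_diff[OF assms] integrable_levy_min[OF \<sigma> a, where 'n = 'n] assms(2)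
    by (intro integral_mono) (auto simp: second_diff_bound_def)
  also have "\<dots> = A * levy_mass TYPE('n) \<sigma> a * (2 * levy_const \<sigma>)"
    using levy_const_pos[OF \<sigma>] by (simp add: levy_mass_def)
  finally show ?thesis
    using levy_const_pos[OF \<sigma>] by (simp add: levy_op_def divide_simps)
qed

lemma continuous_on_levy_op:
  fixes f :: "real ^ 'n \<Rightarrow> 'a :: {banach, second_countable_topology}"
  assumes cont: "continuous_on UNIV f" and bnd: "second_diff_bound a A f"
  shows "continuous_on UNIV (levy_op \<sigma> f)"
proof -
  have "(\<lambda>n. levy_op \<sigma> f (X n)) \<longlonglongrightarrow> levy_op \<sigma> f x" if X: "X \<longlonglongrightarrow> x" for X x
    unfolding levy_op_def
  proof (intro tendsto_scaleR tendsto_const integral_dominated_convergence[where w = "\<lambda>p. A * min (norm (levy_jump p :: real ^ 'n) powr a) 1"])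
    show "AE p in levy_measure \<sigma>. (\<lambda>n. second_diff f (levy_jump p) (X n)) \<longlonglongrightarrow> second_diff f (levy_jump p) x"
    proof (rule AE_I2)
      fix p :: "real \<times> ('n \<Rightarrow> real)"
      have "(\<lambda>n. f (Y n)) \<longlonglongrightarrow> f y" if "Y \<longlonglongrightarrow> y" for Y y
        using cont that by (auto intro: continuous_on_tendsto_compose)
      then show "(\<lambda>n. second_diff f (levy_jump p) (X n)) \<longlonglongrightarrow> second_diff f (levy_jump p) x"
        unfolding second_diff_def using X by (auto intro!: tendsto_diff tendsto_scaleR tendsto_add tendsto_const)
    qed
    show "AE p in levy_measure \<sigma>. norm (second_diff f (levy_jump p) (X n)) \<le> A * min (norm (levy_jump p :: real ^ 'n) powr a) 1" for n
      using bnd by (intro AE_I2) (simp add: second_diff_bound_def)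
  qed (use borel_measurable_second_diff[OF cont] integrable_levy_min[OF \<sigma> a] in auto)
  then show ?thesis
    by (auto simp: continuous_on_sequentially o_def)
qed

text \<open>By the mean value inequality the difference quotients of second differences of f obey
  the bound assumed for f', uniformly in the step, and that bound is integrable.\<close>

lemma has_partial_levy_op:
  fixes f :: "real ^ 'n \<Rightarrow> 'a :: {banach, second_countable_topology}"
  assumes D: "has_partial i f f'" and cont: "continuous_on UNIV f" "continuous_on UNIV f'"
    and bnd: "second_diff_bound a A f" "second_diff_bound a A' f'"
  shows "has_partial i (levy_op \<sigma> f) (levy_op \<sigma> f')"
unfolding has_partial_iff_diff_quotient
proof
  fix x :: "real ^ 'n"
  have "(\<lambda>n. (levy_op \<sigma> f (x + X n *\<^sub>R axis i 1) - levy_op \<sigma> f x) /\<^sub>R X n) \<longlonglongrightarrow> levy_op \<sigma> f' x"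
    if X: "X \<longlonglongrightarrow> 0" "\<And>n. X n \<noteq> 0" for X
  proof -
    let ?q = "\<lambda>n p. (second_diff f (levy_jump p) (x + X n *\<^sub>R axis i 1) - second_diff f (levy_jump p) x) /\<^sub>R X n"
    have X': "filterlim X (at 0) sequentially"
      using X by (simp add: filterlim_at)
    have "(\<lambda>n. LINT p|levy_measure \<sigma>. ?q n p) \<longlonglongrightarrow> (LINT p|levy_measure \<sigma>. second_diff f' (levy_jump p) x)"
    proof (rule integral_dominated_convergence[where w = "\<lambda>p. A' * min (norm (levy_jump p :: real ^ 'n) powr a) 1"])
      show "AE p in levy_measure \<sigma>. (\<lambda>n. ?q n p) \<longlonglongrightarrow> second_diff f' (levy_jump p) x"
        by (intro AE_I2 filterlim_compose[OF has_partial_diff_quotient[OF has_partial_second_diff[OF D]] X'])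
      show "AE p in levy_measure \<sigma>. norm (?q n p) \<le> A' * min (norm (levy_jump p :: real ^ 'n) powr a) 1" for n
      proof (rule AE_I2)
        fix p :: "real \<times> ('n \<Rightarrow> real)"
        have "norm (second_diff f (levy_jump p) (x + X n *\<^sub>R axis i 1) - second_diff f (levy_jump p) x)
            \<le> (A' * min (norm (levy_jump p :: real ^ 'n) powr a) 1) * \<bar>X n\<bar>"
          using bnd(2) by (intro has_partial_norm_le[OF has_partial_second_diff[OF D]]) (simp add: second_diff_bound_def)
        then show "norm (?q n p) \<le> A' * min (norm (levy_jump p :: real ^ 'n) powr a) 1"
          using X(2)[of n] by (simp add: divide_inverse_commute[symmetric] pos_divide_le_eq)
      qed
      show "(\<lambda>p. ?q n p) \<in> borel_measurable (levy_measure \<sigma>)" for n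
        by (intro borel_measurable_scaleR borel_measurable_const borel_measurable_diff borel_measurable_second_diff cont)
    qed (use borel_measurable_second_diff[OF cont(2)] integrable_levy_min[OF \<sigma> a] in auto)
    then have "(\<lambda>n. (1 / (2 * levy_const \<sigma>)) *\<^sub>R (LINT p|levy_measure \<sigma>. ?q n p)) \<longlonglongrightarrow> levy_op \<sigma> f' x"
      unfolding levy_op_def by (intro tendsto_intros)
    moreover have "(1 / (2 * levy_const \<sigma>)) *\<^sub>R (LINT p|levy_measure \<sigma>. ?q n p) =
        (levy_op \<sigma> f (x + X n *\<^sub>R axis i 1) - levy_op \<sigma> f x) /\<^sub>R X n" for n
      using integrable_second_diff[OF cont(1) bnd(1)]
      by (simp add: levy_op_def scaleR_diff_right scaleR_left_commute)
    ultimately show ?thesis by simp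
  qed
  then show "((\<lambda>t. (levy_op \<sigma> f (x + t *\<^sub>R axis i 1) - levy_op \<sigma> f x) /\<^sub>R t) \<longlongrightarrow> levy_op \<sigma> f' x) (at 0)"
    by (auto simp: tendsto_at_iff_sequentially o_def)
qed

lemma integrable_second_diff_pair:
  fixes f g :: "real ^ 'n \<Rightarrow> complex"
  assumes f: "continuous_on UNIV f" "second_diff_bound a A f"
    and g: "continuous_on UNIV g" "\<And>x. norm (g x) \<le> B"
  shows "integrable (torus_measure \<Otimes>\<^sub>M levy_measure \<sigma>) (\<lambda>(x, p). second_diff f (levy_jump p) x * g x)"
proof (rule integrableI_bounded)
  have [measurable]: "f \<in> borel_measurable borel" "g \<in> borel_measurable borel"
    by (intro borel_measurable_continuous_onI f g)+
  have [measurable]: "(\<lambda>x. x) \<in> borel_measurable torus_measure"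
    by (rule borel_measurable_torus_measure) simp
  have [measurable]: "(\<lambda>q. fst q :: real ^ 'n) \<in> borel_measurable (torus_measure \<Otimes>\<^sub>M levy_measure \<sigma>)"
    by (rule measurable_compose[OF measurable_fst]) simp
  show m: "(\<lambda>(x, p). second_diff f (levy_jump p) x * g x) \<in> borel_measurable (torus_measure \<Otimes>\<^sub>M levy_measure \<sigma>)"
    unfolding second_diff_def split_beta by measurable
  interpret sigma_finite_measure "levy_measure \<sigma> :: (real \<times> ('n \<Rightarrow> real)) measure"
    by (rule sigma_finite_levy_measure)
  have "0 \<le> B" using g(2) norm_ge_zero order_trans by blast
  let ?m = "\<lambda>p. min (norm (levy_jump p :: real ^ 'n) powr a) 1"
  have "(\<integral>\<^sup>+q. ennreal (norm ((\<lambda>(x, p). second_diff f (levy_jump p) x * g x) q)) \<partial>(torus_measure \<Otimes>\<^sub>M levy_measure \<sigma>)) =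
      (\<integral>\<^sup>+x. (\<integral>\<^sup>+p. ennreal (norm (second_diff f (levy_jump p) x * g x)) \<partial>levy_measure \<sigma>) \<partial>torus_measure)"
    using m by (subst nn_integral_fst[symmetric]) auto
  also have "\<dots> \<le> (\<integral>\<^sup>+x. (\<integral>\<^sup>+p. ennreal (A * ?m p * B) \<partial>levy_measure \<sigma>) \<partial>(torus_measure :: (real ^ 'n) measure))"
    using f(2) g(2) \<open>0 \<le> B\<close>
    by (intro nn_integral_mono ennreal_leI) (auto simp: norm_mult second_diff_bound_def intro!: mult_mono' )
  also have "\<dots> = (\<integral>\<^sup>+p. ennreal (A * ?m p * B) \<partial>levy_measure \<sigma>) * ennreal ((2 * pi) ^ CARD('n))"
    by (simp add: emeasure_torus_measure_space)
  also have "\<dots> < \<infinity>"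
  proof -
    have "integrable (levy_measure \<sigma>) (\<lambda>p. A * ?m p * B)"
      using integrable_levy_min[OF \<sigma> a, where 'n = 'n] by simp
    then have "(\<integral>\<^sup>+p. ennreal (norm (A * ?m p * B)) \<partial>levy_measure \<sigma>) < \<infinity>"
      unfolding integrable_iff_bounded by blast
    moreover have "(\<integral>\<^sup>+p. ennreal (A * ?m p * B) \<partial>levy_measure \<sigma>) \<le> (\<integral>\<^sup>+p. ennreal (norm (A * ?m p * B)) \<partial>levy_measure \<sigma>)"
      by (intro nn_integral_mono ennreal_leI) simp
    ultimately show ?thesis
      by (auto simp: ennreal_mult_less_top)
  qed
  finally show "(\<integral>\<^sup>+q. ennreal (norm ((\<lambda>(x, p). second_diff f (levy_jump p) x * g x) q)) \<partial>(torus_measure \<Otimes>\<^sub>M levy_measure \<sigma>)) < \<infinity>" .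
qed

lemma integral_torus_levy_op_fubini:
  fixes f g :: "real ^ 'n \<Rightarrow> complex"
  assumes f: "continuous_on UNIV f" "second_diff_bound a A f"
    and g: "continuous_on UNIV g" "torus_periodic g"
  shows "(LINT x|torus_measure. levy_op \<sigma> f x * g x) =
    (1 / (2 * levy_const \<sigma>)) *\<^sub>R (LINT p|levy_measure \<sigma>. LINT x|torus_measure. second_diff f (levy_jump p) x * g x)"
proof -
  obtain B where B: "\<And>x. norm (g x) \<le> B"
    using torus_periodic_bounded[OF g] by blast
  interpret pair_sigma_finite "torus_measure :: (real ^ 'n) measure" "levy_measure \<sigma> :: (real \<times> ('n \<Rightarrow> real)) measure"
    by (simp add: pair_sigma_finite_def sigma_finite_levy_measure torus_measure.sigma_finite_measure)
  have "(LINT p|levy_measure \<sigma>. LINT x|torus_measure. second_diff f (levy_jump p) x * g x) =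
      (LINT x|torus_measure. LINT p|levy_measure \<sigma>. second_diff f (levy_jump p) x * g x)"
    by (rule Fubini_integral) (rule integrable_second_diff_pair[OF f g(1) B])
  also have "\<dots> = (LINT x|torus_measure. (LINT p|levy_measure \<sigma>. second_diff f (levy_jump p) x) * g x)"
    using integrable_second_diff[OF f] by simp
  finally show ?thesis by (simp add: levy_op_def)
qed

lemma integral_torus_levy_op_symmetric:
  fixes f g :: "real ^ 'n \<Rightarrow> complex"
  assumes f: "continuous_on UNIV f" "torus_periodic f" "second_diff_bound a A f"
    and g: "continuous_on UNIV g" "torus_periodic g" "second_diff_bound a A' g"
  shows "(LINT x|torus_measure. levy_op \<sigma> f x * g x) = (LINT x|torus_measure. f x * levy_op \<sigma> g x)"
  using integral_torus_levy_op_fubini[OF f(1,3) g(1,2)] integral_torus_levy_op_fubini[OF g(1,3) f(1,2)]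
    integral_torus_second_diff_symmetric[OF f(1,2) g(1,2)]
  by (simp add: mult.commute)

text \<open>A character is an eigenfunction of every second difference, with eigenvalue 2 (1 - cos
  (k . y)), so its average is the symbol. The second claim makes characters admissible in
  \<open>integral_torus_levy_op_symmetric\<close>.\<close>

lemma levy_op_torus_char:
  fixes k :: "int ^ 'n"
  shows "levy_op \<sigma> (torus_char k) x = of_real (norm (lattice_vec k :: real ^ 'n) powr (2 * \<sigma>)) * torus_char k x"
    and "\<exists>A. second_diff_bound 2 A (torus_char k)"
proof -
  let ?k = "lattice_vec k :: real ^ 'n"
  have eq: "second_diff (torus_char k) y x = of_real (2 * (1 - cos (?k \<bullet> y))) * torus_char k x" for x y
  proof -
    have "second_diff (torus_char k) y x = (2 - torus_char k y - torus_char k (- y)) * torus_char k x"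
      by (simp add: second_diff_def torus_char_shift torus_char_shift_diff scaleR_conv_of_real algebra_simps)
    also have "2 - torus_char k y - torus_char k (- y) = of_real (2 * (1 - cos (?k \<bullet> y)))"
      by (simp add: torus_char_eq_cis complex_eq_iff)
    finally show ?thesis .
  qed
  have cos_nonneg: "0 \<le> 1 - cos t" for t :: real by simp
  have "(LINT p|levy_measure \<sigma>. 1 - cos (?k \<bullet> levy_jump p)) = levy_const \<sigma> * norm ?k powr (2 * \<sigma>)"
    using levy_const_pos[OF \<sigma>]
    by (subst integral_eq_nn_integral) (auto simp: nn_integral_levy_cos[OF \<sigma>])
  then have "(LINT p|levy_measure \<sigma>. complex_of_real (2 * (1 - cos (?k \<bullet> levy_jump p)))) =
      of_real (2 * (levy_const \<sigma> * norm ?k powr (2 * \<sigma>)))"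
    by (simp only: integral_complex_of_real integral_mult_right_zero)
  then show "levy_op \<sigma> (torus_char k) x = of_real (norm ?k powr (2 * \<sigma>)) * torus_char k x"
    using levy_const_pos[OF \<sigma>] unfolding levy_op_def eq
    by (simp add: scaleR_conv_of_real del: of_real_mult of_real_diff) (simp add: field_simps)
  have "norm (second_diff (torus_char k) y x) \<le> (norm ?k)\<^sup>2 * norm y powr 2" for x y
  proof -
    have "1 - cos (?k \<bullet> y) = 2 * (sin ((?k \<bullet> y) / 2))\<^sup>2"
      using cos_double_sin[of "(?k \<bullet> y) / 2"] by simp
    also have "\<dots> \<le> 2 * ((?k \<bullet> y) / 2)\<^sup>2"
      using abs_sin_x_le_abs_x[of "(?k \<bullet> y) / 2"] by (simp only: mult_left_mono abs_le_square_iff[symmetric])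
    finally have "2 * (1 - cos (?k \<bullet> y)) \<le> (?k \<bullet> y)\<^sup>2" by (simp add: power_divide)
    also have "\<dots> \<le> (norm ?k * norm y)\<^sup>2"
      using Cauchy_Schwarz_ineq2[of ?k y] by (simp add: abs_le_square_iff[symmetric])
    finally have "2 * (1 - cos (?k \<bullet> y)) \<le> (norm ?k)\<^sup>2 * norm y powr 2"
      by (simp add: power_mult_distrib powr_numeral)
    then show ?thesis
      unfolding eq norm_mult norm_of_real by simp
  qed
  then have "second_diff_bound 2 ((norm ?k)\<^sup>2 + 4 * 1) (torus_char k)"
    by (rule second_diff_boundI) auto
  then show "\<exists>A. second_diff_bound 2 A (torus_char k)" by blast
qed

end

section \<open>Taylor estimates and the fractional Laplacian\<close>

text \<open>Moving from \<open>x\<close> to \<open>x + h\<close> along the coordinate axes makes total differentiability unnecessary.\<close>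

lemma has_partial_cube_le:
  fixes f :: "real ^ 'n \<Rightarrow> 'a :: real_normed_vector"
  assumes D: "\<And>i. has_partial i f (f' i)"
    and B: "\<And>i z. (\<And>j. \<bar>z $ j - x $ j\<bar> \<le> \<bar>h $ j\<bar>) \<Longrightarrow> norm (f' i z) \<le> B"
  shows "norm (f (x + h) - f x) \<le> B * (\<Sum>i\<in>UNIV. \<bar>h $ i\<bar>)"
proof -
  \<comment> \<open>The displacement with only the coordinates in S switched on; all intermediate
    points stay in the cube where B applies.\<close>
  let ?h = "\<lambda>S. \<chi> i. if i \<in> S then h $ i else 0"
  have "norm (f (x + ?h S) - f x) \<le> B * (\<Sum>i\<in>S. \<bar>h $ i\<bar>)" if "finite S" for S
    using that
  proof (induction S rule: finite_induct)
    case empty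
    have "?h {} = 0" by (simp add: vec_eq_iff)
    then show ?case by simp
  next
    case (insert i S)
    have eq: "x + ?h (insert i S) = (x + ?h S) + (h $ i) *\<^sub>R axis i 1"
      using insert.hyps by (simp add: vec_eq_iff axis_def)
    have "norm (f ((x + ?h S) + (h $ i) *\<^sub>R axis i 1) - f (x + ?h S)) \<le> B * \<bar>h $ i\<bar>"
    proof (rule has_partial_norm_le[OF D])
      fix s assume "s \<in> closed_segment 0 (h $ i)"
      then have "\<bar>s\<bar> \<le> \<bar>h $ i\<bar>"
        by (auto simp: closed_segment_eq_real_ivl split: if_splits)
      then show "norm (f' i ((x + ?h S) + s *\<^sub>R axis i 1)) \<le> B"
        using insert.hyps by (intro B) (auto simp: axis_def)
    qed
    moreover have "norm (f (x + ?h (insert i S)) - f x) \<le>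
        norm (f (x + ?h (insert i S)) - f (x + ?h S)) + norm (f (x + ?h S) - f x)"
      using norm_triangle_ineq[of "f (x + ?h (insert i S)) - f (x + ?h S)" "f (x + ?h S) - f x"] by simp
    ultimately show ?case
      using insert unfolding eq by (simp add: distrib_left)
  qed
  from this[of UNIV] show ?thesis by simp
qed

lemma norm1_le: "(\<Sum>i\<in>UNIV. \<bar>h $ i\<bar>) \<le> real CARD('n) * norm (h :: real ^ 'n)"
  using sum_mono[of UNIV "\<lambda>i. \<bar>h $ i\<bar>" "\<lambda>_. norm h"] component_le_norm_cart[of h] by simp

lemma has_partial_lipschitz:
  fixes f :: "real ^ 'n \<Rightarrow> 'a :: real_normed_vector"
  assumes D: "\<And>i. has_partial i f (f' i)" and B: "\<And>i z. norm (f' i z) \<le> B"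
  shows "norm (f x - f y) \<le> real CARD('n) * B * norm (x - y)"
proof -
  have "0 \<le> B" using B norm_ge_zero order_trans by blast
  have "norm (f (y + (x - y)) - f y) \<le> B * (\<Sum>i\<in>UNIV. \<bar>(x - y) $ i\<bar>)"
    by (rule has_partial_cube_le[OF D B])
  also have "\<dots> \<le> B * (real CARD('n) * norm (x - y))"
    using \<open>0 \<le> B\<close> by (intro mult_left_mono norm1_le)
  finally show ?thesis by (simp add: mult_ac)
qed

text \<open>Subtract the linear Taylor polynomial at \<open>x\<close>; it cancels in the second difference.\<close>

lemma second_diff_taylor:
  fixes f :: "real ^ 'n \<Rightarrow> 'a :: real_normed_vector"
  assumes D: "\<And>i. has_partial i f (f' i)" and "0 < a" "0 \<le> H"
    and H: "\<And>i x y. norm (f' i x - f' i y) \<le> H * norm (x - y) powr a"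
  shows "norm (second_diff f y x) \<le> 2 * real CARD('n) * H * norm y powr (1 + a)"
proof -
  have *: "norm (f (x + h) - f x - (\<Sum>i\<in>UNIV. h $ i *\<^sub>R f' i x)) \<le> real CARD('n) * H * norm h powr (1 + a)" for h
  proof -
    let ?g = "\<lambda>z. f z - (\<Sum>i\<in>UNIV. z $ i *\<^sub>R f' i x)"
    \<comment> \<open>The partials of ?g are differences of f' i from its value at x, and on the
      cube |z - x| \<le> |h|, so the Hoelder bound makes them small.\<close>
    have "norm (?g (x + h) - ?g x) \<le> (H * norm h powr a) * (\<Sum>i\<in>UNIV. \<bar>h $ i\<bar>)"
    proof (rule has_partial_cube_le)
      show "has_partial i ?g (\<lambda>z. f' i z - f' i x)" for i
      proof (rule has_partial_diff[OF D])
        have "((\<lambda>t. \<Sum>j\<in>UNIV. (z $ j + t * (if j = i then 1 else 0)) *\<^sub>R f' j x) has_vector_derivative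
            (\<Sum>j\<in>UNIV. (if j = i then 1 else 0) *\<^sub>R f' j x)) (at 0)" for z :: "real ^ 'n"
          by (auto intro!: derivative_eq_intros)
        moreover have "(\<Sum>j\<in>UNIV. (if j = i then 1 else 0) *\<^sub>R f' j x) = f' i x"
          by (subst sum.cong[OF refl, of _ _ "\<lambda>j. if j = i then f' j x else 0"]) auto
        ultimately show "has_partial i (\<lambda>z. \<Sum>i\<in>UNIV. z $ i *\<^sub>R f' i x) (\<lambda>z. f' i x)"
          by (simp add: has_partial_def axis_def eq_commute)
      qed
      fix i and z :: "real ^ 'n" assume z: "\<And>j. \<bar>z $ j - x $ j\<bar> \<le> \<bar>h $ j\<bar>"
      have "norm (z - x) \<le> norm h"
        using z by (intro norm_le_componentwise_cart) simp
      then have "norm (z - x) powr a \<le> norm h powr a"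
        using \<open>0 < a\<close> by (intro powr_mono2) auto
      then show "norm (f' i z - f' i x) \<le> H * norm h powr a"
        using H[of i z x] mult_left_mono[OF _ \<open>0 \<le> H\<close>] order_trans by blast
    qed
    also have "\<dots> \<le> (H * norm h powr a) * (real CARD('n) * norm h)"
      using \<open>0 \<le> H\<close> by (intro mult_left_mono norm1_le) auto
    also have "\<dots> = real CARD('n) * H * norm h powr (1 + a)"
      by (cases "h = 0") (auto simp: powr_add)
    finally show ?thesis
      by (simp add: scaleR_add_left sum.distrib algebra_simps)
  qed
  have "second_diff f y x = - ((f (x + y) - f x - (\<Sum>i\<in>UNIV. y $ i *\<^sub>R f' i x)) +
      (f (x + - y) - f x - (\<Sum>i\<in>UNIV. (- y) $ i *\<^sub>R f' i x)))"
    by (simp add: second_diff_def scaleR_2 sum_negf)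
  then have "norm (second_diff f y x) \<le> norm (f (x + y) - f x - (\<Sum>i\<in>UNIV. y $ i *\<^sub>R f' i x)) +
      norm (f (x + - y) - f x - (\<Sum>i\<in>UNIV. (- y) $ i *\<^sub>R f' i x))"
    by (simp only: norm_minus_cancel norm_triangle_ineq)
  also have "\<dots> \<le> real CARD('n) * H * norm y powr (1 + a) + real CARD('n) * H * norm y powr (1 + a)"
    using *[of y] *[of "- y"] by (intro add_mono) auto
  finally show ?thesis by (simp add: mult_ac)
qed

text \<open>Bounded second derivatives make the first ones Lipschitz; Taylor then gives exponent 2,
  which \<open>second_diff_boundI\<close> lowers to a.\<close>

lemma torus_smooth_second_diff_bound:
  fixes \<phi> :: "real ^ 'n \<Rightarrow> complex"
  assumes \<phi>: "\<phi> \<in> torus_smooth" and "0 \<le> a" "a \<le> 2"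
  shows "\<exists>A. second_diff_bound a A \<phi>"
proof -
  obtain B where B: "\<And>x. norm (\<phi> x) \<le> B"
    using torus_periodic_bounded torus_smoothD[OF \<phi>] by blast
  have "\<forall>i j. \<exists>B. \<forall>x. norm (partial_along j (partial_along i \<phi>) x) \<le> B"
    using torus_periodic_bounded torus_smoothD torus_smooth_partial(2) \<phi> by metis
  then obtain C where C: "\<And>i j x. norm (partial_along j (partial_along i \<phi>) x) \<le> C i j"
    by metis
  define M where "M = (\<Sum>i\<in>UNIV. \<Sum>j\<in>UNIV. C i j)"
  have C0: "0 \<le> C i j" for i j using C norm_ge_zero order_trans by blast
  have M: "norm (partial_along j (partial_along i \<phi>) x) \<le> M" for i j x
  proof -
    have "C i j \<le> (\<Sum>j\<in>UNIV. C i j)" by (intro member_le_sum C0) auto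
    also have "\<dots> \<le> M" unfolding M_def by (intro member_le_sum sum_nonneg C0) auto
    finally show ?thesis using C order_trans by blast
  qed
  have "0 \<le> M" unfolding M_def by (intro sum_nonneg C0)
  have "norm (second_diff \<phi> y x) \<le> 2 * real CARD('n) * (real CARD('n) * M) * norm y powr (1 + 1)" for x y
  proof (rule second_diff_taylor)
    show "has_partial i \<phi> (partial_along i \<phi>)" for i by (rule torus_smooth_partial(1)[OF \<phi>])
    show "norm (partial_along i \<phi> x - partial_along i \<phi> y) \<le> real CARD('n) * M * norm (x - y) powr 1" for i x y
      using has_partial_lipschitz[OF torus_smooth_partial(1)[OF torus_smooth_partial(2)[OF \<phi>]] M] by simp
  qed (use \<open>0 \<le> M\<close> in auto)
  from second_diff_boundI[OF this B, of a] assms \<open>0 \<le> M\<close> show ?thesis by auto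
qed

text \<open>Testing against a character and moving the operator onto it multiplies each coefficient
  by the symbol. The new coefficients are still summable, so inversion recovers the values
  pointwise.\<close>

theorem frac_laplacian_smooth_eq_levy_op:
  fixes \<phi> :: "real ^ 'n \<Rightarrow> complex"
  assumes \<sigma>: "0 < \<sigma>" "\<sigma> < 1" and \<phi>: "\<phi> \<in> torus_smooth"
  shows "frac_laplacian_smooth \<sigma> \<phi> x = levy_op \<sigma> \<phi> x"
proof -
  have a: "2 * \<sigma> < 2" using \<sigma> by simp
  obtain A where A: "second_diff_bound 2 A \<phi>"
    using torus_smooth_second_diff_bound[OF \<phi>, of 2] by auto
  note \<phi>' = torus_smoothD[OF \<phi>]
  have cont: "continuous_on UNIV (levy_op \<sigma> \<phi>)" by (rule continuous_on_levy_op[OF \<sigma> a \<phi>'(2) A])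
  have per: "torus_periodic (levy_op \<sigma> \<phi>)" by (rule torus_periodic_levy_op[OF \<phi>'(1)])
  have coeff: "fourier_coeff k (levy_op \<sigma> \<phi>) = of_real (norm (lattice_vec k :: real ^ 'n) powr (2 * \<sigma>)) * fourier_coeff k \<phi>" for k
  proof -
    obtain A' where A': "second_diff_bound 2 A' (torus_char (- k))"
      using levy_op_torus_char(2)[OF \<sigma> a] by blast
    have "(LINT x|torus_measure. levy_op \<sigma> \<phi> x * torus_char (- k) x) =
        (LINT x|torus_measure. \<phi> x * levy_op \<sigma> (torus_char (- k)) x)"
      by (rule integral_torus_levy_op_symmetric[OF \<sigma> a \<phi>'(2,1) A _ _ A'])
         (auto intro: continuous_intros torus_periodic_char)
    also have "\<dots> = (LINT x|torus_measure. of_real (norm (lattice_vec k :: real ^ 'n) powr (2 * \<sigma>)) * (\<phi> x * torus_char (- k) x))"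
      by (simp add: levy_op_torus_char(1)[OF \<sigma> a] lattice_vec_minus mult_ac)
    also have "\<dots> = of_real (norm (lattice_vec k :: real ^ 'n) powr (2 * \<sigma>)) * (LINT x|torus_measure. \<phi> x * torus_char (- k) x)"
      by simp
    finally show ?thesis by (simp add: fourier_coeff_eq)
  qed
  have "(\<lambda>k. norm (fourier_coeff k (levy_op \<sigma> \<phi>))) summable_on UNIV"
    using torus_smooth_fourier_summable[OF \<phi>, of "2 * \<sigma>"] \<sigma> by (simp add: coeff norm_mult)
  from fourier_inversion[OF cont per this, of x]
  show ?thesis by (simp add: frac_laplacian_smooth_def coeff torus_char_def)
qed

text \<open>Symmetry is applied with one exponent a for both v and the test function;
  \<open>a \<le> 2\<close> provides it for smooth functions.\<close>

theorem frac_laplacian_distr_given_by_levy_op: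
  fixes v :: "real ^ 'n \<Rightarrow> real"
  assumes \<sigma>: "0 < \<sigma>" "\<sigma> < 1" and a: "2 * \<sigma> < a" "a \<le> 2"
    and v: "continuous_on UNIV v" "torus_periodic v" "second_diff_bound a A v"
  shows "distr_given_by (frac_laplacian_distr \<sigma> v) (levy_op \<sigma> v)"
  unfolding distr_given_by_def
proof
  fix \<phi> :: "real ^ 'n \<Rightarrow> complex" assume \<phi>: "\<phi> \<in> torus_smooth"
  obtain A' where A': "second_diff_bound a A' \<phi>"
    using torus_smooth_second_diff_bound[OF \<phi>, of a] \<sigma> a by auto
  let ?v = "\<lambda>x. complex_of_real (v x)"
  have "second_diff ?v y x = complex_of_real (second_diff v y x)" for x y
    by (simp add: second_diff_def scaleR_conv_of_real)
  then have "second_diff_bound a A ?v"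
    using v(3) by (simp add: second_diff_bound_def)
  moreover have "continuous_on UNIV ?v" by (intro continuous_intros v)
  moreover have "torus_periodic ?v" using v(2) by (simp add: torus_periodic_def)
  ultimately have "(LINT x|torus_measure. levy_op \<sigma> ?v x * \<phi> x) = (LINT x|torus_measure. ?v x * levy_op \<sigma> \<phi> x)"
    using torus_smoothD[OF \<phi>] A' by (intro integral_torus_levy_op_symmetric[OF \<sigma> a(1)])
  then show "frac_laplacian_distr \<sigma> v \<phi> = (LINT z:torus_box|lborel. complex_of_real (levy_op \<sigma> v z) * \<phi> z)"
    by (simp add: frac_laplacian_distr_def set_integral_torus_box frac_laplacian_smooth_eq_levy_op[OF \<sigma> \<phi>]
        levy_op_of_real)
qed

section \<open>Iterated partial derivatives and Hoelder norms\<close>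

lemma cont_diff_mono: "cont_diff k f \<Longrightarrow> m \<le> k \<Longrightarrow> cont_diff m f"
proof (induction m arbitrary: k f)
  case 0
  then show ?case using cont_diff_continuous[of k f] by simp
next
  case (Suc m)
  then obtain k' where k: "k = Suc k'" "m \<le> k'" by (cases k) auto
  note f = Suc.prems(1)[unfolded k(1)]
  show ?case
  proof (rule cont_diff_SucI)
    show "continuous_on UNIV f" by (rule cont_diff_continuous[OF f])
    show "has_partial i f (partial_along i f)" for i by (rule cont_diff_Suc_partial(1)[OF f])
    show "cont_diff m (partial_along i f)" for i
      by (rule Suc.IH[OF cont_diff_Suc_partial(2)[OF f] k(2)])
  qed
qed

lemma cont_diff_iter_partial:
  "cont_diff (length is + m) f \<Longrightarrow> cont_diff m (iter_partial is f)"
proof (induction "is" arbitrary: m)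
  case (Cons i "is")
  have "cont_diff (Suc m) (iter_partial is f)"
    using Cons.prems by (intro Cons.IH) (simp del: cont_diff.simps)
  then show ?case by simp
qed simp

lemma has_partial_iter_partial:
  assumes "cont_diff k f" "length is < k"
  shows "has_partial i (iter_partial is f) (iter_partial (i # is) f)"
proof -
  have "cont_diff (length is + Suc 0) f"
    using assms by (intro cont_diff_mono[OF assms(1)]) simp
  then have "cont_diff (Suc 0) (iter_partial is f)" by (rule cont_diff_iter_partial)
  then show ?thesis unfolding iter_partial.simps by (rule cont_diff_Suc_partial(1))
qed

lemma continuous_on_iter_partial:
  assumes "cont_diff k f" "length is \<le> k"
  shows "continuous_on UNIV (iter_partial is f)"
proof -
  have "cont_diff (length is + 0) f" using cont_diff_mono[OF assms] by simp
  then have "cont_diff 0 (iter_partial is f)" by (rule cont_diff_iter_partial)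
  then show ?thesis by simp
qed

lemma torus_periodic_iter_partial:
  assumes "cont_diff k f" "length is \<le> k" "torus_periodic f"
  shows "torus_periodic (iter_partial is f)"
  using assms(2)
proof (induction "is")
  case (Cons i "is")
  then have "length is < k" "torus_periodic (iter_partial is f)" by simp_all
  then show ?case
    using has_partial_periodic[OF has_partial_iter_partial[OF assms(1), of "is" i]] by blast
qed (use assms(3) in simp)

text \<open>The factor is symmetric in i and j, which is what lets mixed derivatives
  commute.\<close>

lemma fourier_coeff_partial_partial:
  fixes f :: "real ^ 'n \<Rightarrow> real"
  assumes "cont_diff (Suc (Suc 0)) f" "torus_periodic f"
  shows "fourier_coeff k (\<lambda>x. complex_of_real (partial_along i (partial_along j f) x)) =
    \<i> * of_int (k $ i) * (\<i> * of_int (k $ j) * fourier_coeff k (\<lambda>x. complex_of_real (f x)))"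
proof -
  note P = cont_diff_Suc_partial[OF assms(1), of j]
  note Q = cont_diff_Suc_partial[OF P(2), of i]
  note cont = cont_diff_continuous[OF assms(1)] cont_diff_continuous[OF P(2)] cont_diff_continuous[OF Q(2)]
  have per: "torus_periodic (\<lambda>x. complex_of_real (g x))" if "torus_periodic g" for g :: "real ^ 'n \<Rightarrow> real"
    using that by (simp add: torus_periodic_def)
  have "fourier_coeff k (\<lambda>x. complex_of_real (partial_along i (partial_along j f) x)) =
      \<i> * of_int (k $ i) * fourier_coeff k (\<lambda>x. complex_of_real (partial_along j f x))"
    by (intro fourier_coeff_partial has_partial_of_real Q per continuous_intros cont has_partial_periodic[OF P(1) assms(2)])
  also have "fourier_coeff k (\<lambda>x. complex_of_real (partial_along j f x)) =
      \<i> * of_int (k $ j) * fourier_coeff k (\<lambda>x. complex_of_real (f x))"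
    by (intro fourier_coeff_partial has_partial_of_real P per continuous_intros cont assms(2))
  finally show ?thesis .
qed

text \<open>Both sides have the same Fourier coefficients.\<close>

lemma partial_along_commute:
  fixes f :: "real ^ 'n \<Rightarrow> real"
  assumes "cont_diff (Suc (Suc 0)) f" "torus_periodic f"
  shows "partial_along i (partial_along j f) = partial_along j (partial_along i f)"
proof
  fix x
  let ?g = "\<lambda>i j x. complex_of_real (partial_along i (partial_along j f) x)"
  have cont: "continuous_on UNIV (?g i j)" for i j
    using continuous_on_iter_partial[OF assms(1), of "[i, j]"] by (intro continuous_intros) simp
  have per: "torus_periodic (?g i j)" for i j
    using torus_periodic_iter_partial[OF assms(1) _ assms(2), of "[i, j]"] by (simp add: torus_periodic_def)
  have "?g i j x - ?g j i x = 0"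
  proof (rule fourier_coeff_zero_imp_zero[of "\<lambda>x. ?g i j x - ?g j i x"])
    show "continuous_on UNIV (\<lambda>x. ?g i j x - ?g j i x)" by (rule continuous_on_diff[OF cont cont])
    show "torus_periodic (\<lambda>x. ?g i j x - ?g j i x)" using per[of i j] per[of j i] by (simp add: torus_periodic_def)
    show "fourier_coeff k (\<lambda>x. ?g i j x - ?g j i x) = 0" for k
      by (simp only: fourier_coeff_diff[OF cont per cont per] fourier_coeff_partial_partial[OF assms]) simp
  qed
  then show "partial_along i (partial_along j f) x = partial_along j (partial_along i f) x"
    by simp
qed

section \<open>Derivatives along lists and along multi-indices\<close>

lemma iter_partial_move:
  fixes f :: "real ^ 'n \<Rightarrow> real"
  assumes "torus_periodic f"
  shows "cont_diff (Suc (length xs + length ys)) f \<Longrightarrow>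
    iter_partial (xs @ i # ys) f = iter_partial (i # xs @ ys) f"
proof (induction xs)
  case (Cons j xs)
  have "iter_partial (xs @ i # ys) f = iter_partial (i # xs @ ys) f"
    by (rule Cons.IH) (rule cont_diff_mono[OF Cons.prems], simp)
  moreover have "cont_diff (Suc (Suc 0)) (iter_partial (xs @ ys) f)"
    by (rule cont_diff_iter_partial) (rule cont_diff_mono[OF Cons.prems], simp)
  moreover have "torus_periodic (iter_partial (xs @ ys) f)"
    by (rule torus_periodic_iter_partial[OF Cons.prems _ assms]) simp
  ultimately show ?case
    by (simp add: partial_along_commute[of _ i j] del: cont_diff.simps)
qed simp

text \<open>Induction on xs: locate its first entry in ys and bring it to the front by commutation.
  This makes the arbitrary order chosen in \<open>multi_deriv\<close> harmless.\<close>

lemma iter_partial_mset_eq: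
  fixes f :: "real ^ 'n \<Rightarrow> real"
  assumes "torus_periodic f"
  shows "mset xs = mset ys \<Longrightarrow> cont_diff (length xs) f \<Longrightarrow> iter_partial xs f = iter_partial ys f"
proof (induction xs arbitrary: ys)
  case (Cons i xs)
  have "set ys = set (i # xs)" using mset_eq_setD[OF Cons.prems(1)] by simp
  then have "i \<in> set ys" by simp
  then obtain as bs where ys: "ys = as @ i # bs" by (meson split_list)
  with Cons.prems(1) have eq: "mset xs = mset (as @ bs)" by simp
  have len: "length xs = length as + length bs" by (simp add: mset_eq_length[OF eq])
  have "iter_partial xs f = iter_partial (as @ bs) f"
    by (rule Cons.IH[OF eq]) (rule cont_diff_mono[OF Cons.prems(2)], simp)
  moreover have "iter_partial ys f = iter_partial (i # as @ bs) f"
    unfolding ys using Cons.prems(2) len by (intro iter_partial_move assms) simp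
  ultimately show ?case by simp
qed simp

text \<open>A list with the prescribed counts exists, by listing a suitable multiset, so the choice
  in \<open>multi_deriv\<close> is meaningful. One list serves all functions.\<close>

lemma multi_deriv_list:
  fixes \<gamma> :: "nat ^ 'n"
  obtains "is" where "length is = multi_order \<gamma>" "\<And>i. count_list is i = \<gamma> $ i"
    "\<And>f :: real ^ 'n \<Rightarrow> real. multi_deriv \<gamma> f = iter_partial is f"
proof -
  obtain js where "mset js = (\<Sum>i\<in>UNIV. replicate_mset (\<gamma> $ i) i)"
    using ex_mset by blast
  then have "count_list js i = \<gamma> $ i" for i
    by (simp add: count_mset[symmetric] count_sum)
  then have "\<forall>i. count_list js i = \<gamma> $ i" by blast
  then have sel: "\<forall>i. count_list (SOME is. \<forall>i. count_list is i = \<gamma> $ i) i = \<gamma> $ i"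
    by (rule someI)
  show thesis
  proof (rule that)
    show "length (SOME is. \<forall>i. count_list is i = \<gamma> $ i) = multi_order \<gamma>"
      using sum_count_set[of "SOME is. \<forall>i. count_list is i = \<gamma> $ i" UNIV] sel
      by (simp add: multi_order_def)
    show "count_list (SOME is. \<forall>i. count_list is i = \<gamma> $ i) i = \<gamma> $ i" for i
      using sel by blast
    show "multi_deriv \<gamma> f = iter_partial (SOME is. \<forall>i. count_list is i = \<gamma> $ i) f" for f :: "real ^ 'n \<Rightarrow> real"
      by (simp only: multi_deriv_def)
  qed
qed

lemma iter_partial_multi_deriv:
  fixes f :: "real ^ 'n \<Rightarrow> real"
  assumes "torus_periodic f" "cont_diff (length is) f"
  obtains \<gamma> where "multi_order \<gamma> = length is" "multi_deriv \<gamma> f = iter_partial is f"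
proof -
  define \<gamma> :: "nat ^ 'n" where "\<gamma> = (\<chi> i. count_list is i)"
  obtain js where js: "length js = multi_order \<gamma>" "\<And>i. count_list js i = \<gamma> $ i"
    "\<And>f :: real ^ 'n \<Rightarrow> real. multi_deriv \<gamma> f = iter_partial js f"
    by (rule multi_deriv_list[of \<gamma>]) (rule that)
  have "mset is = mset js"
    by (rule multiset_eqI) (simp add: count_mset js \<gamma>_def)
  then have "iter_partial is f = iter_partial js f" "length is = length js"
    by (rule iter_partial_mset_eq[OF assms(1) _ assms(2)], rule mset_eq_length)
  then show thesis
    by (intro that[of \<gamma>]) (simp_all add: js)
qed

lemma finite_multi_order: "finite {\<gamma> :: nat ^ 'n. multi_order \<gamma> \<le> k}"
proof (rule finite_subset)
  show "{\<gamma> :: nat ^ 'n. multi_order \<gamma> \<le> k} \<subseteq> vec_lambda ` (Pi\<^sub>E UNIV (\<lambda>_. {..k}))"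
  proof
    fix \<gamma> :: "nat ^ 'n" assume "\<gamma> \<in> {\<gamma>. multi_order \<gamma> \<le> k}"
    then have "\<gamma> $ i \<le> k" for i
      using member_le_sum[of i UNIV "vec_nth \<gamma>"] by (simp add: multi_order_def)
    then have "vec_nth \<gamma> \<in> Pi\<^sub>E UNIV (\<lambda>_. {..k})" by auto
    then show "\<gamma> \<in> vec_lambda ` (Pi\<^sub>E UNIV (\<lambda>_. {..k}))"
      by (intro image_eqI[of _ _ "vec_nth \<gamma>"]) simp_all
  qed
  show "finite (vec_lambda ` (Pi\<^sub>E (UNIV :: 'n set) (\<lambda>_. {..k})))"
    by (intro finite_imageI finite_PiE) auto
qed

section \<open>Hoelder norms and bounds on all iterated derivatives\<close>

lemma torus_holderD:
  fixes v :: "real ^ 'n \<Rightarrow> real"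
  assumes "v \<in> torus_holder k \<alpha>"
  shows "torus_periodic v" "cont_diff k v"
  using assms by (simp_all add: torus_holder_def)

lemma torus_sup_norm_nonneg:
  fixes f :: "real ^ 'n \<Rightarrow> real"
  assumes "continuous_on UNIV f" "torus_periodic f"
  shows "0 \<le> torus_sup_norm f"
  by (rule order_trans[OF abs_ge_zero abs_le_torus_sup_norm[OF assms]])

text \<open>The norm is a finite sum of nonnegative terms, so it dominates each of them.
  Nonnegativity of the seminorms relies on membership in the space, since a supremum of an unbounded
  set carries no sign.\<close>

lemma torus_holder_norm_bounds:
  fixes v :: "real ^ 'n \<Rightarrow> real"
  assumes v: "v \<in> torus_holder k \<alpha>" and "0 < \<alpha>"
  defines "N \<equiv> torus_holder_norm k \<alpha> v"
  shows "0 \<le> N"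
    and "length is \<le> k \<Longrightarrow> \<bar>iter_partial is v x\<bar> \<le> N"
    and "length is = k \<Longrightarrow> \<bar>iter_partial is v x - iter_partial is v y\<bar> \<le> N * norm (x - y) powr \<alpha>"
proof -
  note v' = torus_holderD[OF v]
  let ?L = "{\<gamma> :: nat ^ 'n. multi_order \<gamma> \<le> k}" and ?E = "{\<gamma> :: nat ^ 'n. multi_order \<gamma> = k}"
  let ?S = "\<Sum>\<gamma>\<in>?L. torus_sup_norm (multi_deriv \<gamma> v)" and ?H = "\<Sum>\<gamma>\<in>?E. holder_seminorm \<alpha> (multi_deriv \<gamma> v)"
  have N: "N = ?S + ?H" by (simp add: N_def torus_holder_norm_def)
  have finE: "finite ?E"
    by (rule finite_subset[OF _ finite_multi_order[of k]]) auto
  have deriv: "continuous_on UNIV (multi_deriv \<gamma> v)" "torus_periodic (multi_deriv \<gamma> v)" if "multi_order \<gamma> \<le> k" for \<gamma>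
  proof -
    obtain js where "length js = multi_order \<gamma>" "multi_deriv \<gamma> v = iter_partial js v"
      by (rule multi_deriv_list[of \<gamma>]) blast
    then show "continuous_on UNIV (multi_deriv \<gamma> v)" "torus_periodic (multi_deriv \<gamma> v)"
      using that continuous_on_iter_partial[OF v'(2)] torus_periodic_iter_partial[OF v'(2) _ v'(1)] by auto
  qed
  have sup_nonneg: "0 \<le> torus_sup_norm (multi_deriv \<gamma> v)" if "\<gamma> \<in> ?L" for \<gamma>
    using deriv that by (intro torus_sup_norm_nonneg) auto
  have bdd: "bdd_above (holder_quotients \<alpha> (multi_deriv \<gamma> v))" if "\<gamma> \<in> ?E" for \<gamma>
    using v that by (simp add: torus_holder_def)
  have semi_nonneg: "0 \<le> holder_seminorm \<alpha> (multi_deriv \<gamma> v)" if "\<gamma> \<in> ?E" for \<gamma>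
    using bdd[OF that] by (rule holder_seminorm_nonneg)
  have S: "0 \<le> ?S" by (intro sum_nonneg sup_nonneg)
  have H: "0 \<le> ?H" by (intro sum_nonneg semi_nonneg)
  show "0 \<le> N" using S H by (simp add: N)
  show "\<bar>iter_partial is v x\<bar> \<le> N" if le: "length is \<le> k"
  proof -
    obtain \<gamma> where \<gamma>: "multi_order \<gamma> = length is" "multi_deriv \<gamma> v = iter_partial is v"
      by (rule iter_partial_multi_deriv[OF v'(1) cont_diff_mono[OF v'(2) le]])
    then have "\<gamma> \<in> ?L" using le by simp
    have "\<bar>multi_deriv \<gamma> v x\<bar> \<le> torus_sup_norm (multi_deriv \<gamma> v)"
      using \<open>\<gamma> \<in> ?L\<close> deriv by (intro abs_le_torus_sup_norm) auto
    also have "\<dots> \<le> ?S"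
      using \<open>\<gamma> \<in> ?L\<close> by (intro member_le_sum sup_nonneg finite_multi_order) auto
    finally show ?thesis using H by (simp add: N \<gamma>(2))
  qed
  show "\<bar>iter_partial is v x - iter_partial is v y\<bar> \<le> N * norm (x - y) powr \<alpha>" if eq: "length is = k"
  proof -
    obtain \<gamma> where \<gamma>: "multi_order \<gamma> = length is" "multi_deriv \<gamma> v = iter_partial is v"
      by (rule iter_partial_multi_deriv[OF v'(1), of "is"]) (simp_all add: v'(2) eq)
    then have "\<gamma> \<in> ?E" using eq by simp
    have "\<bar>multi_deriv \<gamma> v x - multi_deriv \<gamma> v y\<bar> \<le> holder_seminorm \<alpha> (multi_deriv \<gamma> v) * norm (x - y) powr \<alpha>"
      using \<open>\<gamma> \<in> ?E\<close> deriv bdd \<open>0 < \<alpha>\<close> by (intro holder_seminorm_holder) auto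
    also have "\<dots> \<le> N * norm (x - y) powr \<alpha>"
    proof (rule mult_right_mono)
      have "holder_seminorm \<alpha> (multi_deriv \<gamma> v) \<le> ?H"
        using \<open>\<gamma> \<in> ?E\<close> finE by (intro member_le_sum semi_nonneg) auto
      then show "holder_seminorm \<alpha> (multi_deriv \<gamma> v) \<le> N" using S by (simp add: N)
    qed simp
    finally show ?thesis by (simp add: \<gamma>(2))
  qed
qed

lemma torus_holderI:
  fixes w :: "real ^ 'n \<Rightarrow> real"
  assumes w: "torus_periodic w" "cont_diff l w" and "0 < \<beta>" "0 \<le> S" "0 \<le> H"
    and S: "\<And>is x. length is \<le> l \<Longrightarrow> \<bar>iter_partial is w x\<bar> \<le> S"
    and H: "\<And>is x y. length is = l \<Longrightarrow> \<bar>iter_partial is w x - iter_partial is w y\<bar> \<le> H * norm (x - y) powr \<beta>"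
  shows "w \<in> torus_holder l \<beta>"
    and "torus_holder_norm l \<beta> w \<le> real (card {\<gamma> :: nat ^ 'n. multi_order \<gamma> \<le> l}) * S +
      real (card {\<gamma> :: nat ^ 'n. multi_order \<gamma> = l}) * H"
proof -
  have semi: "bdd_above (holder_quotients \<beta> (multi_deriv \<gamma> w))" "holder_seminorm \<beta> (multi_deriv \<gamma> w) \<le> H"
    if "multi_order \<gamma> = l" for \<gamma>
  proof -
    obtain js where js: "length js = multi_order \<gamma>" "multi_deriv \<gamma> w = iter_partial js w"
      by (rule multi_deriv_list[of \<gamma>]) blast
    have "torus_periodic (multi_deriv \<gamma> w)"
      using torus_periodic_iter_partial[OF w(2) _ w(1), of js] js that by simp
    then show "bdd_above (holder_quotients \<beta> (multi_deriv \<gamma> w))" "holder_seminorm \<beta> (multi_deriv \<gamma> w) \<le> H"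
      using holder_seminorm_le[of "multi_deriv \<gamma> w" \<beta> H] H[of js] js that assms by auto
  qed
  show "w \<in> torus_holder l \<beta>"
    using w semi(1) by (simp add: torus_holder_def)
  have sup: "torus_sup_norm (multi_deriv \<gamma> w) \<le> S" if "multi_order \<gamma> \<le> l" for \<gamma>
  proof -
    obtain js where js: "length js = multi_order \<gamma>" "multi_deriv \<gamma> w = iter_partial js w"
      by (rule multi_deriv_list[of \<gamma>]) blast
    show ?thesis using S[of js] js that by (intro torus_sup_norm_le) simp
  qed
  show "torus_holder_norm l \<beta> w \<le> real (card {\<gamma> :: nat ^ 'n. multi_order \<gamma> \<le> l}) * S +
      real (card {\<gamma> :: nat ^ 'n. multi_order \<gamma> = l}) * H"
    unfolding torus_holder_norm_def
    by (intro add_mono sum_bounded_above) (auto intro: sup semi(2))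
qed

section \<open>Hoelder regularity\<close>

text \<open>All derivatives up to order l obey one integrable bound, so differentiation under the
  integral can be repeated.\<close>

lemma iter_partial_levy_op:
  fixes f :: "real ^ 'n \<Rightarrow> real"
  assumes \<sigma>: "0 < \<sigma>" "\<sigma> < 1" "2 * \<sigma> < a" and f: "cont_diff l f"
    and bnd: "\<And>is. length is \<le> l \<Longrightarrow> second_diff_bound a A (iter_partial is f)"
  shows "length is + m \<le> l \<Longrightarrow> cont_diff m (levy_op \<sigma> (iter_partial is f))"
    and "length is \<le> l \<Longrightarrow> iter_partial is (levy_op \<sigma> f) = levy_op \<sigma> (iter_partial is f)"
proof -
  have cont: "continuous_on UNIV (levy_op \<sigma> (iter_partial is f))" if "length is \<le> l" for "is"
    by (rule continuous_on_levy_op[OF \<sigma> continuous_on_iter_partial[OF f that] bnd[OF that]])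
  have D: "has_partial i (levy_op \<sigma> (iter_partial is f)) (levy_op \<sigma> (iter_partial (i # is) f))"
    if "length is < l" for i "is"
  proof -
    have le: "length is \<le> l" "length (i # is) \<le> l" using that by auto
    show ?thesis
      by (rule has_partial_levy_op[OF \<sigma> has_partial_iter_partial[OF f that]
            continuous_on_iter_partial[OF f le(1)] continuous_on_iter_partial[OF f le(2)] bnd[OF le(1)] bnd[OF le(2)]])
  qed
  show "cont_diff m (levy_op \<sigma> (iter_partial is f))" if "length is + m \<le> l"
    using that
  proof (induction m arbitrary: "is")
    case (Suc m)
    show ?case
    proof (rule cont_diff_SucI)
      show "cont_diff m (levy_op \<sigma> (iter_partial (i # is) f))" for i
        using Suc.prems by (intro Suc.IH) simp
      show "has_partial i (levy_op \<sigma> (iter_partial is f)) (levy_op \<sigma> (iter_partial (i # is) f))" for i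
        using Suc.prems by (intro D) simp
      show "continuous_on UNIV (levy_op \<sigma> (iter_partial is f))"
        using Suc.prems by (intro cont) simp
    qed
  qed (use cont in simp)
  show "iter_partial is (levy_op \<sigma> f) = levy_op \<sigma> (iter_partial is f)" if "length is \<le> l"
    using that
  proof (induction "is")
    case (Cons i "is")
    then show ?case using partial_along_eqI[OF D[of "is" i]] by simp
  qed simp
qed

text \<open>Both bounds have total homogeneity p + a in h and y, and they coincide at |y| =
  |h|.\<close>

definition increment_bound :: "real \<Rightarrow> real \<Rightarrow> real \<Rightarrow> real \<Rightarrow> ('a::real_normed_vector \<Rightarrow> real) \<Rightarrow> bool" where
  "increment_bound p a b B f \<longleftrightarrow>
     (\<forall>x y h. \<bar>second_diff f y (x + h) - second_diff f y x\<bar> \<le> B * norm h powr p * norm y powr a \<and>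
        \<bar>second_diff f y (x + h) - second_diff f y x\<bar> \<le> B * norm h powr (p + a - b) * norm y powr b)"

lemma increment_bound_mono:
  assumes "increment_bound p a b B f" "B \<le> B'"
  shows "increment_bound p a b B' f"
proof -
  have "B * norm h powr s * norm y powr t \<le> B' * norm h powr s * norm y powr t" for s t h y
    using assms(2) by (intro mult_right_mono) auto
  then show ?thesis
    using assms(1) unfolding increment_bound_def by (blast intro: order_trans)
qed

text \<open>After factoring out B * |h| powr p the two increment bounds leave exactly the minimum in
  \<open>levy_measure_min_bound\<close> with r = |h|. The constant is independent of f.\<close>

lemma levy_op_holder:
  assumes \<sigma>: "0 < \<sigma>" "\<sigma> < 1" "2 * \<sigma> < a" and b: "b < 2 * \<sigma>"
  obtains C where "C > 0" "\<And>(f :: real ^ 'n \<Rightarrow> real) A B x h.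
      continuous_on UNIV f \<Longrightarrow> second_diff_bound a A f \<Longrightarrow> 0 \<le> B \<Longrightarrow>
      increment_bound p a b B f \<Longrightarrow>
      \<bar>levy_op \<sigma> f (x + h) - levy_op \<sigma> f x\<bar> \<le> C * B * norm h powr (p + a - 2 * \<sigma>)"
proof -
  obtain C where C: "C > 0" "\<And>r. r > 0 \<Longrightarrow>
    (\<integral>\<^sup>+p. ennreal (min (norm (levy_jump p :: real ^ 'n) powr a) (r powr (a - b) * norm (levy_jump p) powr b)) \<partial>levy_measure \<sigma>)
      \<le> ennreal (C * r powr (a - 2 * \<sigma>))"
    by (rule levy_measure_min_bound[OF \<sigma> b]) (rule that)
  have pos: "0 < levy_const \<sigma>" using levy_const_pos \<sigma> by blast
  have "\<bar>levy_op \<sigma> f (x + h) - levy_op \<sigma> f x\<bar> \<le> (C / (2 * levy_const \<sigma>)) * B * norm h powr (p + a - 2 * \<sigma>)"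
    if f: "continuous_on UNIV f" "second_diff_bound a A f" and "0 \<le> B"
      and inc: "increment_bound p a b B f"
    for f :: "real ^ 'n \<Rightarrow> real" and A B x h
  proof (cases "h = 0")
    case False
    let ?d = "\<lambda>q. second_diff f (levy_jump q) (x + h) - second_diff f (levy_jump q) x"
    let ?m = "\<lambda>q. min (norm (levy_jump q :: real ^ 'n) powr a) (norm h powr (a - b) * norm (levy_jump q :: real ^ 'n) powr b)"
    note int = integrable_second_diff[OF \<sigma> f]
    have "ennreal (norm (LINT q|levy_measure \<sigma>. ?d q)) \<le> (\<integral>\<^sup>+q. ennreal (norm (?d q)) \<partial>levy_measure \<sigma>)"
      using int by (intro integral_norm_bound_ennreal Bochner_Integration.integrable_diff)
    also have "\<dots> \<le> (\<integral>\<^sup>+q. ennreal (B * norm h powr p) * ennreal (?m q) \<partial>levy_measure \<sigma>)"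
    proof (rule nn_integral_mono)
      fix q :: "real \<times> ('n \<Rightarrow> real)"
      let ?c = "B * norm h powr p"
      let ?u = "norm (levy_jump q :: real ^ 'n) powr a" and ?w = "norm (levy_jump q :: real ^ 'n) powr b"
      have inc': "norm (?d q) \<le> B * norm h powr p * ?u" "norm (?d q) \<le> B * norm h powr (p + a - b) * ?w"
        using inc unfolding increment_bound_def real_norm_def by blast+
      have "norm h powr (p + a - b) = norm h powr p * norm h powr (a - b)"
        by (simp add: powr_add[symmetric] add_diff_eq)
      then have "norm (?d q) \<le> ?c * (norm h powr (a - b) * ?w)"
        using inc'(2) by (simp add: mult.assoc)
      moreover have "norm (?d q) \<le> ?c * ?u"
        using inc'(1) by simp
      ultimately have "norm (?d q) \<le> ?c * ?m q"
        unfolding min_def by (simp split: if_split)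
      then show "ennreal (norm (?d q)) \<le> ennreal ?c * ennreal (?m q)"
        using \<open>0 \<le> B\<close> by (simp add: ennreal_mult[symmetric] ennreal_leI)
    qed
    also have "\<dots> = ennreal (B * norm h powr p) * (\<integral>\<^sup>+q. ennreal (?m q) \<partial>levy_measure \<sigma>)"
      by (rule nn_integral_cmult) measurable
    also have "\<dots> \<le> ennreal (B * norm h powr p) * ennreal (C * norm h powr (a - 2 * \<sigma>))"
      using False by (intro mult_left_mono C(2)) auto
    also have "\<dots> = ennreal (C * B * norm h powr (p + a - 2 * \<sigma>))"
    proof -
      have "norm h powr (p + a - 2 * \<sigma>) = norm h powr p * norm h powr (a - 2 * \<sigma>)"
        by (simp add: powr_add[symmetric] add_diff_eq)
      then show ?thesis
        using \<open>0 \<le> B\<close> C(1) by (simp add: ennreal_mult[symmetric] mult_ac)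
    qed
    finally have "norm (LINT q|levy_measure \<sigma>. ?d q) \<le> C * B * norm h powr (p + a - 2 * \<sigma>)"
      using \<open>0 \<le> B\<close> C(1) by (subst (asm) ennreal_le_iff) auto
    moreover have "levy_op \<sigma> f (x + h) - levy_op \<sigma> f x = (LINT q|levy_measure \<sigma>. ?d q) / (2 * levy_const \<sigma>)"
      using int by (simp add: levy_op_def diff_divide_distrib)
    ultimately show ?thesis
      using pos by (simp add: divide_right_mono)
  qed simp
  then show thesis
    using that[of "C / (2 * levy_const \<sigma>)"] C(1) pos by simp
qed

lemma levy_op_in_torus_holder:
  assumes \<sigma>: "0 < \<sigma>" "\<sigma> < 1" "2 * \<sigma> < a" and "a \<le> 2" "b < 2 * \<sigma>" "0 < p + a - 2 * \<sigma>"
  obtains C where "0 \<le> C" "\<And>(v :: real ^ 'n \<Rightarrow> real) N. torus_periodic v \<Longrightarrow> cont_diff l v \<Longrightarrow> 0 \<le> N \<Longrightarrow>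
      (\<And>is. length is \<le> l \<Longrightarrow> second_diff_bound a N (iter_partial is v)) \<Longrightarrow>
      (\<And>is. length is = l \<Longrightarrow> increment_bound p a b N (iter_partial is v)) \<Longrightarrow>
      levy_op \<sigma> v \<in> torus_holder l (p + a - 2 * \<sigma>) \<and>
      distr_given_by (frac_laplacian_distr \<sigma> v) (levy_op \<sigma> v) \<and>
      torus_holder_norm l (p + a - 2 * \<sigma>) (levy_op \<sigma> v) \<le> C * N"
proof -
  define \<beta> where "\<beta> = p + a - 2 * \<sigma>"
  obtain C where C: "C > 0" "\<And>(f :: real ^ 'n \<Rightarrow> real) A B x h.
      continuous_on UNIV f \<Longrightarrow> second_diff_bound a A f \<Longrightarrow> 0 \<le> B \<Longrightarrow>
      increment_bound p a b B f \<Longrightarrow>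
      \<bar>levy_op \<sigma> f (x + h) - levy_op \<sigma> f x\<bar> \<le> C * B * norm h powr (p + a - 2 * \<sigma>)"
    using levy_op_holder[OF \<sigma> \<open>b < 2 * \<sigma>\<close>, where p = p and 'n = 'n] by blast
  define M where "M = levy_mass TYPE('n) \<sigma> a"
  have "0 \<le> M" unfolding M_def using \<sigma> by (intro levy_mass_nonneg)
  \<comment> \<open>The norm has c1 sup norms, each at most M * N, and c2 seminorms, each at most C
    * N.\<close>
  define c1 where "c1 = real (card {\<gamma> :: nat ^ 'n. multi_order \<gamma> \<le> l})"
  define c2 where "c2 = real (card {\<gamma> :: nat ^ 'n. multi_order \<gamma> = l})"
  have main: "levy_op \<sigma> v \<in> torus_holder l \<beta> \<and>
      distr_given_by (frac_laplacian_distr \<sigma> v) (levy_op \<sigma> v) \<and>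
      torus_holder_norm l \<beta> (levy_op \<sigma> v) \<le> (c1 * M + c2 * C) * N"
    if v: "torus_periodic v" "cont_diff l v" and "0 \<le> N"
      and bnd: "\<And>is. length is \<le> l \<Longrightarrow> second_diff_bound a N (iter_partial is v)"
      and inc: "\<And>is. length is = l \<Longrightarrow> increment_bound p a b N (iter_partial is v)"
    for v :: "real ^ 'n \<Rightarrow> real" and N
  proof -
    note L = iter_partial_levy_op[OF \<sigma> v(2) bnd]
    have per: "torus_periodic (levy_op \<sigma> v)" by (rule torus_periodic_levy_op[OF v(1)])
    have cd: "cont_diff l (levy_op \<sigma> v)" using L(1)[of "[]" l] by simp
    have sup: "\<bar>iter_partial is (levy_op \<sigma> v) x\<bar> \<le> N * M" if le: "length is \<le> l" for "is" x
      using norm_levy_op_le[OF \<sigma> continuous_on_iter_partial[OF v(2) le] bnd[OF le], of x]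
      by (simp add: L(2)[OF _ le] M_def)
    have hold: "\<bar>iter_partial is (levy_op \<sigma> v) x - iter_partial is (levy_op \<sigma> v) y\<bar> \<le> C * N * norm (x - y) powr \<beta>"
      if eq: "length is = l" for "is" x y
    proof -
      have le: "length is \<le> l" using eq by simp
      have "\<bar>levy_op \<sigma> (iter_partial is v) (y + (x - y)) - levy_op \<sigma> (iter_partial is v) y\<bar>
          \<le> C * N * norm (x - y) powr (p + a - 2 * \<sigma>)"
        by (rule C(2)[OF continuous_on_iter_partial[OF v(2) le] bnd[OF le] \<open>0 \<le> N\<close> inc[OF eq]])
      then show ?thesis by (simp add: L(2)[OF _ le] \<beta>_def)
    qed
    have nonneg: "0 < \<beta>" "0 \<le> N * M" "0 \<le> C * N"
      using assms \<open>0 \<le> N\<close> \<open>0 \<le> M\<close> C(1) by (simp_all add: \<beta>_def)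
    have "second_diff_bound a N v" using bnd[of "[]"] by simp
    then have "distr_given_by (frac_laplacian_distr \<sigma> v) (levy_op \<sigma> v)"
      by (rule frac_laplacian_distr_given_by_levy_op[OF \<sigma> \<open>a \<le> 2\<close> cont_diff_continuous[OF v(2)] v(1)])
    moreover have "levy_op \<sigma> v \<in> torus_holder l \<beta>"
      by (rule torus_holderI(1)[OF per cd nonneg sup hold])
    moreover have "torus_holder_norm l \<beta> (levy_op \<sigma> v) \<le> c1 * (N * M) + c2 * (C * N)"
      unfolding c1_def c2_def by (rule torus_holderI(2)[OF per cd nonneg sup hold])
    ultimately show ?thesis by (simp add: algebra_simps)
  qed
  have "0 \<le> c1 * M + c2 * C" using \<open>0 \<le> M\<close> C(1) by (simp add: c1_def c2_def)
  then show thesis using main unfolding \<beta>_def by (rule that)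
qed

section \<open>Second differences of Hoelder functions and their increments\<close>

lemma abs_second_diff_le:
  fixes f :: "'a :: real_vector \<Rightarrow> real"
  shows "\<bar>second_diff f y x\<bar> \<le> \<bar>f x - f (x + y)\<bar> + \<bar>f x - f (x - y)\<bar>"
  by (simp add: second_diff_def)

context
  fixes v :: "real ^ 'n \<Rightarrow> real" and k :: nat and \<alpha> N n c :: real
  assumes v: "v \<in> torus_holder k \<alpha>" and \<alpha>: "0 < \<alpha>" "\<alpha> \<le> 1"
    and N_def: "N = torus_holder_norm k \<alpha> v"
    and n_def: "n = real CARD('n)" and c_def: "c = n + 2"
begin

lemma holder_consts: "0 \<le> N" "1 \<le> n" "1 \<le> c"
  using torus_holder_norm_bounds(1)[OF v \<alpha>(1)] by (simp_all add: N_def n_def c_def Suc_leI)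

lemma iter_partial_bound: "length is \<le> k \<Longrightarrow> \<bar>iter_partial is v x\<bar> \<le> N"
  unfolding N_def by (rule torus_holder_norm_bounds(2)[OF v \<alpha>(1)])

lemma iter_partial_lipschitz:
  assumes "length is < k"
  shows "\<bar>iter_partial is v x - iter_partial is v y\<bar> \<le> n * N * norm (x - y)"
  using has_partial_lipschitz[OF has_partial_iter_partial[OF torus_holderD(2)[OF v] assms], of N x y]
    iter_partial_bound[of "_ # is"] assms by (simp add: n_def del: iter_partial.simps)

text \<open>Below the top order the derivative is Lipschitz with constant n * N, enough for |x - y|
  \<le> 1, and farther apart 2 * N suffices. Both constants are at most c * N, hence c = n +
  2.\<close>

lemma iter_partial_holder:
  assumes le: "length is \<le> k"
  shows "\<bar>iter_partial is v x - iter_partial is v y\<bar> \<le> c * N * norm (x - y) powr \<alpha>"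
proof (cases "length is = k")
  case True
  have "\<bar>iter_partial is v x - iter_partial is v y\<bar> \<le> N * norm (x - y) powr \<alpha>"
    unfolding N_def by (rule torus_holder_norm_bounds(3)[OF v \<alpha>(1) True])
  also have "\<dots> \<le> c * N * norm (x - y) powr \<alpha>"
    using holder_consts mult_right_mono[of 1 c N] by (intro mult_right_mono) auto
  finally show ?thesis .
next
  case False
  have "\<bar>iter_partial is v x - iter_partial is v y\<bar> \<le> n * N * norm (x - y)"
    using False le by (intro iter_partial_lipschitz) simp
  moreover have "\<bar>iter_partial is v x - iter_partial is v y\<bar> \<le> 2 * N"
    using iter_partial_bound[OF le, of x] iter_partial_bound[OF le, of y] by linarith
  moreover have "n * N * norm (x - y) \<le> c * N * norm (x - y) powr \<alpha>" if "norm (x - y) \<le> 1"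
  proof (cases "x = y")
    case False
    then have "norm (x - y) powr 1 \<le> norm (x - y) powr \<alpha>"
      using that \<alpha> by (intro powr_mono') auto
    then show ?thesis using holder_consts by (intro mult_mono) (auto simp: c_def)
  qed simp
  moreover have "2 * N \<le> c * N * norm (x - y) powr \<alpha>" if "\<not> norm (x - y) \<le> 1"
  proof -
    have "1 \<le> norm (x - y) powr \<alpha>" using that \<alpha> by (intro ge_one_powr_ge_zero) auto
    then have "(2 * N) * 1 \<le> (c * N) * norm (x - y) powr \<alpha>"
      using holder_consts by (intro mult_mono) (auto simp: c_def)
    then show ?thesis by simp
  qed
  ultimately show ?thesis by linarith
qed

lemma second_diff_order0:
  assumes le: "length is \<le> k"
  shows "\<bar>second_diff (iter_partial is v) y x\<bar> \<le> 2 * (c * N) * norm y powr \<alpha>"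
  using abs_second_diff_le[of "iter_partial is v" y x] iter_partial_holder[OF le, of x "x + y"]
    iter_partial_holder[OF le, of x "x - y"] by simp

lemma second_diff_order1:
  assumes "length is < k"
  shows "\<bar>second_diff (iter_partial is v) y x\<bar> \<le> 2 * n * (c * N) * norm y powr (1 + \<alpha>)"
  using second_diff_taylor[OF has_partial_iter_partial[OF torus_holderD(2)[OF v] assms] \<alpha>(1), of "c * N" y x]
    iter_partial_holder[of "_ # is"] holder_consts assms by (simp add: n_def del: iter_partial.simps)

text \<open>Two spare derivatives make the next partials Lipschitz, and Taylor with Hoelder exponent
  1 gives the square.\<close>

lemma second_diff_order2:
  assumes "Suc (length is) < k"
  shows "\<bar>second_diff (iter_partial is v) y x\<bar> \<le> 2 * n * (n * N) * norm y powr 2"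
proof -
  have "length is < k" using assms by simp
  from second_diff_taylor[OF has_partial_iter_partial[OF torus_holderD(2)[OF v] this], of 1 "n * N" y x]
  show ?thesis
    using iter_partial_lipschitz[of "_ # is"] holder_consts assms by (simp add: n_def del: iter_partial.simps)
qed

lemma second_diff_increment0:
  assumes le: "length is \<le> k"
  shows "\<bar>second_diff (iter_partial is v) y (x + h) - second_diff (iter_partial is v) y x\<bar> \<le> 4 * (c * N) * norm h powr \<alpha>"
proof -
  let ?f = "iter_partial is v"
  have *: "\<bar>?f (x + h) - ?f x\<bar> \<le> c * N * norm h powr \<alpha>" for x
    using iter_partial_holder[OF le, of "x + h" x] by simp
  \<comment> \<open>The increment in h is taken at x, x + y and x - y separately; the weights 2, 1,
    1 give the factor 4.\<close>
  have "\<bar>2 * p - q - r\<bar> \<le> 4 * E" if "\<bar>p\<bar> \<le> E" "\<bar>q\<bar> \<le> E" "\<bar>r\<bar> \<le> E" for p q r E :: real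
    using that by linarith
  from this[OF *[of x] *[of "x + y"] *[of "x - y"]]
  have "\<bar>2 * (?f (x + h) - ?f x) - (?f (x + y + h) - ?f (x + y)) - (?f (x - y + h) - ?f (x - y))\<bar> \<le>
      4 * (c * N * norm h powr \<alpha>)" .
  moreover have "x + h + y = x + y + h" "x + h - y = x - y + h" by simp_all
  ultimately show ?thesis
    unfolding second_diff_def by (simp only: real_scaleR_def) (simp add: algebra_simps)
qed

text \<open>A derivative of a second difference is the second difference of the derivative, so one
  derivative is traded for one power of |h|.\<close>

lemma second_diff_increment1:
  assumes "length is < k" and S: "\<And>i x. \<bar>second_diff (iter_partial (i # is) v) y x\<bar> \<le> S"
  shows "\<bar>second_diff (iter_partial is v) y (x + h) - second_diff (iter_partial is v) y x\<bar> \<le> n * S * norm h"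
proof -
  have "norm (second_diff (iter_partial is v) y (x + h) - second_diff (iter_partial is v) y x)
      \<le> real CARD('n) * S * norm ((x + h) - x)"
    by (rule has_partial_lipschitz[OF has_partial_second_diff[OF has_partial_iter_partial[OF torus_holderD(2)[OF v] assms(1)]]])
       (use S in simp)
  then show ?thesis by (simp add: n_def)
qed

text \<open>Exchange the two differences: the increment in h has second derivatives of size |h| powr
  \<alpha>, hence Lipschitz first derivatives, and Taylor in y yields the square.\<close>

lemma second_diff_increment2:
  assumes "Suc (length is) < k"
  shows "\<bar>second_diff (iter_partial is v) y (x + h) - second_diff (iter_partial is v) y x\<bar> \<le>
    2 * n * (n * (c * N)) * norm h powr \<alpha> * norm y powr 2"
proof -
  note v' = torus_holderD(2)[OF v]
  have le: "length is < k" "length (i # is) < k" "length (j # i # is) \<le> k" for i j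
    using assms by auto
  let ?D = "\<lambda>f x. f (x + h) - f x :: real"
  have D: "has_partial i (?D (iter_partial is v)) (?D (iter_partial (i # is) v))" if "length is < k" for i "is"
    by (intro has_partial_diff has_partial_shift has_partial_iter_partial[OF v' that])
  have "norm (second_diff (?D (iter_partial is v)) y x) \<le>
      2 * real CARD('n) * (n * (c * N * norm h powr \<alpha>)) * norm y powr (1 + 1)"
  proof (rule second_diff_taylor[OF D[OF le(1)]])
    show "norm (?D (iter_partial (i # is) v) x - ?D (iter_partial (i # is) v) y) \<le>
        n * (c * N * norm h powr \<alpha>) * norm (x - y) powr 1" for i x y
    proof -
      have "norm (?D (iter_partial (i # is) v) x - ?D (iter_partial (i # is) v) y) \<le>
          real CARD('n) * (c * N * norm h powr \<alpha>) * norm (x - y)"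
      proof (rule has_partial_lipschitz[OF D[OF le(2)]])
        show "norm (?D (iter_partial (j # i # is) v) z) \<le> c * N * norm h powr \<alpha>" for j z
          using iter_partial_holder[OF le(3)[of j i], of "z + h" z] by simp
      qed
      then show ?thesis by (simp add: n_def)
    qed
  qed (use holder_consts in auto)
  moreover have "second_diff (?D f) y x = second_diff f y (x + h) - second_diff f y x" for f :: "real ^ 'n \<Rightarrow> real"
    by (simp add: second_diff_def algebra_simps)
  ultimately show ?thesis by (simp add: n_def mult_ac)
qed

end

section \<open>The mapping property for every admissible order\<close>

theorem frac_laplacian_holder:
  fixes \<sigma> \<alpha> :: real
  assumes \<sigma>: "0 < \<sigma>" "\<sigma> < 1" and \<alpha>: "0 < \<alpha>" "\<alpha> \<le> 1"
    and \<beta>: "0 < \<beta>" "\<beta> < 1" "real k + \<alpha> - 2 * \<sigma> = real l + \<beta>"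
  shows "\<exists>C::real. \<forall>v :: real ^ 'n \<Rightarrow> real. v \<in> torus_holder k \<alpha> \<longrightarrow>
    (\<exists>w \<in> torus_holder l \<beta>. distr_given_by (frac_laplacian_distr \<sigma> v) w \<and>
       torus_holder_norm l \<beta> w \<le> C * torus_holder_norm k \<alpha> v)"
proof -
  define n where "n = real CARD('n)"
  define c where "c = n + 2"
  \<comment> \<open>The first summand majorises the constants of all three cases; the 4 pays for the
    sup norm term in \<open>second_diff_boundI\<close>.\<close>
  define K where "K = 4 * (n * (n * c)) + 4"
  have n: "1 \<le> n" and c: "1 \<le> c" by (simp_all add: n_def c_def Suc_leI)
  have nc: "c \<le> n * c" "n * c \<le> n * (n * c)" "n * n \<le> n * (n * c)"
  proof -
    show "c \<le> n * c" using mult_right_mono[OF n, of c] c by simp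
    then show "n * c \<le> n * (n * c)" using n by (intro mult_left_mono) auto
    have "n * 1 \<le> n * c" using n c by (intro mult_left_mono) auto
    then show "n * n \<le> n * (n * c)" using n by (intro mult_left_mono) auto
  qed
  have "K \<ge> 0" using nc n c by (simp add: K_def)
  have real_kl: "real k - real l = 2 * \<sigma> - \<alpha> + \<beta>" using \<beta> by simp
  then have "- 1 < real k - real l" "real k - real l < 3" using assms by linarith+
  then consider "k = l" | "k = Suc l" | "k = Suc (Suc l)" by linarith
  then obtain a b p where abp: "2 * \<sigma> < a" "a \<le> 2" "b < 2 * \<sigma>" "p + a - 2 * \<sigma> = \<beta>"
    and bounds: "\<And>(v :: real ^ 'n \<Rightarrow> real) is x y. v \<in> torus_holder k \<alpha> \<Longrightarrow> length is \<le> l \<Longrightarrow>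
        \<bar>second_diff (iter_partial is v) y x\<bar> \<le> 4 * (n * (n * c)) * torus_holder_norm k \<alpha> v * norm y powr a"
      "\<And>(v :: real ^ 'n \<Rightarrow> real) is. v \<in> torus_holder k \<alpha> \<Longrightarrow> length is = l \<Longrightarrow>
        increment_bound p a b (4 * (n * (n * c)) * torus_holder_norm k \<alpha> v) (iter_partial is v)"
  proof cases
    case 1
    show ?thesis
    \<comment> \<open>No spare derivative: \<beta> = \<alpha> - 2\<sigma> > 0 gives a > 2\<sigma>,
      and \<sigma> > 0 gives b < 2\<sigma>.\<close>
    proof (rule that[of \<alpha> 0 0])
      fix v :: "real ^ 'n \<Rightarrow> real" and "is" assume v: "v \<in> torus_holder k \<alpha>"
      let ?N = "torus_holder_norm k \<alpha> v" and ?f = "iter_partial is v"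
      let ?B = "4 * (n * (n * c)) * ?N"
      note hyps = v \<alpha> refl n_def c_def
      have N: "0 \<le> ?N" using holder_consts[OF hyps] by simp
      have le: "2 * (c * ?N) \<le> ?B" "4 * (c * ?N) \<le> ?B"
        using mult_right_mono[OF order_trans[OF nc(1,2)] N] N c by (simp_all add: mult.assoc)
      have sd: "\<bar>second_diff ?f y x\<bar> \<le> 2 * (c * ?N) * norm y powr \<alpha>" if "length is \<le> l" for x y
        using that 1 by (intro second_diff_order0[OF hyps]) simp
      show "\<bar>second_diff ?f y x\<bar> \<le> ?B * norm y powr \<alpha>" if "length is \<le> l" for x y
        by (rule order_trans[OF sd[OF that] mult_right_mono[OF le(1)]]) simp
      assume eq: "length is = l"
      show "increment_bound 0 \<alpha> 0 ?B ?f"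
        unfolding increment_bound_def
      proof (intro allI conjI)
        fix x y h :: "real ^ 'n"
        let ?d = "\<bar>second_diff ?f y (x + h) - second_diff ?f y x\<bar>"
        have "?d \<le>
            2 * (c * ?N) * norm y powr \<alpha> + 2 * (c * ?N) * norm y powr \<alpha>"
          using sd[of y "x + h"] sd[of y x] eq by linarith
        also have "\<dots> = 4 * (c * ?N) * norm y powr \<alpha>" by simp
        also have "\<dots> \<le> ?B * norm y powr \<alpha>"
          by (intro mult_right_mono le(2)) simp
        \<comment> \<open>Since \<open>0 powr 0 = 0\<close>, h = 0 is separated; the increment
          vanishes there. The same happens below at y = 0.\<close>
        finally show "?d \<le> ?B * norm h powr 0 * norm y powr \<alpha>"
          by (cases "h = 0") auto
        have "?d \<le> 4 * (c * ?N) * norm h powr \<alpha>"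
          using eq 1 by (intro second_diff_increment0[OF hyps]) simp
        also have "\<dots> \<le> ?B * norm h powr \<alpha>"
          by (intro mult_right_mono le(2)) simp
        finally show "?d \<le> ?B * norm h powr (0 + \<alpha> - 0) * norm y powr 0"
          by (cases "y = 0") auto
      qed
    qed (use 1 assms in auto)
  next
    case 2
    show ?thesis
    \<comment> \<open>One spare derivative: \<beta> = 1 + \<alpha> - 2\<sigma>, so \<beta> > 0 is a
      > 2\<sigma> and \<beta> < 1 is b < 2\<sigma>.\<close>
    proof (rule that[of "1 + \<alpha>" \<alpha> 0])
      fix v :: "real ^ 'n \<Rightarrow> real" and "is" assume v: "v \<in> torus_holder k \<alpha>"
      let ?N = "torus_holder_norm k \<alpha> v" and ?f = "iter_partial is v"
      let ?B = "4 * (n * (n * c)) * ?N"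
      note hyps = v \<alpha> refl n_def c_def
      have N: "0 \<le> ?N" using holder_consts[OF hyps] by simp
      have nonneg: "0 \<le> n * (c * ?N)" using n c N by simp
      have le4: "4 * n * (c * ?N) \<le> ?B"
        using mult_right_mono[OF nc(2) N] by (simp add: mult.assoc)
      have le2: "2 * n * (c * ?N) \<le> ?B"
      proof -
        have "2 * n * (c * ?N) = 2 * (n * (c * ?N))" "4 * n * (c * ?N) = 4 * (n * (c * ?N))" by simp_all
        then show ?thesis using le4 nonneg by linarith
      qed
      have sd: "\<bar>second_diff ?f y x\<bar> \<le> 2 * n * (c * ?N) * norm y powr (1 + \<alpha>)" if "length is \<le> l" for x y
        using that 2 by (intro second_diff_order1[OF hyps]) simp
      show "\<bar>second_diff ?f y x\<bar> \<le> ?B * norm y powr (1 + \<alpha>)" if "length is \<le> l" for x y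
        by (rule order_trans[OF sd[OF that] mult_right_mono[OF le2]]) simp
      assume eq: "length is = l"
      show "increment_bound 0 (1 + \<alpha>) \<alpha> ?B ?f"
        unfolding increment_bound_def
      proof (intro allI conjI)
        fix x y h :: "real ^ 'n"
        let ?d = "\<bar>second_diff ?f y (x + h) - second_diff ?f y x\<bar>"
        have "?d \<le>
            2 * n * (c * ?N) * norm y powr (1 + \<alpha>) + 2 * n * (c * ?N) * norm y powr (1 + \<alpha>)"
          using sd[of y "x + h"] sd[of y x] eq by linarith
        also have "\<dots> = 4 * n * (c * ?N) * norm y powr (1 + \<alpha>)" by simp
        also have "\<dots> \<le> ?B * norm y powr (1 + \<alpha>)"
          by (intro mult_right_mono le4) simp
        finally show "?d \<le> ?B * norm h powr 0 * norm y powr (1 + \<alpha>)"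
          by (cases "h = 0") auto
        have "?d \<le> n * (2 * (c * ?N) * norm y powr \<alpha>) * norm h"
          using eq 2 by (intro second_diff_increment1[OF hyps] second_diff_order0[OF hyps]) auto
        also have "\<dots> = 2 * n * (c * ?N) * (norm h * norm y powr \<alpha>)" by simp
        also have "\<dots> \<le> ?B * (norm h * norm y powr \<alpha>)"
          by (intro mult_right_mono le2) simp
        finally show "?d \<le>
            ?B * norm h powr (0 + (1 + \<alpha>) - \<alpha>) * norm y powr \<alpha>"
          by (simp add: mult.assoc)
      qed
    qed (use 2 assms in auto)
  next
    case 3
    show ?thesis
    \<comment> \<open>Two spare derivatives: \<beta> = 2 + \<alpha> - 2\<sigma>. Now a > 2\<sigma>
      comes from \<sigma> < 1, while b < 2\<sigma> is again \<beta> < 1.\<close>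
    proof (rule that[of 2 "1 + \<alpha>" \<alpha>])
      fix v :: "real ^ 'n \<Rightarrow> real" and "is" assume v: "v \<in> torus_holder k \<alpha>"
      let ?N = "torus_holder_norm k \<alpha> v" and ?f = "iter_partial is v"
      let ?B = "4 * (n * (n * c)) * ?N"
      note hyps = v \<alpha> refl n_def c_def
      have N: "0 \<le> ?N" using holder_consts[OF hyps] by simp
      have nonneg: "0 \<le> n * (n * (c * ?N))" using n c N by simp
      have eqs: "?B = 4 * (n * (n * (c * ?N)))" "2 * n * (n * ?N) = 2 * (n * (n * ?N))"
        "2 * n * (n * (c * ?N)) = 2 * (n * (n * (c * ?N)))" by simp_all
      have le: "2 * n * (n * ?N) \<le> ?B"
      proof -
        have "n * (n * ?N) = n * n * ?N" "n * (n * (c * ?N)) = n * (n * c) * ?N" by simp_all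
        then have "n * (n * ?N) \<le> n * (n * (c * ?N))" using mult_right_mono[OF nc(3) N] by (simp only:)
        then show ?thesis unfolding eqs using nonneg by linarith
      qed
      have le': "2 * n * (n * (c * ?N)) \<le> ?B"
        unfolding eqs using nonneg by linarith
      have sd: "\<bar>second_diff ?f y x\<bar> \<le> 2 * n * (n * ?N) * norm y powr 2" if "length is \<le> l" for x y
        using that 3 by (intro second_diff_order2[OF hyps]) simp
      show "\<bar>second_diff ?f y x\<bar> \<le> ?B * norm y powr 2" if "length is \<le> l" for x y
        by (rule order_trans[OF sd[OF that] mult_right_mono[OF le]]) simp
      assume eq: "length is = l"
      show "increment_bound \<alpha> 2 (1 + \<alpha>) ?B ?f"
        unfolding increment_bound_def
      proof (intro allI conjI)
        fix x y h :: "real ^ 'n"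
        let ?d = "\<bar>second_diff ?f y (x + h) - second_diff ?f y x\<bar>"
        have "?d \<le> 2 * n * (n * (c * ?N)) * norm h powr \<alpha> * norm y powr 2"
          using eq 3 by (intro second_diff_increment2[OF hyps]) simp
        also have "\<dots> \<le> ?B * norm h powr \<alpha> * norm y powr 2"
          by (intro mult_right_mono le') auto
        finally show "?d \<le> ?B * norm h powr \<alpha> * norm y powr 2" .
        have "?d \<le> n * (2 * n * (c * ?N) * norm y powr (1 + \<alpha>)) * norm h"
          using eq 3 by (intro second_diff_increment1[OF hyps] second_diff_order1[OF hyps]) auto
        also have "\<dots> = 2 * n * (n * (c * ?N)) * (norm h * norm y powr (1 + \<alpha>))" by simp
        also have "\<dots> \<le> ?B * (norm h * norm y powr (1 + \<alpha>))"
          by (intro mult_right_mono le') auto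
        finally show "?d \<le>
            ?B * norm h powr (\<alpha> + 2 - (1 + \<alpha>)) * norm y powr (1 + \<alpha>)"
          by (simp add: mult.assoc)
      qed
    qed (use 3 assms in auto)
  qed
  have "0 < p + a - 2 * \<sigma>" using abp \<beta> by simp
  from levy_op_in_torus_holder[OF \<sigma> abp(1-3) this, where 'n = 'n and l = l]
  obtain C where C: "0 \<le> C" "\<And>(v :: real ^ 'n \<Rightarrow> real) N. torus_periodic v \<Longrightarrow> cont_diff l v \<Longrightarrow> 0 \<le> N \<Longrightarrow>
      (\<And>is. length is \<le> l \<Longrightarrow> second_diff_bound a N (iter_partial is v)) \<Longrightarrow>
      (\<And>is. length is = l \<Longrightarrow> increment_bound p a b N (iter_partial is v)) \<Longrightarrow>
      levy_op \<sigma> v \<in> torus_holder l \<beta> \<and>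
      distr_given_by (frac_laplacian_distr \<sigma> v) (levy_op \<sigma> v) \<and>
      torus_holder_norm l \<beta> (levy_op \<sigma> v) \<le> C * N"
    unfolding abp(4) by blast
  have "l \<le> k"
    using \<open>- 1 < real k - real l\<close> by linarith
  have "levy_op \<sigma> v \<in> torus_holder l \<beta> \<and> distr_given_by (frac_laplacian_distr \<sigma> v) (levy_op \<sigma> v) \<and>
      torus_holder_norm l \<beta> (levy_op \<sigma> v) \<le> C * (K * torus_holder_norm k \<alpha> v)"
    if v: "v \<in> torus_holder k \<alpha>" for v :: "real ^ 'n \<Rightarrow> real"
  proof (rule C(2))
    let ?N = "torus_holder_norm k \<alpha> v"
    note N = holder_consts(1)[OF v \<alpha> refl n_def c_def]
    show "torus_periodic v" "cont_diff l v"
      using torus_holderD[OF v] \<open>l \<le> k\<close> cont_diff_mono by blast+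
    show "0 \<le> K * ?N" using \<open>K \<ge> 0\<close> N by simp
    have KN: "4 * (n * (n * c)) * ?N \<le> K * ?N" using N by (intro mult_right_mono) (auto simp: K_def)
    show "second_diff_bound a (K * ?N) (iter_partial is v)" if "length is \<le> l" for "is"
    proof -
      have "second_diff_bound a (4 * (n * (n * c)) * ?N + 4 * ?N) (iter_partial is v)"
      proof (rule second_diff_boundI)
        show "norm (second_diff (iter_partial is v) y x) \<le> 4 * (n * (n * c)) * ?N * norm y powr a" for x y
          using bounds(1)[OF v that] by simp
        show "norm (iter_partial is v x) \<le> ?N" for x
          using iter_partial_bound[OF v \<alpha> refl n_def c_def, of "is" x] that \<open>l \<le> k\<close> by simp
        show "0 \<le> 4 * (n * (n * c)) * ?N" using n c N by simp
      qed (use abp \<sigma> in auto)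
      then show ?thesis by (simp add: K_def distrib_right)
    qed
    show "increment_bound p a b (K * ?N) (iter_partial is v)" if "length is = l" for "is"
      by (rule increment_bound_mono[OF bounds(2)[OF v that] KN])
  qed
  then show ?thesis
    by (intro exI[of _ "C * K"] allI impI) (auto simp: mult.assoc)
qed

lemma floor_split:
  fixes x :: real
  assumes "int l = \<lfloor>x\<rfloor>" "x \<notin> \<int>"
  shows "real l < x \<and> x < real l + 1"
proof -
  from floor_correct[of x, folded assms(1)] have "real l \<le> x" "x < real l + 1" by simp_all
  moreover have "x \<noteq> real l" using assms(2) by auto
  ultimately show ?thesis by simp
qed

text \<open>The first three parts use (k, l) = (0, 0), (1, 1) and (1, 0). In the third, 2\<sigma>
  \<ge> \<alpha> bounds the exponent by 1, and equality means 2\<sigma> = \<alpha>, where k +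
  \<alpha> - 2\<sigma> is an integer; the stated conditions place the exponent in (0, 1).\<close>

theorem theorem2p6:
  fixes \<sigma> \<alpha> :: real
  assumes "0 < \<sigma>" and "\<sigma> < 1" and "0 < \<alpha>" and "\<alpha> \<le> 1"
  shows
    "(0 < 2 * \<sigma> \<and> 2 * \<sigma> < \<alpha> \<longrightarrow>
       (\<exists>C::real. \<forall>v :: real ^ 'n \<Rightarrow> real. v \<in> torus_holder 0 \<alpha> \<longrightarrow>
         (\<exists>w \<in> torus_holder 0 (\<alpha> - 2 * \<sigma>).
            distr_given_by (frac_laplacian_distr \<sigma> v) w \<and>
            torus_holder_norm 0 (\<alpha> - 2 * \<sigma>) w \<le> C * torus_holder_norm 0 \<alpha> v))) \<and>
     (0 < 2 * \<sigma> \<and> 2 * \<sigma> < \<alpha> \<longrightarrow>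
       (\<exists>C::real. \<forall>v :: real ^ 'n \<Rightarrow> real. v \<in> torus_holder 1 \<alpha> \<longrightarrow>
         (\<exists>w \<in> torus_holder 1 (\<alpha> - 2 * \<sigma>).
            distr_given_by (frac_laplacian_distr \<sigma> v) w \<and>
            torus_holder_norm 1 (\<alpha> - 2 * \<sigma>) w \<le> C * torus_holder_norm 1 \<alpha> v))) \<and>
     (2 * \<sigma> \<ge> \<alpha> \<and> \<alpha> - 2 * \<sigma> + 1 \<noteq> 0 \<and>
      0 < \<alpha> - 2 * \<sigma> + 1 \<and> \<alpha> - 2 * \<sigma> + 1 \<noteq> 1 \<longrightarrow>
       (\<exists>C::real. \<forall>v :: real ^ 'n \<Rightarrow> real. v \<in> torus_holder 1 \<alpha> \<longrightarrow>
         (\<exists>w \<in> torus_holder 0 (\<alpha> - 2 * \<sigma> + 1).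
            distr_given_by (frac_laplacian_distr \<sigma> v) w \<and>
            torus_holder_norm 0 (\<alpha> - 2 * \<sigma> + 1) w \<le> C * torus_holder_norm 1 \<alpha> v))) \<and>
     (\<forall>(k::nat) (l::nat) (\<beta>::real).
       real k + \<alpha> - 2 * \<sigma> \<notin> \<int> \<and> int l = \<lfloor>real k + \<alpha> - 2 * \<sigma>\<rfloor> \<and>
       \<beta> = real k + \<alpha> - 2 * \<sigma> - real l \<longrightarrow>
       (\<exists>C::real. \<forall>v :: real ^ 'n \<Rightarrow> real. v \<in> torus_holder k \<alpha> \<longrightarrow>
         (\<exists>w \<in> torus_holder l \<beta>.
            distr_given_by (frac_laplacian_distr \<sigma> v) w \<and>
            torus_holder_norm l \<beta> w \<le> C * torus_holder_norm k \<alpha> v)))"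
  by (intro conjI impI allI; rule frac_laplacian_holder) (use assms in \<open>auto dest: floor_split\<close>)

end
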